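(* Let $G$ be a finite bipartite graph on vertex set $X\sqcup Y$, and $R_G$ the unique (up to isomorphism) row-nested bipartite graph having the same row sizes, i.e. $\deg_{R_G}(x)=\deg_G(x)$ for all $x\in X$. Then $$\beta_{i,X',\bullet}(I(G))=\beta_{i,X',\bullet}(I(R_G))\quad\left(=\begin{cases}\binom{\mathrm{mindeg}(X')}{i-|X'|+2}&\text{if }|X'|<i+2,\\0&\text{otherwise}\end{cases}\right)$$ for all $i\geq 0$ and all nonempty $X'\subseteq X$ if and only if $G$ is nearly row-nested.
   Context: A bipartite graph $G$ on $X\sqcup Y$ has all edges joining $X$ to $Y$; the row of $x\in X$ is $R_x=\{y\in Y:\{x,y\}\in E(G)\}$, so $|R_x|=\deg_G(x)$. $G$ is row-nested if the collection of rows $\{R_x\}_{x\in X}$ is totally ordered by inclusion. $G$ is nearly row-nested if (a) $|R_x|<|R_{x'}|$ implies $R_x\subset R_{x'}$, and (b) for each cardinality $c\ge0$ occurring as some $|R_x|$, $\left|\bigcap_{x:|R_x|=c}R_x\right|\in\{c-1,c\}$. The graph $R_G$ has vertex set $X\sqcup Y''$ for some finite set $Y''$. $\mathrm{mindeg}(X')=\min\{\deg_G(x):x\in X'\}$. Let $k$ be a field. $I(G)\subset k[X\sqcup Y]$ is the edge ideal, generated by the monomials $xy$ for edges $\{x,y\}$ of $G$. For $X'\subseteq X$, $Y'\subseteq Y$, $\beta_{i,X'\sqcup Y'}(I)=\dim_k\mathrm{Tor}_i(I,k)_{X'\sqcup Y'}$ is the finely graded Betti number in the multidegree given by the indicator vector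 of $X'\sqcup Y'$, and $\beta_{i,X',\bullet}(I)=\sum_{Y'\subseteq Y}\beta_{i,X'\sqcup Y'}(I)$. *)

theory Defs
  imports Complex_Main "HOL-Library.Poly_Mapping" "HOL-Library.Function_Algebras"
begin

section \<open>Bipartite graphs\<close>

definition bipartite_graph :: "'v set \<Rightarrow> 'v set \<Rightarrow> 'v set set \<Rightarrow> bool" where
  "bipartite_graph X Y E \<longleftrightarrow>
     finite X \<and> finite Y \<and> X \<inter> Y = {} \<and> E \<subseteq> {{x, y} | x y. x \<in> X \<and> y \<in> Y}"

definition vdeg :: "'v set set \<Rightarrow> 'v \<Rightarrow> nat" where
  "vdeg E v = card {e \<in> E. v \<in> e}"

definition mindeg :: "'v set set \<Rightarrow> 'v set \<Rightarrow> nat" where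
  "mindeg E X' = Min (vdeg E ` X')"

definition row :: "'v set \<Rightarrow> 'v set set \<Rightarrow> 'v \<Rightarrow> 'v set" where
  "row Y E x = {y \<in> Y. {x, y} \<in> E}"

definition row_nested :: "'v set \<Rightarrow> 'v set \<Rightarrow> 'v set set \<Rightarrow> bool" where
  "row_nested X Y E \<longleftrightarrow>
     (\<forall>x\<in>X. \<forall>x'\<in>X. row Y E x \<subseteq> row Y E x' \<or> row Y E x' \<subseteq> row Y E x)"

text \<open>The cardinality condition is stated over the integers, where \<open>c - 1\<close> is not truncated.\<close>

definition nearly_row_nested :: "'v set \<Rightarrow> 'v set \<Rightarrow> 'v set set \<Rightarrow> bool" where
  "nearly_row_nested X Y E \<longleftrightarrow>
     (\<forall>x\<in>X. \<forall>x'\<in>X. card (row Y E x) < card (row Y E x') \<longrightarrow> row Y E x \<subset> row Y E x') \<and>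
     (\<forall>c \<in> (\<lambda>x. card (row Y E x)) ` X.
        int (card (\<Inter>x\<in>{x \<in> X. card (row Y E x) = c}. row Y E x)) \<in> {int c - 1, int c})"

text \<open>\<open>(Y'', R)\<close> is a choice of the graph \<open>R\<^sub>G\<close> on \<open>X \<squnion> Y''\<close>, where \<open>G\<close> has edge set \<open>E\<close>.\<close>

definition is_row_nested_companion ::
    "'v set \<Rightarrow> 'v set set \<Rightarrow> 'v set \<Rightarrow> 'v set set \<Rightarrow> bool" where
  "is_row_nested_companion X E Y'' R \<longleftrightarrow>
     bipartite_graph X Y'' R \<and> row_nested X Y'' R \<and> (\<forall>x\<in>X. vdeg R x = vdeg E x)"


section \<open>Polynomials and edge ideals\<close>

type_synonym 'v mon = "'v \<Rightarrow>\<^sub>0 nat"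
type_synonym ('v, 'k) pol = "'v mon \<Rightarrow>\<^sub>0 'k"

definition poly_ring :: "'v set \<Rightarrow> ('v, 'k::zero) pol set" where
  "poly_ring V = {p. \<forall>m \<in> Poly_Mapping.keys p. Poly_Mapping.keys m \<subseteq> V}"

definition squarefree_mon :: "'v set \<Rightarrow> 'v mon" where
  "squarefree_mon A = (\<Sum>v\<in>A. Poly_Mapping.single v 1)"

definition ideal_generated ::
    "'v set \<Rightarrow> ('v, 'k::comm_ring_1) pol set \<Rightarrow> ('v, 'k) pol set" where
  "ideal_generated V B =
     {(\<Sum>b\<in>A. q b * b) | A q. finite A \<and> A \<subseteq> B \<and> (\<forall>b\<in>A. q b \<in> poly_ring V)}"

definition edge_ideal :: "'v set \<Rightarrow> 'v set set \<Rightarrow> ('v, 'k::comm_ring_1) pol set" where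
  "edge_ideal V E =
     ideal_generated V ((\<lambda>e. Poly_Mapping.single (squarefree_mon e) 1) ` E)"


section \<open>Finely graded free resolutions and Betti numbers\<close>

text \<open>
  Data of an augmented complex of finitely generated, finely graded free modules
  \<open>\<dots> \<rightarrow> F\<^sub>1 \<rightarrow> F\<^sub>0 \<rightarrow> I\<close> over \<open>S = k[V]\<close>. The module \<open>F\<^sub>i\<close> has the basis \<open>basis F i\<close>, whose
  elements are labelled by natural numbers; the basis element \<open>j\<close> has degree \<open>fdeg F i j\<close>.
  The map \<open>F\<^sub>i\<^sub>+\<^sub>1 \<rightarrow> F\<^sub>i\<close> has the matrix \<open>bdry F i\<close> (row index in \<open>basis F i\<close>, column index in
  \<open>basis F (i + 1)\<close>), and \<open>aug F j\<close> is the image in \<open>I\<close> of the basis element \<open>j\<close> of \<open>F\<^sub>0\<close>.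
\<close>

record (overloaded) ('v, 'k) free_complex =
  basis :: "nat \<Rightarrow> nat set"
  fdeg :: "nat \<Rightarrow> nat \<Rightarrow> 'v mon"
  bdry :: "nat \<Rightarrow> nat \<Rightarrow> nat \<Rightarrow> ('v, 'k::zero) pol"
  aug :: "nat \<Rightarrow> ('v, 'k) pol"

definition chains :: "'v set \<Rightarrow> ('v, 'k::comm_ring_1) free_complex \<Rightarrow> nat \<Rightarrow> (nat \<Rightarrow> ('v, 'k) pol) set"
  where
  "chains V F i = {f. \<forall>j. f j \<in> poly_ring V \<and> (j \<notin> basis F i \<longrightarrow> f j = 0)}"

definition bdry_map ::
    "('v, 'k::comm_ring_1) free_complex \<Rightarrow> nat \<Rightarrow> (nat \<Rightarrow> ('v, 'k) pol) \<Rightarrow> (nat \<Rightarrow> ('v, 'k) pol)"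
  where
  "bdry_map F i f =
     (\<lambda>p. if p \<in> basis F i then \<Sum>q\<in>basis F (Suc i). bdry F i p q * f q else 0)"

definition aug_map :: "('v, 'k::comm_ring_1) free_complex \<Rightarrow> (nat \<Rightarrow> ('v, 'k) pol) \<Rightarrow> ('v, 'k) pol"
  where
  "aug_map F f = (\<Sum>q\<in>basis F 0. aug F q * f q)"

text \<open>
  The third and fourth conjuncts say that the maps preserve the fine grading; the remaining ones
  express exactness of \<open>\<dots> \<rightarrow> F\<^sub>1 \<rightarrow> F\<^sub>0 \<rightarrow> I \<rightarrow> 0\<close>.
\<close>

definition free_resolution ::
    "'v set \<Rightarrow> ('v, 'k::comm_ring_1) pol set \<Rightarrow> ('v, 'k) free_complex \<Rightarrow> bool" where
  "free_resolution V I F \<longleftrightarrow>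
     (\<forall>i. finite (basis F i)) \<and>
     (\<forall>i. \<forall>j\<in>basis F i. Poly_Mapping.keys (fdeg F i j) \<subseteq> V) \<and>
     (\<forall>i. \<forall>p\<in>basis F i. \<forall>q\<in>basis F (Suc i). bdry F i p q \<in> poly_ring V \<and>
        (\<forall>m\<in>Poly_Mapping.keys (bdry F i p q). m + fdeg F i p = fdeg F (Suc i) q)) \<and>
     (\<forall>q\<in>basis F 0. Poly_Mapping.keys (aug F q) \<subseteq> {fdeg F 0 q}) \<and>
     aug_map F ` chains V F 0 = I \<and>
     bdry_map F 0 ` chains V F (Suc 0) = {f \<in> chains V F 0. aug_map F f = 0} \<and>
     (\<forall>i. bdry_map F (Suc i) ` chains V F (Suc (Suc i)) =
          {f \<in> chains V F (Suc i). bdry_map F i f = (\<lambda>_. 0)})"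

text \<open>
  The complex \<open>F \<otimes>\<^sub>S k\<close> with \<open>k = S / (v. v \<in> V)\<close>: in homological degree \<open>i\<close> it is the vector space
  on \<open>basis F i\<close>, and its differential is given by the constant terms of the entries of \<open>bdry F i\<close>.
  All vector spaces are taken in their component of fine degree \<open>a\<close>.
\<close>

definition tor_chains ::
    "('v, 'k::field) free_complex \<Rightarrow> 'v mon \<Rightarrow> nat \<Rightarrow> (nat \<Rightarrow> 'k) set" where
  "tor_chains F a i = {u. \<forall>j. u j \<noteq> 0 \<longrightarrow> j \<in> basis F i \<and> fdeg F i j = a}"

definition tor_bdry :: "('v, 'k::field) free_complex \<Rightarrow> nat \<Rightarrow> (nat \<Rightarrow> 'k) \<Rightarrow> (nat \<Rightarrow> 'k)" where
  "tor_bdry F i u =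
     (\<lambda>p. if p \<in> basis F i
          then \<Sum>q\<in>basis F (Suc i). Poly_Mapping.lookup (bdry F i p q) 0 * u q else 0)"

fun tor_cycles :: "('v, 'k::field) free_complex \<Rightarrow> 'v mon \<Rightarrow> nat \<Rightarrow> (nat \<Rightarrow> 'k) set" where
  "tor_cycles F a 0 = tor_chains F a 0"
| "tor_cycles F a (Suc i) = {u \<in> tor_chains F a (Suc i). tor_bdry F i u = (\<lambda>_. 0)}"

definition tor_boundaries ::
    "('v, 'k::field) free_complex \<Rightarrow> 'v mon \<Rightarrow> nat \<Rightarrow> (nat \<Rightarrow> 'k) set" where
  "tor_boundaries F a i = tor_bdry F i ` tor_chains F a (Suc i)"

definition vdim :: "(nat \<Rightarrow> 'k::field) set \<Rightarrow> nat" where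
  "vdim U = vector_space.dim (\<lambda>(c::'k) u j. c * u j) U"

text \<open>
  The dimension of the degree \<open>a\<close> part of \<open>Tor\<^sub>i(I, k)\<close>, computed as the homology of \<open>F \<otimes>\<^sub>S k\<close> for a
  chosen resolution \<open>F\<close> of \<open>I\<close>. The boundaries form a subspace of the finite-dimensional space of
  cycles, so the difference of dimensions is the dimension of the quotient.
\<close>

definition betti :: "'v set \<Rightarrow> ('v, 'k::field) pol set \<Rightarrow> nat \<Rightarrow> 'v mon \<Rightarrow> nat" where
  "betti V I i a =
     (let F = (SOME F. free_resolution V I F)
      in vdim (tor_cycles F a i) - vdim (tor_boundaries F a i))"

definition betti_row ::
    "'v set \<Rightarrow> 'v set \<Rightarrow> ('v, 'k::field) pol set \<Rightarrow> nat \<Rightarrow> 'v set \<Rightarrow> nat" where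
  "betti_row X Y I i X' = (\<Sum>Y'\<in>Pow Y. betti (X \<union> Y) I i (squarefree_mon (X' \<union> Y')))"

end

theory Submission
  imports Defs "HOL-Library.Countable"
begin

text \<open>
  The Betti numbers in question depend on the rows only through their transversals. Fix a set \<open>X'\<close> of
  \<open>m\<close> rows and call \<open>U \<subseteq> Y\<close> a transversal when it meets every row of \<open>X'\<close>. A resolution \<open>F\<close> of the
  edge ideal is examined one vertex at a time. For sets \<open>A \<subseteq> V\<close> of vertices let \<open>C(A, V)\<close> be the complex
  of vector spaces on the generators of \<open>F\<close> whose degree is squarefree with support between \<open>A\<close> and \<open>V\<close>;
  the differential consists of the coefficients of the monomial entries of \<open>F\<close>. The complex
  \<open>C({}, V)\<close> is the strand of \<open>F\<close> in degree \<open>V\<close>, so it has a single homology class if \<open>V\<close> contains an edge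
  and is exact otherwise. At the other end, \<open>C(U, U)\<close> computes \<open>Tor(I, k)\<close> in degree \<open>U\<close>. The two ends are
  joined by the exact sequences \<open>0 \<rightarrow> C(A, V - v) \<rightarrow> C(A, V) \<rightarrow> C(A \<union> v, V) \<rightarrow> 0\<close>: if \<open>C(A, V - v)\<close> is acyclic, the
  third complex has the Betti numbers of the second, and if \<open>C(A, V)\<close> is acyclic, it has those of the
  first, shifted by one (\<open>hdim_quotient_if_sub_acyclic\<close>, \<open>hdim_quotient_if_total_acyclic\<close>). Acyclicity in
  turn comes from one criterion, \<open>acyclic_cone\<close>: some \<open>v \<in> A\<close> never decides whether an edge is present. Thus
  only dimensions have to be followed, and the result is the same for every resolution.

  Passing from \<open>{}\<close> to \<open>X'\<close> first, \<open>C(X', X' \<union> Y')\<close> has one class, in homological degree \<open>m - 1\<close>, if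
  \<open>Y'\<close> is a transversal, and none otherwise. Passing then from \<open>X'\<close> to \<open>X' \<union> Y'\<close> involves nothing but the transversals. If \<open>G\<close> is
  nearly row-nested, the shortest rows of \<open>X'\<close> form a sunflower with at most one petal vertex each:
  unless \<open>mindeg X' = 0\<close>, when there are no transversals and all Betti numbers vanish, the
  transversals are the sets that meet a set \<open>A\<close> of size \<open>mindeg X' - 1\<close> or contain a set \<open>B\<close>. A set \<open>Y'\<close>
  then contributes one class if \<open>{} \<noteq> Y' \<subseteq> A\<close> or \<open>Y' = A' \<union> B\<close> with \<open>A' \<subseteq> A\<close>, and no class otherwise, so the
  formula is Pascal's rule (\<open>sum_hdim_sunflower\<close>). Row-nested graphs are nearly row-nested, hence they obey
  the same formula.

  Conversely, each minimal transversal contributes one class for \<open>i = m - 1\<close>, where the formula equals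
  \<open>mindeg X'\<close>. So equality forces at most \<open>mindeg X'\<close> minimal transversals. Two rows \<open>R, R'\<close> have
  \<open>|R \<inter> R'| + |R - R'| |R' - R|\<close> of them, which forces inclusion when the sizes differ and \<open>|R - R'| \<le> 1\<close> when
  they agree. Three distinct rows of size \<open>c\<close> inside a set of size \<open>c + 1\<close> have \<open>c + 1\<close> minimal
  transversals, which excludes the one remaining configuration (\<open>nearly_row_nested_if_few_transversals\<close>).

  Betti numbers are defined through an arbitrary resolution, so one has to exist: a variant of the
  Taylor resolution with words in the edges instead of sets serves this purpose.
\<close>

section \<open>Divisibility of monomials\<close>

text \<open>
  Divisibility is compared pointwise; the order \<open>\<le>\<close> on monomials is lexicographic.
\<close>
definition mdvd :: "'v mon \<Rightarrow> 'v mon \<Rightarrow> bool" where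
  "mdvd m M \<longleftrightarrow> (\<forall>v. Poly_Mapping.lookup m v \<le> Poly_Mapping.lookup M v)"

lemma mdvd_diff_add: "mdvd m M \<Longrightarrow> M - m + m = M"
  by (rule poly_mapping_eqI) (simp add: mdvd_def lookup_add lookup_minus)

lemma mdvd_add_right: "mdvd m (k + m)"
  by (simp add: mdvd_def lookup_add)

lemma mdvd_trans: "mdvd a b \<Longrightarrow> mdvd b c \<Longrightarrow> mdvd a c"
  unfolding mdvd_def using le_trans by blast

lemma mdvd_diff_diff: "mdvd a b \<Longrightarrow> mdvd b c \<Longrightarrow> (b - a) + (c - b) = c - a"
  by (rule poly_mapping_eqI) (simp add: mdvd_def lookup_add lookup_minus)

lemma mdvd_zero: "mdvd 0 m"
  by (simp add: mdvd_def)

lemma keys_diff_mon: "Poly_Mapping.keys (M - m :: 'v mon) \<subseteq> Poly_Mapping.keys M"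
  by (auto simp: in_keys_iff lookup_minus)

lemma keys_add_mon: "Poly_Mapping.keys (a + b :: 'v mon) = Poly_Mapping.keys a \<union> Poly_Mapping.keys b"
  by (auto simp: in_keys_iff lookup_add)

lemma mdvd_keys: "mdvd m M \<Longrightarrow> Poly_Mapping.keys m \<subseteq> Poly_Mapping.keys M"
  by (auto simp: in_keys_iff mdvd_def) (metis not_gr_zero not_less)

lemma lookup_squarefree_mon:
  "finite A \<Longrightarrow> Poly_Mapping.lookup (squarefree_mon A) v = of_bool (v \<in> A)"
proof -
  assume "finite A"
  have "Poly_Mapping.lookup (squarefree_mon A) v = (\<Sum>x\<in>A. if x = v then 1 else 0)"
    by (simp only: squarefree_mon_def lookup_sum lookup_single when_def)
  thus ?thesis using \<open>finite A\<close> by simp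
qed

lemma keys_squarefree_mon: "finite A \<Longrightarrow> Poly_Mapping.keys (squarefree_mon A) = A"
  by (auto simp: in_keys_iff lookup_squarefree_mon)

lemma squarefree_mon_mdvd_iff:
  "finite A \<Longrightarrow> mdvd (squarefree_mon A) M \<longleftrightarrow> A \<subseteq> Poly_Mapping.keys M"
  by (auto simp: mdvd_def lookup_squarefree_mon in_keys_iff subset_iff of_bool_def
      split: if_splits)

text \<open>
  The divisors of a squarefree monomial are squarefree. This is what turns degrees into sets: below
  a squarefree degree only squarefree generators are visible.
\<close>
lemma mdvd_squarefree_mon_iff:
  assumes "finite V"
  shows "mdvd m (squarefree_mon V) \<longleftrightarrow>
    m = squarefree_mon (Poly_Mapping.keys m) \<and> Poly_Mapping.keys m \<subseteq> V"
proof
  assume L: "mdvd m (squarefree_mon V)"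
  have "Poly_Mapping.keys m \<subseteq> V"
    using mdvd_keys[OF L] by (simp add: keys_squarefree_mon assms)
  moreover have "m = squarefree_mon (Poly_Mapping.keys m)"
  proof (rule poly_mapping_eqI)
    fix v
    have "Poly_Mapping.lookup m v \<le> of_bool (v \<in> V)"
      using L by (simp add: mdvd_def lookup_squarefree_mon assms)
    hence "Poly_Mapping.lookup m v \<le> 1"
      by (simp add: of_bool_def split: if_splits)
    thus "Poly_Mapping.lookup m v = Poly_Mapping.lookup (squarefree_mon (Poly_Mapping.keys m)) v"
      by (auto simp: lookup_squarefree_mon in_keys_iff)
  qed
  ultimately show "m = squarefree_mon (Poly_Mapping.keys m) \<and> Poly_Mapping.keys m \<subseteq> V" by blast
next
  assume "m = squarefree_mon (Poly_Mapping.keys m) \<and> Poly_Mapping.keys m \<subseteq> V"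
  thus "mdvd m (squarefree_mon V)"
    by (metis finite_keys squarefree_mon_mdvd_iff keys_squarefree_mon assms)
qed

lemma lookup_single_mult_add:
  fixes g :: "('v, 'k::comm_ring_1) pol"
  shows "Poly_Mapping.lookup (Poly_Mapping.single a c * g) (a + s) = c * Poly_Mapping.lookup g s"
proof -
  have "Poly_Mapping.lookup (Poly_Mapping.single a c * g) (a + s) =
    (\<Sum>l. Poly_Mapping.lookup (Poly_Mapping.single a c) l *
       (\<Sum>q. Poly_Mapping.lookup g q when a + s = l + q))"
    by (simp add: lookup_mult)
  also have "\<dots> = (\<Sum>l. (c * (\<Sum>q. Poly_Mapping.lookup g q when a + s = l + q)) when l = a)"
    by (intro Sum_any.cong) (auto simp: lookup_single when_def)
  also have "\<dots> = c * Poly_Mapping.lookup g s" by simp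
  finally show ?thesis .
qed

lemma lookup_single_mult_not_mdvd:
  fixes g :: "('v, 'k::comm_ring_1) pol"
  assumes "\<not> mdvd a t"
  shows "Poly_Mapping.lookup (Poly_Mapping.single a c * g) t = 0"
proof (rule ccontr)
  assume "Poly_Mapping.lookup (Poly_Mapping.single a c * g) t \<noteq> 0"
  hence "t \<in> Poly_Mapping.keys (Poly_Mapping.single a c * g)" by (simp add: in_keys_iff)
  then obtain x y where "t = x + y" "x \<in> Poly_Mapping.keys (Poly_Mapping.single a c)"
    using keys_mult[of "Poly_Mapping.single a c" g] by blast
  hence "t = a + y" by (auto split: if_splits)
  thus False using assms by (metis add.commute mdvd_add_right)
qed

lemma poly_mapping_sum_singles:
  "(\<Sum>m\<in>Poly_Mapping.keys p. Poly_Mapping.single m (Poly_Mapping.lookup p m)) = p"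
proof (rule poly_mapping_eqI)
  fix k
  show "Poly_Mapping.lookup (\<Sum>m\<in>Poly_Mapping.keys p. Poly_Mapping.single m (Poly_Mapping.lookup p m)) k
     = Poly_Mapping.lookup p k"
    by (simp add: lookup_sum lookup_single when_def in_keys_iff)
qed

lemma poly_ring_sum:
  assumes "\<And>x. x \<in> A \<Longrightarrow> f x \<in> poly_ring V"
  shows "(\<Sum>x\<in>A. f x) \<in> poly_ring V"
  unfolding poly_ring_def mem_Collect_eq
proof
  fix m assume "m \<in> Poly_Mapping.keys (\<Sum>x\<in>A. f x)"
  hence "(\<Sum>x\<in>A. Poly_Mapping.lookup (f x) m) \<noteq> 0" by (simp add: in_keys_iff lookup_sum)
  then obtain x where "x \<in> A" "Poly_Mapping.lookup (f x) m \<noteq> 0" by (meson sum.neutral)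
  thus "Poly_Mapping.keys m \<subseteq> V"
    using assms[of x] by (auto simp: poly_ring_def in_keys_iff)
qed

lemma poly_ring_mult:
  "p \<in> poly_ring V \<Longrightarrow> q \<in> poly_ring V \<Longrightarrow> p * q \<in> poly_ring V"
proof -
  assume p: "p \<in> poly_ring V" and q: "q \<in> poly_ring V"
  have "Poly_Mapping.keys m \<subseteq> V" if m: "m \<in> Poly_Mapping.keys (p * q)" for m
  proof -
    obtain a b where "m = a + b" "a \<in> Poly_Mapping.keys p" "b \<in> Poly_Mapping.keys q"
      using keys_mult[of p q] m by blast
    thus ?thesis using p q by (simp add: poly_ring_def keys_add_mon)
  qed
  thus ?thesis by (simp add: poly_ring_def)
qed

lemma poly_ring_zero: "0 \<in> poly_ring V"
  by (simp add: poly_ring_def)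

lemma poly_ring_single: "Poly_Mapping.keys m \<subseteq> V \<Longrightarrow> Poly_Mapping.single m c \<in> poly_ring V"
  by (auto simp: poly_ring_def)

section \<open>Strands of graded matrices\<close>

text \<open>
  The same map serves for matrices of polynomials and for their scalar strands.
\<close>
definition mat_map :: "nat set \<Rightarrow> nat set \<Rightarrow> (nat \<Rightarrow> nat \<Rightarrow> 'a::semiring_0) \<Rightarrow> (nat \<Rightarrow> 'a) \<Rightarrow> nat \<Rightarrow> 'a"
  where "mat_map P Q M f = (\<lambda>p. if p \<in> P then \<Sum>q\<in>Q. M p q * f q else 0)"

text \<open>
  Every entry of a graded matrix is a scalar times the monomial \<open>dQ q - dP p\<close>; \<open>scalars\<close> below extracts that
  scalar. In a fixed degree \<open>t\<close> a homogeneous vector has entries that are scalar multiples of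
  \<open>t - dQ q\<close>, so a graded matrix acts on it through its scalars alone.
\<close>
definition graded_matrix ::
    "nat set \<Rightarrow> (nat \<Rightarrow> 'v mon) \<Rightarrow> nat set \<Rightarrow> (nat \<Rightarrow> 'v mon) \<Rightarrow> (nat \<Rightarrow> nat \<Rightarrow> ('v, 'k::zero) pol) \<Rightarrow> bool"
  where "graded_matrix P dP Q dQ M \<longleftrightarrow>
    (\<forall>p\<in>P. \<forall>q\<in>Q. \<forall>m\<in>Poly_Mapping.keys (M p q). m + dP p = dQ q)"

definition scalars ::
    "(nat \<Rightarrow> 'v mon) \<Rightarrow> (nat \<Rightarrow> 'v mon) \<Rightarrow> (nat \<Rightarrow> nat \<Rightarrow> ('v, 'k::zero) pol) \<Rightarrow> nat \<Rightarrow> nat \<Rightarrow> 'k"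
  where "scalars dP dQ M p q = Poly_Mapping.lookup (M p q) (dQ q - dP p)"

definition strand :: "nat set \<Rightarrow> (nat \<Rightarrow> 'v mon) \<Rightarrow> 'v mon \<Rightarrow> (nat \<Rightarrow> 'k::zero) set" where
  "strand Q d t = {u. \<forall>q. u q \<noteq> 0 \<longrightarrow> q \<in> Q \<and> mdvd (d q) t}"

definition component ::
    "nat set \<Rightarrow> (nat \<Rightarrow> 'v mon) \<Rightarrow> 'v mon \<Rightarrow> (nat \<Rightarrow> ('v, 'k::zero) pol) \<Rightarrow> nat \<Rightarrow> 'k" where
  "component Q d t f = (\<lambda>q. if q \<in> Q \<and> mdvd (d q) t then Poly_Mapping.lookup (f q) (t - d q) else 0)"

definition homogenize ::
    "(nat \<Rightarrow> 'v mon) \<Rightarrow> 'v mon \<Rightarrow> (nat \<Rightarrow> 'k::zero) \<Rightarrow> nat \<Rightarrow> ('v, 'k) pol" where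
  "homogenize d t u = (\<lambda>q. Poly_Mapping.single (t - d q) (u q))"

definition poly_vectors :: "'v set \<Rightarrow> nat set \<Rightarrow> (nat \<Rightarrow> ('v, 'k::zero) pol) set" where
  "poly_vectors V Q = {f. \<forall>j. f j \<in> poly_ring V \<and> (j \<notin> Q \<longrightarrow> f j = 0)}"

lemma component_in_strand: "component Q d t f \<in> strand Q d t"
  by (auto simp: component_def strand_def split: if_splits)

lemma component_homogenize: "u \<in> strand Q d t \<Longrightarrow> component Q d t (homogenize d t u) = u"
  by (fastforce simp: component_def homogenize_def strand_def)

lemma component_homogenize_other:
  assumes "s \<noteq> t" "u \<in> strand Q d t"
  shows "component Q d s (homogenize d t u) = (\<lambda>_. 0)"
proof
  fix q
  have "t - d q \<noteq> s - d q" if "mdvd (d q) s" "mdvd (d q) t"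
    using that assms(1) mdvd_diff_add by metis
  thus "component Q d s (homogenize d t u) q = 0"
    using assms(2) by (auto simp: component_def homogenize_def strand_def lookup_single when_def)
qed

lemma homogenize_in_poly_vectors:
  assumes "u \<in> strand Q d t" "Poly_Mapping.keys t \<subseteq> V"
  shows "homogenize d t u \<in> poly_vectors V Q"
proof -
  have "Poly_Mapping.keys (t - m) \<subseteq> V" for m using keys_diff_mon[of t m] assms(2) by blast
  moreover have "u q = 0" if "q \<notin> Q" for q using that assms(1) by (auto simp: strand_def)
  ultimately show ?thesis by (simp add: poly_vectors_def homogenize_def poly_ring_single)
qed

lemma graded_matrix_entry:
  fixes M :: "nat \<Rightarrow> nat \<Rightarrow> ('v, 'k::comm_ring_1) pol"
  assumes "graded_matrix P dP Q dQ M" "p \<in> P" "q \<in> Q"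
  shows "M p q = Poly_Mapping.single (dQ q - dP p) (scalars dP dQ M p q)"
proof (rule poly_mapping_eqI)
  fix k
  have "k = dQ q - dP p" if "Poly_Mapping.lookup (M p q) k \<noteq> 0"
  proof -
    have "k + dP p = dQ q" using assms that by (auto simp: graded_matrix_def in_keys_iff)
    thus ?thesis by (metis add_diff_cancel_right')
  qed
  thus "Poly_Mapping.lookup (M p q) k =
      Poly_Mapping.lookup (Poly_Mapping.single (dQ q - dP p) (scalars dP dQ M p q)) k"
    by (auto simp: scalars_def lookup_single when_def)
qed

lemma scalars_nonzero_mdvd:
  assumes "graded_matrix P dP Q dQ M" "p \<in> P" "q \<in> Q" "scalars dP dQ M p q \<noteq> 0"
  shows "mdvd (dP p) (dQ q)"
proof -
  have "(dQ q - dP p) + dP p = dQ q" using assms by (simp add: graded_matrix_def scalars_def in_keys_iff)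
  thus ?thesis by (metis mdvd_add_right)
qed

text \<open>
  Reading off the component of degree \<open>t\<close> is natural in the matrix. A nonzero scalar at \<open>(p, q)\<close> means that
  \<open>dP p\<close> divides \<open>dQ q\<close>, and therefore generators of degree not dividing \<open>t\<close> neither send anything to nor
  receive anything from the strand of degree \<open>t\<close>.
\<close>
lemma component_mat_map:
  fixes M :: "nat \<Rightarrow> nat \<Rightarrow> ('v, 'k::comm_ring_1) pol"
  assumes gr: "graded_matrix P dP Q dQ M"
  shows "component P dP t (mat_map P Q M f) =
         mat_map P Q (scalars dP dQ M) (component Q dQ t f)"
proof
  fix p
  let ?c = "scalars dP dQ M"
  consider "p \<notin> P" | "p \<in> P" "\<not> mdvd (dP p) t" | "p \<in> P" "mdvd (dP p) t" by blast
  then show "component P dP t (mat_map P Q M f) p = mat_map P Q ?c (component Q dQ t f) p"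
  proof cases
    case 2
    have "?c p q * component Q dQ t f q = 0" if "q \<in> Q" for q
      using scalars_nonzero_mdvd[OF gr \<open>p \<in> P\<close> that] 2 mdvd_trans[of "dP p" "dQ q" t]
      by (cases "scalars dP dQ M p q = 0") (auto simp: component_def)
    then show ?thesis using 2 by (auto simp: component_def mat_map_def)
  next
    case 3
    have "Poly_Mapping.lookup (M p q * f q) (t - dP p) = ?c p q * component Q dQ t f q"
      if q: "q \<in> Q" for q
    proof (cases "?c p q = 0")
      case True
      then show ?thesis using graded_matrix_entry[OF gr \<open>p \<in> P\<close> q] by simp
    next
      case False
      have d: "mdvd (dP p) (dQ q)" using scalars_nonzero_mdvd[OF gr \<open>p \<in> P\<close> q False] .
      show ?thesis
      proof (cases "mdvd (dQ q) t")
        case True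
        show ?thesis
          using lookup_single_mult_add[of "dQ q - dP p" "?c p q" "f q" "t - dQ q"]
          by (simp add: mdvd_diff_diff[OF d True] graded_matrix_entry[OF gr \<open>p \<in> P\<close> q, symmetric]
              component_def q True)
      next
        case nd: False
        have "\<not> mdvd (dQ q - dP p) (t - dP p)"
        proof
          assume "mdvd (dQ q - dP p) (t - dP p)"
          hence "mdvd (dQ q) t" using d 3(2)
            unfolding mdvd_def lookup_minus by (meson diff_le_mono2 le_diff_iff le_trans)
          thus False using nd by simp
        qed
        thus ?thesis
          using lookup_single_mult_not_mdvd[of "dQ q - dP p" "t - dP p" "?c p q" "f q"]
          by (simp add: graded_matrix_entry[OF gr \<open>p \<in> P\<close> q, symmetric] component_def nd)
      qed
    qed
    then show ?thesis using 3 by (simp add: component_def mat_map_def lookup_sum)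
  qed (simp add: component_def mat_map_def)
qed

lemma mat_map_in_poly_vectors:
  fixes M :: "nat \<Rightarrow> nat \<Rightarrow> ('v, 'k::comm_ring_1) pol"
  assumes "\<And>p q. p \<in> P \<Longrightarrow> q \<in> Q \<Longrightarrow> M p q \<in> poly_ring V" "f \<in> poly_vectors V Q"
  shows "mat_map P Q M f \<in> poly_vectors V P"
proof -
  have "(\<Sum>q\<in>Q. M p q * f q) \<in> poly_ring V" if "p \<in> P" for p
    using assms that by (intro poly_ring_sum poly_ring_mult) (simp_all add: poly_vectors_def)
  thus ?thesis by (simp add: poly_vectors_def mat_map_def poly_ring_zero)
qed

lemma poly_vectors_eqI:
  assumes "f \<in> poly_vectors V Q" "g \<in> poly_vectors V Q"
    and "\<And>t. component Q d t f = component Q d t g"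
  shows "f = g"
proof
  fix q
  show "f q = g q"
  proof (cases "q \<in> Q")
    case True
    show ?thesis
    proof (rule poly_mapping_eqI)
      fix k
      show "Poly_Mapping.lookup (f q) k = Poly_Mapping.lookup (g q) k"
        using fun_cong[OF assms(3)[of "k + d q"], of q] True mdvd_add_right[of "d q" k]
        by (simp add: component_def)
    qed
  qed (use assms in \<open>auto simp: poly_vectors_def\<close>)
qed

lemma mat_map_zero_vector: "mat_map P Q M (\<lambda>_. 0) = (\<lambda>_. 0)"
  by (auto simp: mat_map_def)

lemma component_zero_vector: "component Q d t (\<lambda>_. 0) = (\<lambda>_. 0)"
  by (auto simp: component_def)

lemma mat_map_eq_0_iff:
  fixes M :: "nat \<Rightarrow> nat \<Rightarrow> ('v, 'k::comm_ring_1) pol"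
  assumes gr: "graded_matrix P dP Q dQ M" and "\<And>p q. p \<in> P \<Longrightarrow> q \<in> Q \<Longrightarrow> M p q \<in> poly_ring V"
    and "f \<in> poly_vectors V Q"
  shows "mat_map P Q M f = (\<lambda>_. 0) \<longleftrightarrow>
    (\<forall>t. mat_map P Q (scalars dP dQ M) (component Q dQ t f) = (\<lambda>_. 0))"
proof
  assume "mat_map P Q M f = (\<lambda>_. 0)"
  thus "\<forall>t. mat_map P Q (scalars dP dQ M) (component Q dQ t f) = (\<lambda>_. 0)"
    by (metis component_mat_map[OF gr] component_zero_vector)
next
  assume "\<forall>t. mat_map P Q (scalars dP dQ M) (component Q dQ t f) = (\<lambda>_. 0)"
  hence "component P dP t (mat_map P Q M f) = component P dP t (\<lambda>_. 0)" for t
    by (simp add: component_mat_map[OF gr] component_zero_vector)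
  thus "mat_map P Q M f = (\<lambda>_. 0)"
    using mat_map_in_poly_vectors[of P Q M V f, OF assms(2,3)]
    by (intro poly_vectors_eqI[of _ V P]) (simp_all add: poly_vectors_def poly_ring_zero)
qed

lemma finite_component_support:
  assumes "finite Q"
  shows "finite {t. component Q d t f \<noteq> (\<lambda>_. 0)}"
proof (rule finite_subset)
  show "{t. component Q d t f \<noteq> (\<lambda>_. 0)} \<subseteq> (\<Union>q\<in>Q. (\<lambda>m. m + d q) ` Poly_Mapping.keys (f q))"
  proof
    fix t assume "t \<in> {t. component Q d t f \<noteq> (\<lambda>_. 0)}"
    then obtain q where "component Q d t f q \<noteq> 0" by blast
    hence "q \<in> Q" "mdvd (d q) t" "t - d q \<in> Poly_Mapping.keys (f q)"
      by (auto simp: component_def in_keys_iff split: if_splits)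
    thus "t \<in> (\<Union>q\<in>Q. (\<lambda>m. m + d q) ` Poly_Mapping.keys (f q))"
      using mdvd_diff_add[of "d q" t] by (intro UN_I[of q] image_eqI[of _ _ "t - d q"]) auto
  qed
qed (use assms in auto)

lemma component_sum:
  fixes f :: "'s \<Rightarrow> nat \<Rightarrow> ('v, 'k::comm_monoid_add) pol"
  shows "component Q d t (\<lambda>q. \<Sum>s\<in>S. f s q) = (\<lambda>q. \<Sum>s\<in>S. component Q d t (f s) q)"
proof
  fix q
  show "component Q d t (\<lambda>q. \<Sum>s\<in>S. f s q) q = (\<Sum>s\<in>S. component Q d t (f s) q)"
  proof (cases "q \<in> Q \<and> mdvd (d q) t")
    case False
    hence "component Q d t h q = 0" for h :: "nat \<Rightarrow> ('v, 'k) pol" by (auto simp: component_def)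
    thus ?thesis by simp
  qed (simp add: component_def lookup_sum)
qed

lemma component_support_keys:
  assumes "f \<in> poly_vectors V Q" "\<And>q. q \<in> Q \<Longrightarrow> Poly_Mapping.keys (d q) \<subseteq> V"
    and "component Q d t f \<noteq> (\<lambda>_. 0)"
  shows "Poly_Mapping.keys t \<subseteq> V"
proof -
  obtain q where "component Q d t f q \<noteq> 0" using assms(3) by blast
  hence q: "q \<in> Q" "mdvd (d q) t" "t - d q \<in> Poly_Mapping.keys (f q)"
    by (auto simp: component_def in_keys_iff split: if_splits)
  have "Poly_Mapping.keys (t - d q) \<subseteq> V" using q(3) assms(1) by (auto simp: poly_vectors_def poly_ring_def)
  thus ?thesis using mdvd_diff_add[OF q(2)] keys_add_mon[of "t - d q" "d q"] assms(2)[OF q(1)] by auto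
qed

text \<open>
  Only finitely many components of \<open>f\<close> are nonzero, so preimages of the components can be homogenized
  and added up to a preimage of \<open>f\<close>.
\<close>
lemma mat_map_image_iff:
  fixes M :: "nat \<Rightarrow> nat \<Rightarrow> ('v, 'k::comm_ring_1) pol"
  assumes gr: "graded_matrix P dP Q dQ M" and pr: "\<And>p q. p \<in> P \<Longrightarrow> q \<in> Q \<Longrightarrow> M p q \<in> poly_ring V"
    and fin: "finite P" and dV: "\<And>p. p \<in> P \<Longrightarrow> Poly_Mapping.keys (dP p) \<subseteq> V"
    and f: "f \<in> poly_vectors V P"
  shows "f \<in> mat_map P Q M ` poly_vectors V Q \<longleftrightarrow>
    (\<forall>t. component P dP t f \<in> mat_map P Q (scalars dP dQ M) ` strand Q dQ t)"
proof
  assume "f \<in> mat_map P Q M ` poly_vectors V Q"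
  thus "\<forall>t. component P dP t f \<in> mat_map P Q (scalars dP dQ M) ` strand Q dQ t"
    using component_mat_map[OF gr] component_in_strand by blast
next
  assume "\<forall>t. component P dP t f \<in> mat_map P Q (scalars dP dQ M) ` strand Q dQ t"
  hence "\<forall>t. \<exists>u. u \<in> strand Q dQ t \<and> component P dP t f = mat_map P Q (scalars dP dQ M) u" by blast
  then obtain w where w: "\<And>t. w t \<in> strand Q dQ t"
    and fw: "\<And>t. component P dP t f = mat_map P Q (scalars dP dQ M) (w t)"
    by metis
  define S where "S = {t. component P dP t f \<noteq> (\<lambda>_. 0)}"
  have finS: "finite S" unfolding S_def by (rule finite_component_support[OF fin])
  define g where "g = (\<lambda>q. \<Sum>s\<in>S. homogenize dQ s (w s) q)"
  have g: "g \<in> poly_vectors V Q"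
  proof -
    have "homogenize dQ s (w s) \<in> poly_vectors V Q" if "s \<in> S" for s
      using that component_support_keys[OF f dV] by (intro homogenize_in_poly_vectors w) (auto simp: S_def)
    hence "homogenize dQ s (w s) j \<in> poly_ring V" "j \<notin> Q \<Longrightarrow> homogenize dQ s (w s) j = 0"
      if "s \<in> S" for s j using that by (simp_all add: poly_vectors_def)
    thus ?thesis by (simp add: poly_vectors_def g_def poly_ring_sum)
  qed
  have cg: "component Q dQ t g = (if t \<in> S then w t else (\<lambda>_. 0))" for t
  proof
    fix q
    have "component Q dQ t g q = (\<Sum>s\<in>S. component Q dQ t (homogenize dQ s (w s)) q)"
      by (simp add: g_def component_sum)
    also have "\<dots> = (\<Sum>s\<in>S. if s = t then w t q else 0)"
      by (intro sum.cong refl)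
        (auto simp: component_homogenize[OF w] component_homogenize_other[OF _ w])
    finally show "component Q dQ t g q = (if t \<in> S then w t else (\<lambda>_. 0)) q"
      using finS by simp
  qed
  have "f = mat_map P Q M g"
  proof (rule poly_vectors_eqI[OF f mat_map_in_poly_vectors[OF pr g]])
    fix t
    show "component P dP t f = component P dP t (mat_map P Q M g)"
    proof (cases "t \<in> S")
      case False
      hence "component P dP t f = (\<lambda>_. 0)" by (simp add: S_def)
      thus ?thesis using False by (simp add: component_mat_map[OF gr] cg mat_map_zero_vector)
    qed (simp add: component_mat_map[OF gr] cg fw)
  qed auto
  thus "f \<in> mat_map P Q M ` poly_vectors V Q" using g by blast
qed

text \<open>
  Exactness can be tested degree by degree. The implication from right to left gives the
  exactness of the Taylor complex below, the other one makes the strands of an arbitrary resolution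
  available.
\<close>
lemma exact_iff_strands_exact:
  fixes M N :: "nat \<Rightarrow> nat \<Rightarrow> ('v, 'k::comm_ring_1) pol"
  assumes grN: "graded_matrix P dP Q dQ N" and grM: "graded_matrix Q dQ R dR M"
    and prN: "\<And>p q. p \<in> P \<Longrightarrow> q \<in> Q \<Longrightarrow> N p q \<in> poly_ring V"
    and prM: "\<And>q r. q \<in> Q \<Longrightarrow> r \<in> R \<Longrightarrow> M q r \<in> poly_ring V"
    and fin: "finite Q" and dV: "\<And>q. q \<in> Q \<Longrightarrow> Poly_Mapping.keys (dQ q) \<subseteq> V"
  shows "mat_map Q R M ` poly_vectors V R = {f \<in> poly_vectors V Q. mat_map P Q N f = (\<lambda>_. 0)} \<longleftrightarrow>
    (\<forall>t. Poly_Mapping.keys t \<subseteq> V \<longrightarrow> mat_map Q R (scalars dQ dR M) ` strand R dR t =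
         {u \<in> strand Q dQ t. mat_map P Q (scalars dP dQ N) u = (\<lambda>_. 0)})"
    (is "?L \<longleftrightarrow> (\<forall>t. _ \<longrightarrow> ?im t = ?ker t)")
proof
  assume L: ?L
  show "\<forall>t. Poly_Mapping.keys t \<subseteq> V \<longrightarrow> ?im t = ?ker t"
  proof (intro allI impI set_eqI)
    fix t :: "'v mon" and u :: "nat \<Rightarrow> 'k"
    assume t: "Poly_Mapping.keys t \<subseteq> V"
    have st: "u \<in> strand Q dQ t" if im: "u \<in> ?im t"
    proof -
      obtain w where w: "w \<in> strand R dR t" "u = mat_map Q R (scalars dQ dR M) w" using im by blast
      have "u = component Q dQ t (mat_map Q R M (homogenize dR t w))"
        by (simp add: component_mat_map[OF grM] component_homogenize[OF w(1)] w(2))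
      thus ?thesis using component_in_strand by metis
    qed
    show "u \<in> ?im t \<longleftrightarrow> u \<in> ?ker t"
    proof (cases "u \<in> strand Q dQ t")
      case True
      let ?f = "homogenize dQ t u"
      have f: "?f \<in> poly_vectors V Q" by (rule homogenize_in_poly_vectors[OF True t])
      have c: "component Q dQ s ?f = (if s = t then u else (\<lambda>_. 0))" for s
        using component_homogenize[OF True] component_homogenize_other[OF _ True] by simp
      have z: "(\<lambda>_. 0) \<in> mat_map Q R (scalars dQ dR M) ` strand R dR s" for s
        by (rule image_eqI[of _ _ "\<lambda>_. 0"]) (auto simp: mat_map_def strand_def)
      have "u \<in> ?im t \<longleftrightarrow> ?f \<in> mat_map Q R M ` poly_vectors V R"
        unfolding mat_map_image_iff[OF grM prM fin dV f, simplified] c using z by auto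
      also have "\<dots> \<longleftrightarrow> mat_map P Q N ?f = (\<lambda>_. 0)" using L f by blast
      also have "\<dots> \<longleftrightarrow> u \<in> ?ker t"
        unfolding mat_map_eq_0_iff[OF grN prN f, simplified] c using True by (auto simp: mat_map_def)
      finally show ?thesis .
    qed (use st in auto)
  qed
next
  assume R: "\<forall>t. Poly_Mapping.keys t \<subseteq> V \<longrightarrow> ?im t = ?ker t"
  show ?L
  proof (rule set_eqI)
    fix f :: "nat \<Rightarrow> ('v, 'k) pol"
    show "f \<in> mat_map Q R M ` poly_vectors V R \<longleftrightarrow>
       f \<in> {f \<in> poly_vectors V Q. mat_map P Q N f = (\<lambda>_. 0)}"
    proof (cases "f \<in> poly_vectors V Q")
      case True
      have "component Q dQ t f \<in> ?im t \<longleftrightarrow> component Q dQ t f \<in> ?ker t" for t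
      proof (cases "Poly_Mapping.keys t \<subseteq> V")
        case False
        hence "component Q dQ t f = (\<lambda>_. 0)" using component_support_keys[OF True, of dQ t] dV by blast
        thus ?thesis by (auto simp: mat_map_def strand_def intro!: image_eqI[of _ _ "\<lambda>_. 0"])
      qed (use R in auto)
      thus ?thesis using True
        unfolding mat_map_image_iff[OF grM prM fin dV True, simplified] 
        by (auto simp: mat_map_eq_0_iff[OF grN prN True, simplified] component_in_strand)
    qed (use mat_map_in_poly_vectors[of Q R M V] prM in auto)
  qed
qed

section \<open>Edge ideals are spanned by monomials\<close>

text \<open>
  A polynomial all of whose monomials are divisible by an edge is a combination of edges: choose
  an edge for each monomial and collect the monomials with the same edge.
\<close>
lemma edge_ideal_iff:
  fixes p :: "('v, 'k::comm_ring_1) pol"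
  assumes "finite V" "E \<subseteq> Pow V"
  shows "p \<in> edge_ideal V E \<longleftrightarrow>
    p \<in> poly_ring V \<and> (\<forall>m\<in>Poly_Mapping.keys p. \<exists>e\<in>E. e \<subseteq> Poly_Mapping.keys m)"
proof
  let ?b = "\<lambda>e. Poly_Mapping.single (squarefree_mon e) (1::'k)"
  have fin: "finite e" if "e \<in> E" for e using assms that finite_subset[of e V] by blast
  assume "p \<in> edge_ideal V E"
  then obtain A q where A: "A \<subseteq> ?b ` E" "\<And>b. b \<in> A \<Longrightarrow> q b \<in> poly_ring V" and p: "p = (\<Sum>b\<in>A. q b * b)"
    unfolding edge_ideal_def ideal_generated_def by blast
  have "b \<in> poly_ring V" if "b \<in> A" for b
  proof -
    obtain e where "e \<in> E" "b = ?b e" using \<open>b \<in> A\<close> A(1) by blast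
    thus ?thesis using assms(2)
      by (metis PowD fin keys_squarefree_mon poly_ring_single subsetD)
  qed
  hence "p \<in> poly_ring V" unfolding p using A(2) by (intro poly_ring_sum poly_ring_mult) auto
  moreover have "\<exists>e\<in>E. e \<subseteq> Poly_Mapping.keys m" if "m \<in> Poly_Mapping.keys p" for m
  proof -
    have "(\<Sum>b\<in>A. Poly_Mapping.lookup (q b * b) m) \<noteq> 0"
      using that by (simp add: p in_keys_iff lookup_sum)
    then obtain b where b: "b \<in> A" "m \<in> Poly_Mapping.keys (q b * b)"
      by (metis (mono_tags, lifting) sum.neutral in_keys_iff)
    obtain e where e: "e \<in> E" "b = ?b e" using b(1) A(1) by blast
    obtain k where "m = k + squarefree_mon e"
      using b(2) keys_mult[of "q b" b] unfolding e(2) by (auto split: if_splits)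
    thus ?thesis using e(1) by (auto simp: keys_add_mon keys_squarefree_mon fin intro!: bexI[of _ e])
  qed
  ultimately show "p \<in> poly_ring V \<and> (\<forall>m\<in>Poly_Mapping.keys p. \<exists>e\<in>E. e \<subseteq> Poly_Mapping.keys m)"
    by blast
next
  let ?b = "\<lambda>e. Poly_Mapping.single (squarefree_mon e) (1::'k)"
  have fin: "finite e" if "e \<in> E" for e using assms that finite_subset[of e V] by blast
  assume p: "p \<in> poly_ring V \<and> (\<forall>m\<in>Poly_Mapping.keys p. \<exists>e\<in>E. e \<subseteq> Poly_Mapping.keys m)"
  then obtain e where e: "\<And>m. m \<in> Poly_Mapping.keys p \<Longrightarrow> e m \<in> E \<and> e m \<subseteq> Poly_Mapping.keys m"
    by metis
  define r where "r m = Poly_Mapping.single (m - squarefree_mon (e m)) (Poly_Mapping.lookup p m)" for m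
  define q where "q c = (\<Sum>m\<in>{m \<in> Poly_Mapping.keys p. ?b (e m) = c}. r m)" for c
  have r: "r m \<in> poly_ring V" if "m \<in> Poly_Mapping.keys p" for m
  proof -
    have "Poly_Mapping.keys m \<subseteq> V" using p that by (simp add: poly_ring_def)
    thus ?thesis unfolding r_def using keys_diff_mon[of m "squarefree_mon (e m)"]
      by (intro poly_ring_single) blast
  qed
  have rm: "r m * ?b (e m) = Poly_Mapping.single m (Poly_Mapping.lookup p m)"
    if "m \<in> Poly_Mapping.keys p" for m
    unfolding r_def mult_single
    using mdvd_diff_add[of "squarefree_mon (e m)" m] squarefree_mon_mdvd_iff[of "e m" m] fin e[OF that]
    by simp
  have "p = (\<Sum>m\<in>Poly_Mapping.keys p. r m * ?b (e m))"
    using poly_mapping_sum_singles[of p] rm by simp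
  also have "\<dots> = (\<Sum>c\<in>(\<lambda>m. ?b (e m)) ` Poly_Mapping.keys p.
      \<Sum>m\<in>{m \<in> Poly_Mapping.keys p. ?b (e m) = c}. r m * ?b (e m))"
    by (rule sum.image_gen) simp
  also have "\<dots> = (\<Sum>c\<in>(\<lambda>m. ?b (e m)) ` Poly_Mapping.keys p. q c * c)"
    by (intro sum.cong refl) (simp add: q_def sum_distrib_right)
  finally have "p = (\<Sum>c\<in>(\<lambda>m. ?b (e m)) ` Poly_Mapping.keys p. q c * c)" .
  moreover have "finite ((\<lambda>m. ?b (e m)) ` Poly_Mapping.keys p)" by simp
  moreover have "(\<lambda>m. ?b (e m)) ` Poly_Mapping.keys p \<subseteq> ?b ` E" using e by blast
  moreover have "\<forall>c\<in>(\<lambda>m. ?b (e m)) ` Poly_Mapping.keys p. q c \<in> poly_ring V"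
    unfolding q_def by (auto intro!: poly_ring_sum r)
  ultimately show "p \<in> edge_ideal V E"
    unfolding edge_ideal_def ideal_generated_def by blast
qed

section \<open>Strands of free resolutions\<close>

lemma chains_eq: "chains V F i = poly_vectors V (basis F i)"
  by (simp add: chains_def poly_vectors_def)

lemma bdry_map_eq: "bdry_map F i = mat_map (basis F i) (basis F (Suc i)) (bdry F i)"
  by (rule ext) (simp add: bdry_map_def mat_map_def)

text \<open>
  The augmentation is a graded matrix with a single row, placed in degree \<open>0\<close>, so the lemmas on
  graded matrices apply to it. The index \<open>c\<close> of that row is arbitrary.
\<close>
lemma aug_map_eq: "mat_map {c} (basis F 0) (\<lambda>_. aug F) f = (\<lambda>j. if j = c then aug_map F f else 0)"
  by (auto simp: aug_map_def mat_map_def)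

lemma aug_image_iff:
  fixes F :: "('v, 'k::comm_ring_1) free_complex"
  assumes aug: "\<And>q. q \<in> basis F 0 \<Longrightarrow> Poly_Mapping.keys (aug F q) \<subseteq> {fdeg F 0 q}"
    and dV: "\<And>q. q \<in> basis F 0 \<Longrightarrow> Poly_Mapping.keys (fdeg F 0 q) \<subseteq> V"
  shows "p \<in> aug_map F ` chains V F 0 \<longleftrightarrow> p \<in> poly_ring V \<and>
    (\<forall>t. \<exists>w\<in>strand (basis F 0) (fdeg F 0) t.
       Poly_Mapping.lookup p t = (\<Sum>q\<in>basis F 0. Poly_Mapping.lookup (aug F q) (fdeg F 0 q) * w q))"
proof -
  let ?M = "\<lambda>_::nat. aug F" and ?d = "\<lambda>_::nat. 0 :: 'v mon"
  let ?g = "\<lambda>j. if j = (0::nat) then p else 0"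
  have gr: "graded_matrix {0} ?d (basis F 0) (fdeg F 0) ?M"
    using aug by (fastforce simp: graded_matrix_def)
  have pr: "?M c q \<in> poly_ring V" if "q \<in> basis F 0" for c q
    using aug[OF that] dV[OF that] by (auto simp: poly_ring_def)
  have eq: "p = aug_map F f \<longleftrightarrow> ?g = mat_map {0} (basis F 0) ?M f" for f
    unfolding aug_map_eq by (metis (full_types))
  have "p \<in> aug_map F ` chains V F 0 \<longleftrightarrow> ?g \<in> mat_map {0} (basis F 0) ?M ` poly_vectors V (basis F 0)"
    unfolding chains_eq image_iff eq ..
  also have "\<dots> \<longleftrightarrow> ?g \<in> poly_vectors V {0} \<and>
      (\<forall>t. component {0} ?d t ?g \<in> mat_map {0} (basis F 0) (scalars ?d (fdeg F 0) ?M) ` strand (basis F 0) (fdeg F 0) t)"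
  proof (cases "?g \<in> poly_vectors V {0}")
    case True
    show ?thesis using mat_map_image_iff[OF gr pr _ _ True] True by simp
  next
    case False
    thus ?thesis using mat_map_in_poly_vectors[of "{0}" "basis F 0" ?M V] pr by (auto simp del: aug_map_eq)
  qed
  finally have 1: "p \<in> aug_map F ` chains V F 0 \<longleftrightarrow> ?g \<in> poly_vectors V {0} \<and>
      (\<forall>t. component {0} ?d t ?g \<in> mat_map {0} (basis F 0) (scalars ?d (fdeg F 0) ?M) ` strand (basis F 0) (fdeg F 0) t)" .
  have 2: "?g \<in> poly_vectors V {0} \<longleftrightarrow> p \<in> poly_ring V"
    by (auto simp: poly_vectors_def poly_ring_zero)
  have 3: "component {0} ?d t ?g = mat_map {0} (basis F 0) (scalars ?d (fdeg F 0) ?M) w \<longleftrightarrow>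
    Poly_Mapping.lookup p t = (\<Sum>q\<in>basis F 0. Poly_Mapping.lookup (aug F q) (fdeg F 0 q) * w q)"
    (is "?l = ?r \<longleftrightarrow> ?a = ?b") for t w
  proof -
    have "?l = (\<lambda>j. if j = 0 then ?a else 0)" "?r = (\<lambda>j. if j = 0 then ?b else 0)"
      by (auto simp: component_def mdvd_zero mat_map_def scalars_def)
    thus ?thesis by (auto dest: fun_cong[of _ _ 0])
  qed
  show ?thesis unfolding 1 2 unfolding image_iff 3 ..
qed

section \<open>The ordered Taylor resolution\<close>

text \<open>
  The boundary of a word \<open>a # q\<close> is \<open>q - a # \<partial> q\<close>, the alternating sum of the words obtained by deleting one
  letter; \<open>face_coeff p q\<close> is the coefficient of \<open>p\<close> in \<open>\<partial> q\<close>. Words with repetitions spare all choices of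
  orientation. A word of length \<open>i + 1\<close> in the edges will be a generator in homological degree \<open>i\<close>, whose
  degree is the least common multiple of its edges, and the empty word is the target of the
  augmentation.
\<close>
fun face_coeff :: "nat list \<Rightarrow> nat list \<Rightarrow> 'k::comm_ring_1" where
  "face_coeff p [] = 0"
| "face_coeff [] (a # q) = of_bool (q = [])"
| "face_coeff (b # p) (a # q) = of_bool (b # p = q) - of_bool (b = a) * face_coeff p q"

lemma face_coeff_nonzero:
  "face_coeff p q \<noteq> (0::'k::comm_ring_1) \<Longrightarrow> length q = Suc (length p) \<and> set p \<subseteq> set q"
proof (induction p q rule: face_coeff.induct)
  case (3 b p a q)
  thus ?case by (cases "b # p = q"; cases "b = a") auto
qed (auto split: if_splits)

definition words :: "nat \<Rightarrow> nat \<Rightarrow> nat list set" where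
  "words n k = {l. length l = k \<and> set l \<subseteq> {..<n}}"

lemma finite_words: "finite (words n k)"
  using finite_lists_length_eq[of "{..<n}" k] by (simp add: words_def conj_commute)

lemma words_0: "words n 0 = {[]}"
  by (auto simp: words_def)

lemma sum_of_bool_eq_mult:
  fixes w :: "'a \<Rightarrow> 'k::comm_ring_1"
  assumes "finite A"
  shows "(\<Sum>q\<in>A. of_bool (q = p) * w q) = (if p \<in> A then w p else 0)"
    and "(\<Sum>q\<in>A. w q * of_bool (q = p)) = (if p \<in> A then w p else 0)"
proof -
  have "(\<Sum>q\<in>A. of_bool (q = p) * w q) = (\<Sum>q\<in>A. if q = p then w q else 0)"
    by (intro sum.cong refl) simp
  thus "(\<Sum>q\<in>A. of_bool (q = p) * w q) = (if p \<in> A then w p else 0)"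
    using assms by simp
  thus "(\<Sum>q\<in>A. w q * of_bool (q = p)) = (if p \<in> A then w p else 0)"
    by (simp add: mult.commute)
qed

lemma sum_words_Suc:
  fixes g :: "nat list \<Rightarrow> 'k::comm_monoid_add"
  assumes "a < n" "\<And>b l. b \<noteq> a \<Longrightarrow> g (b # l) = 0"
  shows "(\<Sum>l\<in>words n (Suc k). g l) = (\<Sum>l\<in>words n k. g (a # l))"
proof -
  have "(\<Sum>l\<in>words n (Suc k). g l) = (\<Sum>l\<in>(#) a ` words n k. g l)"
  proof (rule sum.mono_neutral_right[OF finite_words])
    show "(#) a ` words n k \<subseteq> words n (Suc k)" using assms(1) by (auto simp: words_def)
    show "\<forall>l\<in>words n (Suc k) - (#) a ` words n k. g l = 0"
    proof
      fix l assume l: "l \<in> words n (Suc k) - (#) a ` words n k"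
      then obtain b l' where "l = b # l'" by (cases l) (auto simp: words_def)
      thus "g l = 0" using l assms(2) by (auto simp: words_def)
    qed
  qed
  also have "\<dots> = (\<Sum>l\<in>words n k. g (a # l))"
    by (subst sum.reindex) (auto simp: inj_on_def)
  finally show ?thesis .
qed

text \<open>
  This is \<open>\<partial> \<partial> = 0\<close>: by induction \<open>\<partial> (q - a # \<partial> q) = \<partial> q - (\<partial> q - a # \<partial> \<partial> q) = 0\<close>.
\<close>
lemma sum_face_coeff_face_coeff:
  "q \<in> words n (Suc k) \<Longrightarrow>
   (\<Sum>p\<in>words n k. face_coeff r p * face_coeff p q) = (0::'k::comm_ring_1)"
proof (induction q arbitrary: r k)
  case (Cons a q)
  show ?case
  proof (cases k)
    case 0
    thus ?thesis by (simp add: words_0)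
  next
    case (Suc j)
    have q: "q \<in> words n (Suc j)" and a: "a < n" using Cons.prems Suc by (auto simp: words_def)
    have split: "face_coeff p (a # q) = of_bool (p = q) -
       (case p of [] \<Rightarrow> 0 | b # p' \<Rightarrow> of_bool (b = a) * (face_coeff p' q :: 'k))"
      if "p \<in> words n (Suc j)" for p
      using that q by (cases p) (auto simp: words_def)
    have "(\<Sum>p\<in>words n k. face_coeff r p * face_coeff p (a # q)) =
        (\<Sum>p\<in>words n (Suc j). face_coeff r p * of_bool (p = q)) -
        (\<Sum>p\<in>words n (Suc j). face_coeff r p *
            (case p of [] \<Rightarrow> 0 | b # p' \<Rightarrow> of_bool (b = a) * (face_coeff p' q :: 'k)))"
      unfolding Suc sum_subtractf[symmetric] by (intro sum.cong refl) (simp add: split algebra_simps)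
    also have "(\<Sum>p\<in>words n (Suc j). face_coeff r p * of_bool (p = q)) = (face_coeff r q :: 'k)"
      using q by (simp add: sum_of_bool_eq_mult(2)[OF finite_words])
    also have "(\<Sum>p\<in>words n (Suc j). face_coeff r p *
            (case p of [] \<Rightarrow> 0 | b # p' \<Rightarrow> of_bool (b = a) * (face_coeff p' q :: 'k))) =
        (\<Sum>p\<in>words n j. face_coeff r (a # p) * face_coeff p q)"
      by (subst sum_words_Suc[OF a]) auto
    also have "\<dots> = face_coeff r q"
    proof (cases r)
      case Nil
      show ?thesis
      proof (cases j)
        case 0
        thus ?thesis using q Nil by (simp add: words_0)
      next
        case (Suc i)
        have "q \<noteq> []" "tl q \<noteq> []" using q Suc by (cases q; cases "tl q"; auto simp: words_def)+
        hence "face_coeff [] q = (0::'k)" by (cases q) auto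
        moreover have "face_coeff [] (a # p) = (0::'k)" if "p \<in> words n j" for p
          using that Suc by (auto simp: words_def)
        ultimately show ?thesis using Nil by simp
      qed
    next
      case (Cons b s)
      have "(\<Sum>p\<in>words n j. face_coeff r (a # p) * face_coeff p q) =
          (\<Sum>p\<in>words n j. of_bool (p = r) * face_coeff p q) -
          of_bool (b = a) * (\<Sum>p\<in>words n j. face_coeff s p * face_coeff p q :: 'k)"
        unfolding Cons sum_distrib_left sum_subtractf[symmetric]
        by (intro sum.cong refl) (auto simp: algebra_simps)
      also have "(\<Sum>p\<in>words n j. face_coeff s p * face_coeff p q :: 'k) = 0"
        by (rule Cons.IH[OF q])
      also have "(\<Sum>p\<in>words n j. of_bool (p = r) * face_coeff p q :: 'k) = face_coeff r q"
      proof (cases "r \<in> words n j")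
        case True
        thus ?thesis by (simp add: sum_of_bool_eq_mult(1)[OF finite_words])
      next
        case False
        have "face_coeff r q = (0::'k)"
        proof (rule ccontr)
          assume "face_coeff r q \<noteq> (0::'k)"
          from face_coeff_nonzero[OF this] show False using False q by (auto simp: words_def)
        qed
        moreover have "of_bool (p = r) * face_coeff p q = (0::'k)" if "p \<in> words n j" for p
          using that False by auto
        ultimately show ?thesis by simp
      qed
      finally show ?thesis by simp
    qed
    finally show ?thesis by simp
  qed
qed (simp add: words_def)

text \<open>
  The contracting homotopy that puts the letter \<open>a\<close> in front of each word.
\<close>
definition prepend :: "nat \<Rightarrow> (nat list \<Rightarrow> 'k::zero) \<Rightarrow> nat list \<Rightarrow> 'k" where
  "prepend a w l = (case l of [] \<Rightarrow> 0 | b # q \<Rightarrow> if b = a then w q else 0)"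

text \<open>
  The homotopy formula \<open>\<partial> (a # w) = w - a # \<partial> w\<close> exhibits a cycle \<open>w\<close> as a boundary.
\<close>
lemma face_sum_prepend:
  fixes w :: "nat list \<Rightarrow> 'k::comm_ring_1"
  assumes "a < n" "p \<in> words n k" and cyc: "\<And>r. (\<Sum>q\<in>words n k. face_coeff r q * w q) = 0"
  shows "(\<Sum>q\<in>words n (Suc k). face_coeff p q * prepend a w q) = w p"
proof -
  have "(\<Sum>q\<in>words n (Suc k). face_coeff p q * prepend a w q) =
    (\<Sum>q\<in>words n k. face_coeff p (a # q) * w q)"
    by (subst sum_words_Suc[OF assms(1)]) (auto simp: prepend_def)
  also have "\<dots> = w p"
  proof (cases p)
    case Nil
    thus ?thesis using assms(2) by (simp add: words_def words_0[unfolded words_def, simplified])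
  next
    case (Cons b r)
    have "(\<Sum>q\<in>words n k. face_coeff p (a # q) * w q) =
      (\<Sum>q\<in>words n k. of_bool (q = p) * w q) - of_bool (b = a) * (\<Sum>q\<in>words n k. face_coeff r q * w q)"
      unfolding Cons sum_distrib_left sum_subtractf[symmetric]
      by (intro sum.cong refl) (auto simp: algebra_simps)
    also have "(\<Sum>q\<in>words n k. of_bool (q = p) * w q) = w p"
      using assms(2) by (simp add: sum_of_bool_eq_mult(1)[OF finite_words])
    finally show ?thesis by (simp add: cyc)
  qed
  finally show ?thesis .
qed

definition word_codes :: "nat \<Rightarrow> nat \<Rightarrow> nat set" where
  "word_codes n k = to_nat ` words n k"

definition code_coeff :: "nat \<Rightarrow> nat \<Rightarrow> 'k::comm_ring_1" where
  "code_coeff p q = face_coeff (from_nat p) (from_nat q)"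

lemma mat_map_code_coeff:
  fixes u :: "nat \<Rightarrow> 'k::comm_ring_1"
  shows "mat_map (word_codes n k) (word_codes n l) code_coeff u =
   (\<lambda>j. if j \<in> word_codes n k then \<Sum>q\<in>words n l. face_coeff (from_nat j) q * u (to_nat q) else 0)"
proof -
  have "(\<Sum>q\<in>word_codes n l. g q) = (\<Sum>q\<in>words n l. g (to_nat q))" for g :: "nat \<Rightarrow> 'k"
    unfolding word_codes_def by (subst sum.reindex) (auto simp: inj_on_def)
  thus ?thesis by (simp add: mat_map_def code_coeff_def cong: if_cong)
qed

text \<open>
  In degree \<open>t\<close> the Taylor complex consists of the words in the alphabet \<open>A\<close> of those edges that divide \<open>t\<close>,
  and prepending a letter of \<open>A\<close> does not leave this alphabet. If \<open>A\<close> is empty there are no nonempty words.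
\<close>
lemma word_codes_exact:
  fixes A :: "nat set" and n :: nat
  defines "U \<equiv> \<lambda>k. {u :: nat \<Rightarrow> 'k::comm_ring_1. \<forall>j. u j \<noteq> 0 \<longrightarrow> j \<in> word_codes n k \<and> set (from_nat j) \<subseteq> A}"
  shows "mat_map (word_codes n (Suc k)) (word_codes n (Suc (Suc k))) code_coeff ` U (Suc (Suc k)) =
    {u \<in> U (Suc k). mat_map (word_codes n k) (word_codes n (Suc k)) code_coeff u = (\<lambda>_. 0)}"
    (is "?d1 ` _ = {u \<in> _. ?d0 u = _}")
proof (intro equalityI subsetI)
  fix v assume "v \<in> ?d1 ` U (Suc (Suc k))"
  then obtain u where u: "u \<in> U (Suc (Suc k))" and v: "v = ?d1 u" by blast
  have "v \<in> U (Suc k)"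
    unfolding U_def mem_Collect_eq
  proof (intro allI impI)
    fix j assume "v j \<noteq> 0"
    hence j: "j \<in> word_codes n (Suc k)"
      and "(\<Sum>q\<in>words n (Suc (Suc k)). face_coeff (from_nat j) q * u (to_nat q)) \<noteq> 0"
      by (auto simp: v mat_map_code_coeff split: if_splits)
    then obtain q where q: "face_coeff (from_nat j) q \<noteq> (0::'k)" "u (to_nat q) \<noteq> 0"
      by (metis (no_types, lifting) mult_zero_left mult_zero_right sum.neutral)
    have "set q \<subseteq> A" using u q(2) unfolding U_def mem_Collect_eq by (metis from_nat_to_nat)
    thus "j \<in> word_codes n (Suc k) \<and> set (from_nat j) \<subseteq> A"
      using j face_coeff_nonzero[OF q(1)] by blast
  qed
  moreover have "?d0 v = (\<lambda>_. 0)"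
  proof
    fix j
    have vp: "v (to_nat p) = (\<Sum>q\<in>words n (Suc (Suc k)). face_coeff p q * u (to_nat q))"
      if "p \<in> words n (Suc k)" for p
    proof -
      have "to_nat p \<in> word_codes n (Suc k)" using that by (simp add: word_codes_def)
      thus ?thesis by (simp add: v mat_map_code_coeff)
    qed
    have "(\<Sum>p\<in>words n (Suc k). face_coeff r p * v (to_nat p)) = 0" for r :: "nat list"
    proof -
      have "(\<Sum>p\<in>words n (Suc k). face_coeff r p * v (to_nat p)) =
        (\<Sum>p\<in>words n (Suc k). \<Sum>q\<in>words n (Suc (Suc k)). face_coeff r p * face_coeff p q * u (to_nat q))"
        by (intro sum.cong refl) (simp add: vp sum_distrib_left mult.assoc)
      also have "\<dots> = (\<Sum>q\<in>words n (Suc (Suc k)).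
          (\<Sum>p\<in>words n (Suc k). face_coeff r p * face_coeff p q) * u (to_nat q))"
        by (subst sum.swap) (simp add: sum_distrib_right)
      also have "\<dots> = 0" by (intro sum.neutral ballI) (simp add: sum_face_coeff_face_coeff)
      finally show ?thesis .
    qed
    thus "?d0 v j = 0" by (simp add: mat_map_code_coeff)
  qed
  ultimately show "v \<in> {u \<in> U (Suc k). ?d0 u = (\<lambda>_. 0)}" by blast
next
  fix v assume "v \<in> {u \<in> U (Suc k). ?d0 u = (\<lambda>_. 0)}"
  hence v: "\<And>j. v j \<noteq> 0 \<Longrightarrow> j \<in> word_codes n (Suc k) \<and> set (from_nat j :: nat list) \<subseteq> A"
    and dv: "?d0 v = (\<lambda>_. 0)" by (auto simp: U_def)
  show "v \<in> ?d1 ` U (Suc (Suc k))"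
  proof (cases "\<exists>a. a \<in> A \<and> a < n")
    case False
    have "v j = 0" for j
    proof (rule ccontr)
      assume "v j \<noteq> 0"
      from v[OF this] obtain l where "l \<in> words n (Suc k)" "set l \<subseteq> A"
        by (auto simp: word_codes_def)
      moreover obtain a where "a \<in> set l" using \<open>l \<in> words n (Suc k)\<close> by (cases l) (auto simp: words_def)
      ultimately show False using False by (auto simp: words_def)
    qed
    hence "v = ?d1 (\<lambda>_. 0)" by (auto simp: mat_map_def)
    moreover have "(\<lambda>_. 0) \<in> U (Suc (Suc k))" by (simp add: U_def)
    ultimately show ?thesis by blast
  next
    case True
    then obtain a where a: "a \<in> A" "a < n" by blast
    define w where "w l = v (to_nat l)" for l :: "nat list"
    define u where "u j = (if j \<in> word_codes n (Suc (Suc k)) then prepend a w (from_nat j) else 0)" for j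
    have cyc: "(\<Sum>q\<in>words n (Suc k). face_coeff r q * w q) = 0" for r
    proof (cases "r \<in> words n k")
      case True
      hence "to_nat r \<in> word_codes n k" by (simp add: word_codes_def)
      thus ?thesis using fun_cong[OF dv, of "to_nat r"] by (simp add: mat_map_code_coeff w_def)
    next
      case False
      have "face_coeff r q = (0::'k)" if "q \<in> words n (Suc k)" for q
      proof (rule ccontr)
        assume "face_coeff r q \<noteq> (0::'k)"
        from face_coeff_nonzero[OF this] show False using False that by (auto simp: words_def)
      qed
      thus ?thesis by simp
    qed
    have "u \<in> U (Suc (Suc k))"
      unfolding U_def mem_Collect_eq
    proof (intro allI impI)
      fix j assume "u j \<noteq> 0"
      hence j: "j \<in> word_codes n (Suc (Suc k))" and "prepend a w (from_nat j) \<noteq> 0"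
        by (auto simp: u_def split: if_splits)
      then obtain q where "from_nat j = a # q" "w q \<noteq> 0"
        by (auto simp: prepend_def split: list.splits if_splits)
      thus "j \<in> word_codes n (Suc (Suc k)) \<and> set (from_nat j) \<subseteq> A"
        using j v[of "to_nat q"] a(1) by (simp add: w_def)
    qed
    moreover have "v = ?d1 u"
    proof
      fix j
      show "v j = ?d1 u j"
      proof (cases "j \<in> word_codes n (Suc k)")
        case True
        then obtain p where p: "p \<in> words n (Suc k)" "j = to_nat p" by (auto simp: word_codes_def)
        have "?d1 u j = (\<Sum>q\<in>words n (Suc (Suc k)). face_coeff p q * prepend a w q)"
          using True by (simp add: mat_map_code_coeff p(2)) (intro sum.cong refl, simp add: u_def word_codes_def)
        also have "\<dots> = w p" by (rule face_sum_prepend[OF a(2) p(1) cyc])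
        finally show ?thesis by (simp add: w_def p(2))
      next
        case False
        thus ?thesis using v[of j] by (auto simp: mat_map_def)
      qed
    qed
    ultimately show ?thesis by blast
  qed
qed

text \<open>
  The least common multiple of squarefree monomials is the monomial of the union.
\<close>
definition taylor_degree :: "(nat \<Rightarrow> 'v set) \<Rightarrow> nat \<Rightarrow> 'v mon" where
  "taylor_degree en j = squarefree_mon (\<Union> (en ` set (from_nat j :: nat list)))"

definition taylor_matrix :: "(nat \<Rightarrow> 'v set) \<Rightarrow> nat \<Rightarrow> nat \<Rightarrow> ('v, 'k::comm_ring_1) pol" where
  "taylor_matrix en p q =
     Poly_Mapping.single (taylor_degree en q - taylor_degree en p) (code_coeff p q)"

text \<open>
  Generators have to be natural numbers, hence words are replaced by their codes. The augmentation is
  the row of the empty word in the same matrix; this makes exactness at all levels one statement.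
\<close>
definition taylor_complex :: "(nat \<Rightarrow> 'v set) \<Rightarrow> nat \<Rightarrow> ('v, 'k::comm_ring_1) free_complex" where
  "taylor_complex en n = \<lparr>basis = \<lambda>i. word_codes n (Suc i), fdeg = \<lambda>_. taylor_degree en,
     bdry = \<lambda>_. taylor_matrix en, aug = taylor_matrix en (to_nat ([] :: nat list))\<rparr>"

lemma taylor_complex_resolution:
  fixes E :: "'v set set"
  assumes V: "finite V" "E \<subseteq> Pow V" and en: "E = en ` {..<n}"
  shows "free_resolution V (edge_ideal V E :: ('v, 'k::comm_ring_1) pol set) (taylor_complex en n)"
proof -
  let ?F = "taylor_complex en n :: ('v, 'k) free_complex"
  let ?d = "taylor_degree en" and ?W = "word_codes n" and ?M = "taylor_matrix en :: nat \<Rightarrow> nat \<Rightarrow> ('v, 'k) pol"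
  have F: "basis ?F i = ?W (Suc i)" "fdeg ?F i = ?d" "bdry ?F i = ?M" "aug ?F = ?M (to_nat ([] :: nat list))" for i
    by (simp_all add: taylor_complex_def)
  have U: "\<Union> (en ` set (from_nat j :: nat list)) \<subseteq> V" if "j \<in> ?W k" for j k
  proof -
    have "set (from_nat j :: nat list) \<subseteq> {..<n}" using that by (auto simp: word_codes_def words_def)
    thus ?thesis using V(2) en by blast
  qed
  have Ufin: "finite (\<Union> (en ` set (from_nat j :: nat list)))" if "j \<in> ?W k" for j k
    using U[OF that] V(1) finite_subset by blast
  have dkeys: "Poly_Mapping.keys (?d j) = \<Union> (en ` set (from_nat j :: nat list))" if "j \<in> ?W k" for j k
    using Ufin[OF that] by (simp add: taylor_degree_def keys_squarefree_mon)
  have dV: "Poly_Mapping.keys (?d j) \<subseteq> V" if "j \<in> ?W k" for j k using dkeys[OF that] U[OF that] by simp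
  have ddvd: "mdvd (?d j) t \<longleftrightarrow> (\<forall>a\<in>set (from_nat j :: nat list). en a \<subseteq> Poly_Mapping.keys t)"
    if "j \<in> ?W k" for j k t
    using squarefree_mon_mdvd_iff[OF Ufin[OF that], of t] by (auto simp: taylor_degree_def)
  have finW: "finite (?W k)" for k by (simp add: word_codes_def finite_words)
  have M: "?M p q \<in> poly_ring V" if "q \<in> ?W k" for p q k
  proof -
    have "Poly_Mapping.keys (?d q - ?d p) \<subseteq> V" using dV[OF that] keys_diff_mon[of "?d q" "?d p"] by blast
    thus ?thesis unfolding taylor_matrix_def by (rule poly_ring_single)
  qed
  have gr: "graded_matrix (?W k) ?d (?W l) ?d ?M" for k l
    unfolding graded_matrix_def
  proof (intro ballI)
    fix p q m assume p: "p \<in> ?W k" and q: "q \<in> ?W l" and m: "m \<in> Poly_Mapping.keys (?M p q)"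
    have "code_coeff p q \<noteq> (0::'k)" "m = ?d q - ?d p"
      using m by (auto simp: taylor_matrix_def split: if_splits)
    moreover from this have "mdvd (?d p) (?d q)"
      unfolding ddvd[OF p] dkeys[OF q] code_coeff_def using face_coeff_nonzero by blast
    ultimately show "m + ?d p = ?d q" by (simp add: mdvd_diff_add)
  qed
  have sc: "scalars ?d ?d ?M = code_coeff"
    by (intro ext) (simp add: scalars_def taylor_matrix_def)
  have st: "strand (?W k) ?d t = {u. \<forall>j. u j \<noteq> 0 \<longrightarrow> j \<in> ?W k \<and> set (from_nat j) \<subseteq> {a. en a \<subseteq> Poly_Mapping.keys t}}" for k t
    unfolding strand_def using ddvd by blast
  have exact: "mat_map (?W (Suc k)) (?W (Suc (Suc k))) ?M ` poly_vectors V (?W (Suc (Suc k))) =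
     {f \<in> poly_vectors V (?W (Suc k)). mat_map (?W k) (?W (Suc k)) ?M f = (\<lambda>_. 0)}" for k
    by (subst exact_iff_strands_exact[OF gr gr M M finW dV])
       (assumption+, unfold sc st, intro allI impI word_codes_exact)
  have W0: "?W 0 = {to_nat ([] :: nat list)}" by (simp add: word_codes_def words_0)
  have aug0: "mat_map (?W 0) (?W (Suc 0)) ?M f = (\<lambda>_. 0) \<longleftrightarrow> aug_map ?F f = 0" for f
    using aug_map_eq[of "to_nat ([] :: nat list)" ?F f] unfolding F W0 mat_map_def aug_map_def
    by (auto simp: fun_eq_iff)
  have d0: "?d (to_nat ([] :: nat list)) = 0" by (simp add: taylor_degree_def squarefree_mon_def)
  have c0: "code_coeff (to_nat ([] :: nat list)) q = (1::'k)" if "q \<in> ?W (Suc 0)" for q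
    using that by (auto simp: word_codes_def words_def code_coeff_def length_Suc_conv)
  have augF: "aug ?F q = Poly_Mapping.single (?d q) 1" if "q \<in> ?W (Suc 0)" for q
    unfolding F taylor_matrix_def d0 c0[OF that] by simp
  have image: "aug_map ?F ` chains V ?F 0 = edge_ideal V E"
  proof (rule set_eqI)
    fix p :: "('v, 'k) pol"
    have "(\<exists>w\<in>strand (?W (Suc 0)) ?d t. Poly_Mapping.lookup p t =
            (\<Sum>q\<in>?W (Suc 0). Poly_Mapping.lookup (aug ?F q) (?d q) * w q)) \<longleftrightarrow>
          (t \<in> Poly_Mapping.keys p \<longrightarrow> (\<exists>e\<in>E. e \<subseteq> Poly_Mapping.keys t))" (is "?L \<longleftrightarrow> ?R") for t
    proof
      assume ?L
      then obtain w where w: "w \<in> strand (?W (Suc 0)) ?d t"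
        and pt: "Poly_Mapping.lookup p t = (\<Sum>q\<in>?W (Suc 0). Poly_Mapping.lookup (aug ?F q) (?d q) * w q)" by blast
      show ?R
      proof
        assume "t \<in> Poly_Mapping.keys p"
        hence "(\<Sum>q\<in>?W (Suc 0). Poly_Mapping.lookup (aug ?F q) (?d q) * w q) \<noteq> 0" using pt by (simp add: in_keys_iff)
        then obtain q where q: "q \<in> ?W (Suc 0)" "w q \<noteq> 0"
          by (metis (no_types, lifting) mult_zero_right sum.neutral)
        then obtain a where a: "from_nat q = [a]" "a < n"
          by (auto simp: word_codes_def words_def length_Suc_conv)
        have "set (from_nat q) \<subseteq> {a. en a \<subseteq> Poly_Mapping.keys t}" using w q(2) unfolding st by blast
        thus "\<exists>e\<in>E. e \<subseteq> Poly_Mapping.keys t" using a en by auto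
      qed
    next
      assume R: ?R
      show ?L
      proof (cases "t \<in> Poly_Mapping.keys p")
        case True
        then obtain a where a: "a < n" "en a \<subseteq> Poly_Mapping.keys t" using R en by auto
        let ?w = "\<lambda>j. if j = to_nat [a] then Poly_Mapping.lookup p t else 0"
        have aW: "to_nat [a] \<in> ?W (Suc 0)" using a(1) by (simp add: word_codes_def words_def)
        have "?w \<in> strand (?W (Suc 0)) ?d t" unfolding st using aW a(2) by auto
        moreover have "(\<Sum>q\<in>?W (Suc 0). Poly_Mapping.lookup (aug ?F q) (?d q) * ?w q) = Poly_Mapping.lookup p t"
          using aW finW by (simp add: if_distrib augF cong: if_cong)
        ultimately show ?thesis by (intro bexI[of _ ?w]) (simp_all only:)
      next
        case False
        hence "Poly_Mapping.lookup p t = 0" by (simp add: in_keys_iff)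
        moreover have "(\<lambda>_. 0) \<in> strand (?W (Suc 0)) ?d t" by (simp add: strand_def)
        ultimately show ?thesis by (intro bexI[of _ "\<lambda>_. 0"]) simp_all
      qed
    qed
    moreover have "p \<in> aug_map ?F ` chains V ?F 0 \<longleftrightarrow> p \<in> poly_ring V \<and>
       (\<forall>t. \<exists>w\<in>strand (?W (Suc 0)) ?d t.
       Poly_Mapping.lookup p t = (\<Sum>q\<in>?W (Suc 0). Poly_Mapping.lookup (aug ?F q) (?d q) * w q))"
    proof -
      have 1: "Poly_Mapping.keys (aug ?F q) \<subseteq> {fdeg ?F 0 q}" "Poly_Mapping.keys (fdeg ?F 0 q) \<subseteq> V"
        if "q \<in> basis ?F 0" for q
      proof -
        have "q \<in> ?W (Suc 0)" using that by (simp add: F)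
        thus "Poly_Mapping.keys (aug ?F q) \<subseteq> {fdeg ?F 0 q}" "Poly_Mapping.keys (fdeg ?F 0 q) \<subseteq> V"
          using augF dV by (simp_all add: F(2))
      qed
      show ?thesis using aug_image_iff[of ?F V p, OF 1] unfolding F(1,2) .
    qed
    ultimately show "p \<in> aug_map ?F ` chains V ?F 0 \<longleftrightarrow> p \<in> edge_ideal V E"
      unfolding edge_ideal_iff[OF V] by auto
  qed
  have keysaug: "Poly_Mapping.keys (aug ?F q) \<subseteq> {?d q}" if "q \<in> ?W (Suc 0)" for q
    using augF[OF that] by simp
  have "bdry_map ?F 0 ` chains V ?F (Suc 0) = {f \<in> chains V ?F 0. aug_map ?F f = 0}"
    unfolding bdry_map_eq chains_eq F using exact[of 0] by (simp add: aug0)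
  moreover have "\<forall>i. bdry_map ?F (Suc i) ` chains V ?F (Suc (Suc i)) =
      {f \<in> chains V ?F (Suc i). bdry_map ?F i f = (\<lambda>_. 0)}"
    unfolding bdry_map_eq chains_eq F using exact by blast
  moreover have "\<forall>i. finite (basis ?F i)" by (simp add: F finW)
  moreover have "\<forall>i. \<forall>j\<in>basis ?F i. Poly_Mapping.keys (fdeg ?F i j) \<subseteq> V"
    unfolding F using dV by blast
  moreover have "\<forall>i. \<forall>p\<in>basis ?F i. \<forall>q\<in>basis ?F (Suc i). bdry ?F i p q \<in> poly_ring V \<and>
        (\<forall>m\<in>Poly_Mapping.keys (bdry ?F i p q). m + fdeg ?F i p = fdeg ?F (Suc i) q)"
    unfolding F using M gr[unfolded graded_matrix_def] by blast
  moreover have "\<forall>q\<in>basis ?F 0. Poly_Mapping.keys (aug ?F q) \<subseteq> {fdeg ?F 0 q}"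
    unfolding F(1,2) using keysaug by blast
  ultimately show ?thesis
    unfolding free_resolution_def using image by (intro conjI)
qed

lemma edge_ideal_has_resolution:
  fixes E :: "'v set set"
  assumes V: "finite V" "E \<subseteq> Pow V"
  shows "\<exists>F. free_resolution V (edge_ideal V E :: ('v, 'k::comm_ring_1) pol set) F"
proof -
  have "finite (Pow V)" using V(1) by simp
  with V(2) have "finite E" by (rule finite_subset)
  then obtain n and en :: "nat \<Rightarrow> 'v set" where "E = en ` {i. i < n}"
    unfolding finite_conv_nat_seg_image by (elim exE) (rule that)
  hence "E = en ` {..<n}" unfolding lessThan_def .
  from taylor_complex_resolution[OF V this] show ?thesis by (rule exI)
qed

section \<open>Rank and nullity\<close>

abbreviation fscale :: "'k::field \<Rightarrow> (nat \<Rightarrow> 'k) \<Rightarrow> nat \<Rightarrow> 'k" where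
  "fscale \<equiv> (\<lambda>c u j. c * u j)"

interpretation FS: vector_space "fscale :: 'k::field \<Rightarrow> (nat \<Rightarrow> 'k) \<Rightarrow> nat \<Rightarrow> 'k"
  by unfold_locales (auto simp: fun_eq_iff algebra_simps)

definition fin_vecs :: "nat set \<Rightarrow> (nat \<Rightarrow> 'k::field) set" where
  "fin_vecs J = {u. \<forall>j. u j \<noteq> 0 \<longrightarrow> j \<in> J}"

definition fun_linear :: "((nat \<Rightarrow> 'k::field) \<Rightarrow> nat \<Rightarrow> 'k) \<Rightarrow> bool" where
  "fun_linear f \<longleftrightarrow> (\<forall>u w. f (u + w) = f u + f w) \<and> (\<forall>c u. f (fscale c u) = fscale c (f u))"

lemma fun_linear_imp_linear: "fun_linear f \<Longrightarrow> Vector_Spaces.linear fscale fscale f"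
  by unfold_locales (auto simp: fun_linear_def)

lemma sum_apply: "(\<Sum>i\<in>I. f i) (j :: nat) = (\<Sum>i\<in>I. f i j :: 'k::field)"
  by (induction I rule: infinite_finite_induct) auto

lemma fin_vecs_in_span:
  assumes "finite J"
  shows "fin_vecs J \<subseteq> FS.span ((\<lambda>i j. of_bool (j = i)) ` J :: (nat \<Rightarrow> 'k::field) set)"
proof
  fix u :: "nat \<Rightarrow> 'k" assume u: "u \<in> fin_vecs J"
  have "u = (\<Sum>i\<in>J. fscale (u i) (\<lambda>j. of_bool (j = i)))"
  proof
    fix j
    have "(\<Sum>i\<in>J. fscale (u i) (\<lambda>j. of_bool (j = i))) j = (\<Sum>i\<in>J. if i = j then u j else 0)"
      unfolding sum_apply by (intro sum.cong) auto
    also have "\<dots> = u j" using u assms by (auto simp: fin_vecs_def)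
    finally show "u j = (\<Sum>i\<in>J. fscale (u i) (\<lambda>j. of_bool (j = i))) j" by simp
  qed
  also have "\<dots> \<in> FS.span ((\<lambda>i j. of_bool (j = i)) ` J)"
    by (intro FS.span_sum FS.span_scale FS.span_base) auto
  finally show "u \<in> FS.span ((\<lambda>i j. of_bool (j = i)) ` J)" .
qed

text \<open>
  The coordinates of \<open>x\<close> with respect to \<open>B\<close> vanish outside \<open>C\<close> and outside \<open>D\<close>.
\<close>
lemma independent_disjoint_spans:
  fixes x :: "nat \<Rightarrow> 'k::field"
  assumes "FS.independent B" "C \<subseteq> B" "D \<subseteq> B" "C \<inter> D = {}" "x \<in> FS.span C" "x \<in> FS.span D"
  shows "x = 0"
proof -
  have "FS.representation B x = FS.representation C x" "FS.representation B x = FS.representation D x"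
    using assms FS.representation_extend by blast+
  hence "FS.representation B x b = 0" for b
    using FS.representation_ne_zero[of C x b] FS.representation_ne_zero[of D x b] assms(4) by auto
  moreover have "x \<in> FS.span B" using assms FS.span_mono by blast
  hence "(\<Sum>b | FS.representation B x b \<noteq> 0. fscale (FS.representation B x b) b) = x"
    using FS.sum_nonzero_representation_eq[OF assms(1)] by blast
  ultimately show ?thesis by simp
qed

text \<open>
  The space of all functions has infinite dimension, so the argument is made for subspaces of
  finitely supported functions: extend a basis of the kernel to one of \<open>U\<close>; the new vectors are mapped to
  a basis of the image.
\<close>
lemma vdim_rank_nullity:
  fixes U :: "(nat \<Rightarrow> 'k::field) set"
  assumes U: "FS.subspace U" "U \<subseteq> fin_vecs J" "finite J" and f: "fun_linear f"
  shows "vdim U = vdim (f ` U) + vdim {u \<in> U. f u = 0}"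
proof -
  note lin = fun_linear_imp_linear[OF f]
  interpret f: Vector_Spaces.linear fscale fscale f by (rule lin)
  define K where "K = {u \<in> U. f u = 0}"
  obtain B0 where B0: "B0 \<subseteq> K" "FS.independent B0" "K \<subseteq> FS.span B0"
    using FS.maximal_independent_subset[of K] by metis
  obtain B where B: "B0 \<subseteq> B" "B \<subseteq> U" "FS.independent B" "U \<subseteq> FS.span B"
    using FS.maximal_independent_subset_extend[of B0 U] B0 unfolding K_def by (metis (no_types, lifting) mem_Collect_eq subset_iff)
  have "B \<subseteq> FS.span ((\<lambda>i j. of_bool (j = i)) ` J)" using B(2) U(2) fin_vecs_in_span[OF U(3)] by blast
  hence finB: "finite B" using FS.independent_span_bound[OF _ B(3)] U(3) by blast
  have subK: "FS.subspace K" unfolding K_def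
    using U(1) by (auto simp: FS.subspace_def f.add f.scale f.zero fun_eq_iff)
  define C where "C = B - B0"
  have spC: "FS.span C \<subseteq> U" unfolding C_def using B(2) U(1) by (intro FS.span_minimal) auto
  have inj: "inj_on f (FS.span C)"
    unfolding f.inj_on_iff_eq_0[OF FS.subspace_span]
  proof (intro ballI impI)
    fix x assume x: "x \<in> FS.span C" "f x = 0"
    hence "x \<in> FS.span B0" using spC B0(3) by (auto simp: K_def)
    thus "x = 0" using independent_disjoint_spans[OF B(3), of C B0 x] x(1) B(1) by (auto simp: C_def)
  qed
  have indC: "FS.independent C" using B(3) FS.independent_mono[of B C] by (auto simp: C_def)
  have "FS.independent (f ` C)" by (rule f.independent_injective_image[OF indC inj])
  moreover have "f ` U \<subseteq> FS.span (f ` C)"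
  proof
    fix y assume "y \<in> f ` U"
    then obtain u where "u \<in> U" "y = f u" by blast
    hence "y \<in> FS.span (f ` B)" using B(4) f.span_image[of B] by blast
    moreover have "f ` B \<subseteq> insert 0 (f ` C)" using B0(1) by (auto simp: C_def K_def)
    ultimately show "y \<in> FS.span (f ` C)" using FS.span_mono[of "f ` B" "insert 0 (f ` C)"]
      unfolding FS.span_insert_0 by blast
  qed
  moreover have "f ` C \<subseteq> f ` U" using B(2) by (auto simp: C_def)
  ultimately have "vdim (f ` U) = card (f ` C)"
    unfolding vdim_def using FS.basis_card_eq_dim[of "f ` C" "f ` U"] by simp
  also have "\<dots> = card C" using inj FS.span_superset[of C] by (intro card_image) (rule inj_on_subset)
  finally have 1: "vdim (f ` U) = card C" .
  have 2: "vdim K = card B0" unfolding vdim_def using FS.basis_card_eq_dim[OF B0(1,3,2)] by simp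
  have 3: "vdim U = card B" unfolding vdim_def using FS.basis_card_eq_dim[OF B(2,4,3)] by simp
  have "card B = card C + card B0" unfolding C_def
    using card_Diff_subset[of B0 B] card_mono[OF finB B(1)] finite_subset[OF B(1) finB] B(1) by simp
  thus ?thesis using 1 2 3 unfolding K_def by simp
qed

lemma vdim_zero: "vdim {0 :: nat \<Rightarrow> 'k::field} = 0"
  unfolding vdim_def by (metis FS.dim_span FS.span_empty FS.dim_eq_card_independent FS.independent_empty card.empty)

section \<open>Complexes filtered by sets\<close>

text \<open>
  Level \<open>n + 1\<close> is meant to be the module \<open>F\<^sub>n\<close> of a resolution, and level \<open>0\<close> is empty. With this shift every
  homology group is one of cycles in a level that has a predecessor, and the lowest level needs no
  separate treatment in the exact sequences. The differential does not decrease the set \<open>dg\<close> from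
  the target to the source, so generators with \<open>A \<subseteq> dg\<close> form a quotient complex and those with \<open>dg \<subseteq> V\<close> a subcomplex.
\<close>
locale filtered_complex =
  fixes idx :: "nat \<Rightarrow> nat set" and dg :: "nat \<Rightarrow> nat \<Rightarrow> 'v set" and D :: "nat \<Rightarrow> nat \<Rightarrow> nat \<Rightarrow> 'k::field"
  assumes finite_idx: "finite (idx n)" and idx_0: "idx 0 = {}"
    and D_mono: "q \<in> idx (Suc n) \<Longrightarrow> D n p q \<noteq> 0 \<Longrightarrow> p \<in> idx n \<and> dg n p \<subseteq> dg (Suc n) q"
    and D_D: "r \<in> idx (Suc (Suc n)) \<Longrightarrow> (\<Sum>q\<in>idx (Suc n). D n p q * D (Suc n) q r) = 0"
begin

definition ch :: "nat \<Rightarrow> 'v set \<Rightarrow> 'v set \<Rightarrow> (nat \<Rightarrow> 'k) set" where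
  "ch n A V = {u. \<forall>j. u j \<noteq> 0 \<longrightarrow> j \<in> idx n \<and> A \<subseteq> dg n j \<and> dg n j \<subseteq> V}"

text \<open>
  On vectors supported below \<open>V\<close> the differential stays below \<open>V\<close>, so only the lower bound \<open>A\<close> has to be imposed.
\<close>
definition bd :: "nat \<Rightarrow> 'v set \<Rightarrow> (nat \<Rightarrow> 'k) \<Rightarrow> nat \<Rightarrow> 'k" where
  "bd n A u = (\<lambda>p. if A \<subseteq> dg n p then \<Sum>q\<in>idx (Suc n). D n p q * u q else 0)"

fun cyc :: "nat \<Rightarrow> 'v set \<Rightarrow> 'v set \<Rightarrow> (nat \<Rightarrow> 'k) set" where
  "cyc 0 A V = ch 0 A V"
| "cyc (Suc n) A V = {u \<in> ch (Suc n) A V. bd n A u = 0}"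

definition bnd :: "nat \<Rightarrow> 'v set \<Rightarrow> 'v set \<Rightarrow> (nat \<Rightarrow> 'k) set" where
  "bnd n A V = bd n A ` ch (Suc n) A V"

definition hdim :: "nat \<Rightarrow> 'v set \<Rightarrow> 'v set \<Rightarrow> nat" where
  "hdim n A V = vdim (cyc n A V) - vdim (bnd n A V)"

definition acyclic :: "'v set \<Rightarrow> 'v set \<Rightarrow> bool" where
  "acyclic A V \<longleftrightarrow> (\<forall>n. cyc n A V \<subseteq> bnd n A V)"

definition spherical :: "nat \<Rightarrow> 'v set \<Rightarrow> 'v set \<Rightarrow> bool" where
  "spherical k A V \<longleftrightarrow> (\<forall>n. hdim n A V = of_bool (n = k))"

text \<open>
  The projection from \<open>ch n A V\<close> onto \<open>ch n (insert v A) V\<close>. Its kernel is \<open>ch n A (V - {v})\<close>; this is the short exact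
  sequence on which everything rests.
\<close>
definition restr :: "nat \<Rightarrow> 'v \<Rightarrow> (nat \<Rightarrow> 'k) \<Rightarrow> nat \<Rightarrow> 'k" where
  "restr n v u = (\<lambda>j. if v \<in> dg n j then u j else 0)"

lemma bd_linear: "fun_linear (bd n A)"
proof -
  have "c * (\<Sum>q\<in>Q. d q * u q) = (\<Sum>q\<in>Q. d q * (c * u q))" for c :: 'k and Q :: "nat set" and d u
    by (simp add: sum_distrib_left mult.left_commute)
  thus ?thesis by (auto simp: fun_linear_def bd_def fun_eq_iff sum.distrib distrib_left)
qed

lemma restr_linear: "fun_linear (restr n v)"
  by (auto simp: fun_linear_def restr_def fun_eq_iff)

lemma bd_add: "bd n A (u + w) = bd n A u + bd n A w"
  using bd_linear by (simp add: fun_linear_def)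

lemma bd_diff: "bd n A (u - w) = bd n A u - bd n A w"
  by (auto simp: bd_def fun_eq_iff sum_subtractf right_diff_distrib)

lemma bd_0: "bd n A 0 = 0"
  by (auto simp: bd_def fun_eq_iff)

lemma restr_add: "restr n v (u + w) = restr n v u + restr n v w"
  by (auto simp: restr_def)

lemma restr_0: "restr n v 0 = 0"
  by (auto simp: restr_def)

lemma restr_diff: "restr n v (u - w) = restr n v u - restr n v w"
  by (auto simp: restr_def)

lemma ch_subspace: "FS.subspace (ch n A V)"
  unfolding FS.subspace_def
proof (intro conjI ballI allI)
  show "x + y \<in> ch n A V" if "x \<in> ch n A V" "y \<in> ch n A V" for x y
    unfolding ch_def mem_Collect_eq
  proof (intro allI impI)
    fix j assume "(x + y) j \<noteq> 0"
    hence "x j \<noteq> 0 \<or> y j \<noteq> 0" by auto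
    thus "j \<in> idx n \<and> A \<subseteq> dg n j \<and> dg n j \<subseteq> V" using that by (auto simp: ch_def)
  qed
qed (auto simp: ch_def)

lemma ch_0: "0 \<in> ch n A V" by (simp add: ch_def)

lemma ch_add: "u \<in> ch n A V \<Longrightarrow> w \<in> ch n A V \<Longrightarrow> u + w \<in> ch n A V"
  using ch_subspace by (auto simp: FS.subspace_def)

lemma ch_diff: "u \<in> ch n A V \<Longrightarrow> w \<in> ch n A V \<Longrightarrow> u - w \<in> ch n A V"
  using ch_subspace FS.subspace_diff by blast

lemma ch_fin_vecs: "ch n A V \<subseteq> fin_vecs (idx n)"
  by (auto simp: ch_def fin_vecs_def)

lemma ch_level_0: "ch 0 A V = {0}"
  by (auto simp: ch_def idx_0 fun_eq_iff)

lemma ch_mono: "V \<subseteq> V' \<Longrightarrow> ch n A V \<subseteq> ch n A V'"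
  by (auto simp: ch_def)

lemma bd_in_ch: "u \<in> ch (Suc n) A V \<Longrightarrow> bd n A u \<in> ch n A V"
  unfolding ch_def mem_Collect_eq
proof (intro allI impI)
  fix p assume u: "\<forall>j. u j \<noteq> 0 \<longrightarrow> j \<in> idx (Suc n) \<and> A \<subseteq> dg (Suc n) j \<and> dg (Suc n) j \<subseteq> V"
    and "bd n A u p \<noteq> 0"
  hence A: "A \<subseteq> dg n p" and "(\<Sum>q\<in>idx (Suc n). D n p q * u q) \<noteq> 0" by (auto simp: bd_def split: if_splits)
  then obtain q where "q \<in> idx (Suc n)" "D n p q \<noteq> 0" "u q \<noteq> 0"
    by (metis (no_types, lifting) mult_zero_left mult_zero_right sum.neutral)
  thus "p \<in> idx n \<and> A \<subseteq> dg n p \<and> dg n p \<subseteq> V" using A u D_mono[of q n p] by blast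
qed

lemma bd_bd: "bd n A (bd (Suc n) A u) = 0"
proof
  fix p
  show "bd n A (bd (Suc n) A u) p = 0 p"
  proof (cases "A \<subseteq> dg n p")
    case True
    have "D n p q * bd (Suc n) A u q = D n p q * (\<Sum>r\<in>idx (Suc (Suc n)). D (Suc n) q r * u r)"
      if "q \<in> idx (Suc n)" for q
      using D_mono[OF that, of p] True by (cases "D n p q = 0") (auto simp: bd_def)
    hence "bd n A (bd (Suc n) A u) p =
      (\<Sum>q\<in>idx (Suc n). \<Sum>r\<in>idx (Suc (Suc n)). D n p q * D (Suc n) q r * u r)"
      using True unfolding bd_def[of n] by (simp add: sum_distrib_left mult.assoc)
    also have "\<dots> = (\<Sum>r\<in>idx (Suc (Suc n)). (\<Sum>q\<in>idx (Suc n). D n p q * D (Suc n) q r) * u r)"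
      by (subst sum.swap) (simp add: sum_distrib_right)
    also have "\<dots> = 0" by (intro sum.neutral ballI) (simp add: D_D)
    finally show ?thesis by simp
  qed (simp add: bd_def)
qed

lemma cyc_ch: "cyc n A V \<subseteq> ch n A V"
  by (cases n) auto

lemma bnd_subset_cyc: "bnd n A V \<subseteq> cyc n A V"
  by (cases n) (auto simp: bnd_def bd_bd intro: bd_in_ch)

lemma cyc_subspace: "FS.subspace (cyc n A V)"
proof (cases n)
  case (Suc m)
  interpret f: Vector_Spaces.linear fscale fscale "bd m A" by (rule fun_linear_imp_linear[OF bd_linear])
  show ?thesis unfolding Suc using ch_subspace[of "Suc m" A V]
    by (auto simp: FS.subspace_def f.add f.scale f.zero fun_eq_iff)
qed (simp add: ch_subspace)

lemma bnd_subspace: "FS.subspace (bnd n A V)"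
proof -
  interpret f: Vector_Spaces.linear fscale fscale "bd n A" by (rule fun_linear_imp_linear[OF bd_linear])
  show ?thesis unfolding bnd_def by (rule f.subspace_image[OF ch_subspace])
qed

lemma ch_rank_nullity:
  assumes "FS.subspace U" "U \<subseteq> ch n A V" "fun_linear f"
  shows "vdim U = vdim (f ` U) + vdim {u \<in> U. f u = 0}"
  using vdim_rank_nullity[OF assms(1) _ finite_idx assms(3)] assms(2) ch_fin_vecs by blast

lemma acyclic_cyc_eq: "acyclic A V \<Longrightarrow> cyc n A V = bnd n A V"
  using bnd_subset_cyc[of n A V] unfolding acyclic_def by blast

lemma acyclic_hdim: "acyclic A V \<Longrightarrow> hdim n A V = 0"
  by (simp add: hdim_def acyclic_cyc_eq)

lemma hdim_0: "hdim 0 A V = 0"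
  by (simp add: hdim_def ch_level_0 vdim_zero)

lemma cyc_sub: "cyc n A (V - {v}) = cyc n A V \<inter> ch n A (V - {v})"
  using ch_mono[of "V - {v}" V] by (cases n) auto

lemma restr_in_ch: "u \<in> ch n A V \<Longrightarrow> restr n v u \<in> ch n (insert v A) V"
  by (auto simp: ch_def restr_def)

lemma restr_remainder: "u \<in> ch n A V \<Longrightarrow> u - restr n v u \<in> ch n A (V - {v})"
  by (auto simp: ch_def restr_def)

lemma restr_id: "u \<in> ch n (insert v A) V \<Longrightarrow> restr n v u = u"
  by (auto simp: ch_def restr_def fun_eq_iff)

lemma restr_eq_0_iff: "u \<in> ch n A V \<Longrightarrow> restr n v u = 0 \<longleftrightarrow> u \<in> ch n A (V - {v})"
  by (auto simp: ch_def restr_def fun_eq_iff)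

lemma ch_insert: "ch n (insert v A) V \<subseteq> ch n A V"
  by (auto simp: ch_def)

lemma bd_insert: "bd n (insert v A) u = restr n v (bd n A u)"
  by (auto simp: bd_def restr_def fun_eq_iff)

lemma ch_sub: "u \<in> ch n A (V - {v}) \<Longrightarrow> u \<in> ch n A V"
  using ch_mono[of "V - {v}" V] by auto

lemma bd_restr:
  assumes "u \<in> ch (Suc n) A V"
  shows "bd n (insert v A) (restr (Suc n) v u) = restr n v (bd n A u)"
proof -
  have "bd n A (u - restr (Suc n) v u) \<in> ch n A (V - {v})"
    by (intro bd_in_ch restr_remainder assms)
  hence "restr n v (bd n A (u - restr (Suc n) v u)) = 0"
    using restr_eq_0_iff ch_sub by blast
  thus ?thesis by (simp add: bd_insert bd_diff restr_diff)
qed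

lemma restr_image_ch: "restr n v ` ch n A V = ch n (insert v A) V"
proof
  show "restr n v ` ch n A V \<subseteq> ch n (insert v A) V" using restr_in_ch by blast
  show "ch n (insert v A) V \<subseteq> restr n v ` ch n A V"
  proof
    fix u assume u: "u \<in> ch n (insert v A) V"
    hence "u \<in> ch n A V" using ch_insert by blast
    thus "u \<in> restr n v ` ch n A V" using restr_id[OF u] by (intro image_eqI[of _ _ u]) simp_all
  qed
qed

lemma restr_image_bnd: "restr n v ` bnd n A V = bnd n (insert v A) V"
proof -
  have "restr n v ` bnd n A V = (\<lambda>u. bd n (insert v A) (restr (Suc n) v u)) ` ch (Suc n) A V"
    unfolding bnd_def image_image using bd_restr by (intro image_cong refl) simp
  also have "\<dots> = bd n (insert v A) ` restr (Suc n) v ` ch (Suc n) A V" by (simp add: image_image)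
  also have "\<dots> = bnd n (insert v A) V" by (simp add: restr_image_ch bnd_def)
  finally show ?thesis .
qed

text \<open>
  The part of the long exact sequence around the quotient: if the inclusion of the subcomplex is
  injective and surjective on homology, the quotient has no homology. Lift a cycle \<open>z\<close> of the quotient; its
  boundary lies in the subcomplex and can be corrected by some \<open>s\<close> there to make \<open>z - s\<close> a cycle, which is
  homologous to some \<open>s'\<close> in the subcomplex and so vanishes in the quotient up to a boundary.
\<close>
lemma acyclic_insert:
  assumes inj: "\<And>n. bnd n A V \<inter> ch n A (V - {v}) \<subseteq> bnd n A (V - {v})"
    and sur: "\<And>n z. z \<in> cyc n A V \<Longrightarrow> \<exists>s\<in>ch n A (V - {v}). z - s \<in> bnd n A V"
  shows "acyclic (insert v A) V"
  unfolding acyclic_def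
proof (intro allI subsetI)
  fix n z assume z: "z \<in> cyc n (insert v A) V"
  show "z \<in> bnd n (insert v A) V"
  proof (cases n)
    case 0
    thus ?thesis using z bd_0[of 0 "insert v A"] ch_0 by (auto simp: ch_level_0 bnd_def image_iff intro!: bexI[of _ 0])
  next
    case (Suc m)
    have zQ: "z \<in> ch n (insert v A) V" and zC: "z \<in> ch n A V" using z cyc_ch ch_insert by blast+
    have "restr m v (bd m A z) = 0" using z by (simp add: Suc bd_insert)
    moreover have "bd m A z \<in> ch m A V" using zC by (simp add: Suc bd_in_ch)
    ultimately have "bd m A z \<in> ch m A (V - {v})" using restr_eq_0_iff by blast
    moreover have "bd m A z \<in> bnd m A V" using zC by (simp add: bnd_def Suc)
    ultimately obtain s where s: "s \<in> ch n A (V - {v})" "bd m A z = bd m A s"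
      using inj[of m] unfolding bnd_def Suc by blast
    hence "z - s \<in> cyc n A V" using zC ch_sub[OF s(1)] ch_diff[of z n A V s] by (simp add: Suc bd_diff)
    then obtain s' where s': "s' \<in> ch n A (V - {v})" "z - s - s' \<in> bnd n A V" using sur by blast
    have "restr n v s = 0" "restr n v s' = 0" using s(1) s'(1) restr_eq_0_iff ch_sub by blast+
    hence "restr n v (z - s - s') = z" by (simp add: restr_diff restr_id[OF zQ])
    thus ?thesis using s'(2) unfolding restr_image_bnd[of n v A V, symmetric]
      by (intro image_eqI[of _ _ "z - s - s'"]) simp_all
  qed
qed

lemma acyclic_quotient:
  assumes "acyclic A (V - {v})" "acyclic A V"
  shows "acyclic (insert v A) V"
proof (rule acyclic_insert)
  show "bnd n A V \<inter> ch n A (V - {v}) \<subseteq> bnd n A (V - {v})" for n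
    using bnd_subset_cyc[of n A V] cyc_sub[of n A V v] assms(1) by (auto simp: acyclic_def)
  show "\<exists>s\<in>ch n A (V - {v}). z - s \<in> bnd n A V" if "z \<in> cyc n A V" for n z
    using that assms(2) ch_0 by (intro bexI[of _ 0]) (auto simp: acyclic_def)
qed

text \<open>
  The projection maps cycles onto cycles, since the obstruction lies in the homology of the
  subcomplex, and boundaries onto boundaries. Both restricted projections have the
  boundaries of the subcomplex as their kernel, so the two dimensions drop by the same amount.
\<close>
lemma hdim_quotient_if_sub_acyclic:
  assumes ac: "acyclic A (V - {v})"
  shows "hdim n (insert v A) V = hdim n A V"
proof -
  have kb: "{u \<in> bnd n A V. restr n v u = 0} = bnd n A (V - {v})"
  proof
    show "{u \<in> bnd n A V. restr n v u = 0} \<subseteq> bnd n A (V - {v})"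
    proof
      fix u assume u: "u \<in> {u \<in> bnd n A V. restr n v u = 0}"
      hence "u \<in> cyc n A V" using bnd_subset_cyc by blast
      moreover from this u have "u \<in> ch n A (V - {v})" using restr_eq_0_iff cyc_ch by blast
      ultimately show "u \<in> bnd n A (V - {v})" using ac cyc_sub[of n A V v] by (auto simp: acyclic_def)
    qed
    show "bnd n A (V - {v}) \<subseteq> {u \<in> bnd n A V. restr n v u = 0}"
      using ch_sub restr_eq_0_iff bd_in_ch unfolding bnd_def by blast
  qed
  have kc: "{u \<in> cyc n A V. restr n v u = 0} = bnd n A (V - {v})"
  proof -
    have "{u \<in> cyc n A V. restr n v u = 0} = cyc n A (V - {v})"
      unfolding cyc_sub using cyc_ch restr_eq_0_iff by blast
    thus ?thesis using acyclic_cyc_eq[OF ac] by simp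
  qed
  have "restr n v ` cyc n A V = cyc n (insert v A) V"
  proof (cases n)
    case 0
    thus ?thesis using restr_image_ch[of 0] by simp
  next
    case (Suc m)
    show ?thesis
    proof
      show "restr n v ` cyc n A V \<subseteq> cyc n (insert v A) V"
      proof
        fix y assume "y \<in> restr n v ` cyc n A V"
        then obtain u where "u \<in> ch (Suc m) A V" "bd m A u = 0" "y = restr n v u" by (auto simp: Suc)
        thus "y \<in> cyc n (insert v A) V"
          using bd_restr[of u m A V v] restr_in_ch[of u n A V v] by (simp add: Suc restr_0)
      qed
      show "cyc n (insert v A) V \<subseteq> restr n v ` cyc n A V"
      proof
        fix z assume z: "z \<in> cyc n (insert v A) V"
        have zQ: "z \<in> ch n (insert v A) V" and zC: "z \<in> ch n A V" using z cyc_ch ch_insert by blast+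
        have "restr m v (bd m A z) = 0" using z by (simp add: Suc bd_insert)
        moreover have "bd m A z \<in> ch m A V" using zC by (simp add: Suc bd_in_ch)
        ultimately have "bd m A z \<in> ch m A (V - {v})" using restr_eq_0_iff by blast
        moreover have "bd m A z \<in> cyc m A V" using bnd_subset_cyc[of m A V] zC by (auto simp: bnd_def Suc)
        ultimately have "bd m A z \<in> bnd m A (V - {v})" using ac cyc_sub[of m A V v] by (auto simp: acyclic_def)
        then obtain s where s: "s \<in> ch n A (V - {v})" "bd m A z = bd m A s" by (auto simp: bnd_def Suc)
        hence "z - s \<in> cyc n A V" using zC ch_sub[OF s(1)] ch_diff[of z n A V s] by (simp add: Suc bd_diff)
        moreover have "restr n v s = 0" using s(1) restr_eq_0_iff ch_sub by blast
        hence "z = restr n v (z - s)" by (simp add: restr_diff restr_id[OF zQ])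
        ultimately show "z \<in> restr n v ` cyc n A V" by blast
      qed
    qed
  qed
  hence "vdim (cyc n A V) = vdim (cyc n (insert v A) V) + vdim (bnd n A (V - {v}))"
    using ch_rank_nullity[OF cyc_subspace cyc_ch restr_linear, of n A V n v] kc by simp
  moreover have "vdim (bnd n A V) = vdim (bnd n (insert v A) V) + vdim (bnd n A (V - {v}))"
    using ch_rank_nullity[OF bnd_subspace _ restr_linear, of n A V n A V n v] kb
      order_trans[OF bnd_subset_cyc cyc_ch, of n A V] by (simp add: restr_image_bnd)
  ultimately show ?thesis by (simp add: hdim_def)
qed

text \<open>
  The connecting homomorphism in terms of dimensions. It is induced by the differential on the
  space \<open>P\<close> of chains whose boundary lies in the subcomplex, where trivial classes correspond to the space
  \<open>N\<close>. The projection maps \<open>P\<close> and \<open>N\<close> onto the cycles and boundaries of the quotient, both times with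
  kernel the chains of the subcomplex, and the differential maps them onto the cycles and boundaries of the subcomplex,
  both times with kernel the cycles of the total complex. Compare the four dimensions.
\<close>
lemma hdim_quotient_if_total_acyclic:
  assumes ac: "acyclic A V"
  shows "hdim (Suc n) (insert v A) V = hdim n A (V - {v})"
proof -
  let ?S = "ch (Suc n) A (V - {v})"
  define P where "P = {u \<in> ch (Suc n) A V. bd n A u \<in> ch n A (V - {v})}"
  define N where "N = {b + s | b s. b \<in> bnd (Suc n) A V \<and> s \<in> ?S}"
  interpret f: Vector_Spaces.linear fscale fscale "bd n A" by (rule fun_linear_imp_linear[OF bd_linear])
  have P: "FS.subspace P" "P \<subseteq> ch (Suc n) A V"
    using ch_subspace[of "Suc n" A V] ch_subspace[of n A "V - {v}"]
    by (auto simp: P_def FS.subspace_def f.add f.scale f.zero)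
  have Nch: "N \<subseteq> ch (Suc n) A V"
    using bnd_subset_cyc[of "Suc n" A V] cyc_ch[of "Suc n" A V] ch_sub unfolding N_def by (blast intro: ch_add)
  have N: "FS.subspace N"
    unfolding N_def by (rule FS.subspace_sums[OF bnd_subspace ch_subspace])
  have SN: "?S \<subseteq> N"
  proof
    fix s assume "s \<in> ?S"
    moreover have "0 \<in> bnd (Suc n) A V" using bnd_subspace by (auto simp: FS.subspace_def)
    ultimately show "s \<in> N" unfolding N_def by (intro CollectI exI[of _ 0] exI[of _ s]) simp
  qed
  have bN: "bnd (Suc n) A V \<subseteq> N"
  proof
    fix b assume "b \<in> bnd (Suc n) A V"
    thus "b \<in> N" unfolding N_def using ch_0[of "Suc n" A "V - {v}"]
      by (intro CollectI exI[of _ b] exI[of _ 0]) simp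
  qed
  have bb: "bd n A b = 0" if "b \<in> bnd (Suc n) A V" for b using that by (auto simp: bnd_def bd_bd)
  have rS: "restr (Suc n) v s = 0" if "s \<in> ?S" for s using that restr_eq_0_iff ch_sub by blast
  have P1: "restr (Suc n) v ` P = cyc (Suc n) (insert v A) V"
  proof
    show "restr (Suc n) v ` P \<subseteq> cyc (Suc n) (insert v A) V"
    proof
      fix y assume "y \<in> restr (Suc n) v ` P"
      then obtain u where u: "u \<in> ch (Suc n) A V" "bd n A u \<in> ch n A (V - {v})" "y = restr (Suc n) v u"
        by (auto simp: P_def)
      hence "restr n v (bd n A u) = 0" using restr_eq_0_iff ch_sub by blast
      thus "y \<in> cyc (Suc n) (insert v A) V" using bd_restr[OF u(1), of v] restr_in_ch[OF u(1)] u(3) by simp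
    qed
    show "cyc (Suc n) (insert v A) V \<subseteq> restr (Suc n) v ` P"
    proof
      fix z assume z: "z \<in> cyc (Suc n) (insert v A) V"
      have zQ: "z \<in> ch (Suc n) (insert v A) V" and zC: "z \<in> ch (Suc n) A V" using z cyc_ch ch_insert by blast+
      have "restr n v (bd n A z) = 0" using z by (simp add: bd_insert)
      moreover have "bd n A z \<in> ch n A V" using zC by (simp add: bd_in_ch)
      ultimately have "bd n A z \<in> ch n A (V - {v})" using restr_eq_0_iff by blast
      hence "z \<in> P" using zC by (simp add: P_def)
      thus "z \<in> restr (Suc n) v ` P" using restr_id[OF zQ] by (intro image_eqI[of _ _ z]) simp_all
    qed
  qed
  have P2: "{u \<in> P. restr (Suc n) v u = 0} = ?S"
  proof
    show "{u \<in> P. restr (Suc n) v u = 0} \<subseteq> ?S" using restr_eq_0_iff P(2) by blast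
    show "?S \<subseteq> {u \<in> P. restr (Suc n) v u = 0}" using ch_sub bd_in_ch rS unfolding P_def by blast
  qed
  have P3: "bd n A ` P = cyc n A (V - {v})"
  proof
    show "bd n A ` P \<subseteq> cyc n A (V - {v})"
      using bnd_subset_cyc[of n A V] unfolding cyc_sub P_def bnd_def by blast
    show "cyc n A (V - {v}) \<subseteq> bd n A ` P"
      using ac unfolding cyc_sub P_def acyclic_def bnd_def by blast
  qed
  have P4: "{u \<in> P. bd n A u = 0} = cyc (Suc n) A V"
    using ch_0 by (auto simp: P_def)
  have N1: "restr (Suc n) v ` N = bnd (Suc n) (insert v A) V"
  proof
    show "restr (Suc n) v ` N \<subseteq> bnd (Suc n) (insert v A) V"
      unfolding restr_image_bnd[symmetric] N_def using rS by (auto simp: restr_add)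
    show "bnd (Suc n) (insert v A) V \<subseteq> restr (Suc n) v ` N"
      unfolding restr_image_bnd[symmetric] using bN by blast
  qed
  have N2: "{u \<in> N. restr (Suc n) v u = 0} = ?S"
    using restr_eq_0_iff Nch SN rS by blast
  have N3: "bd n A ` N = bnd n A (V - {v})"
  proof
    show "bd n A ` N \<subseteq> bnd n A (V - {v})"
      unfolding N_def bnd_def[of n] using bb by (auto simp: bd_add)
    show "bnd n A (V - {v}) \<subseteq> bd n A ` N" unfolding bnd_def[of n] using SN by blast
  qed
  have N4: "{u \<in> N. bd n A u = 0} = cyc (Suc n) A V"
  proof
    show "{u \<in> N. bd n A u = 0} \<subseteq> cyc (Suc n) A V" using Nch by auto
    show "cyc (Suc n) A V \<subseteq> {u \<in> N. bd n A u = 0}"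
      using bN acyclic_cyc_eq[OF ac, of "Suc n"] bb by blast
  qed
  have "vdim (cyc (Suc n) (insert v A) V) + vdim ?S = vdim (cyc n A (V - {v})) + vdim (cyc (Suc n) A V)"
    using ch_rank_nullity[OF P restr_linear, of "Suc n" v] ch_rank_nullity[OF P bd_linear, of n A]
    unfolding P1 P2 P3 P4 by simp
  moreover have "vdim (bnd (Suc n) (insert v A) V) + vdim ?S = vdim (bnd n A (V - {v})) + vdim (cyc (Suc n) A V)"
    using ch_rank_nullity[OF N Nch restr_linear, of "Suc n" v] ch_rank_nullity[OF N Nch bd_linear, of n A]
    unfolding N1 N2 N3 N4 by simp
  ultimately show ?thesis unfolding hdim_def by linarith
qed

lemma spherical_quotient_if_sub_acyclic:
  "acyclic A (V - {v}) \<Longrightarrow> spherical k A V \<Longrightarrow> spherical k (insert v A) V"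
  by (simp add: spherical_def hdim_quotient_if_sub_acyclic)

lemma spherical_quotient_if_total_acyclic:
  assumes "acyclic A V" "spherical k A (V - {v})"
  shows "spherical (Suc k) (insert v A) V"
  unfolding spherical_def
proof
  fix n show "hdim n (insert v A) V = of_bool (n = Suc k)"
    using assms by (cases n) (auto simp: spherical_def hdim_0 hdim_quotient_if_total_acyclic)
qed

end

section \<open>Complexes that resolve an edge ideal\<close>

text \<open>
  The axioms describe the strands \<open>C({}, V)\<close> of a resolution of the edge ideal: they are exact but for
  the cokernel, which the augmentation identifies with the component of the ideal in degree \<open>V\<close>. That
  component is \<open>k\<close> if \<open>V\<close> contains an edge and \<open>0\<close> otherwise.
\<close>
locale edge_complex = filtered_complex idx dg D
  for idx :: "nat \<Rightarrow> nat set" and dg :: "nat \<Rightarrow> nat \<Rightarrow> 'v set" and D :: "nat \<Rightarrow> nat \<Rightarrow> nat \<Rightarrow> 'k::field" +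
  fixes aug_coeff :: "nat \<Rightarrow> 'k" and W :: "'v set" and E :: "'v set set"
  assumes finite_W: "finite W"
    and exact_high: "V \<subseteq> W \<Longrightarrow> cyc (Suc (Suc n)) {} V \<subseteq> bnd (Suc (Suc n)) {} V"
    and exact_aug: "V \<subseteq> W \<Longrightarrow> bnd 1 {} V = {u \<in> ch 1 {} V. (\<Sum>q\<in>idx 1. aug_coeff q * u q) = 0}"
    and aug_onto: "V \<subseteq> W \<Longrightarrow> e \<in> E \<Longrightarrow> e \<subseteq> V \<Longrightarrow> \<exists>u\<in>ch 1 {} V. (\<Sum>q\<in>idx 1. aug_coeff q * u q) = 1"
    and aug_zero: "V \<subseteq> W \<Longrightarrow> \<forall>e\<in>E. \<not> e \<subseteq> V \<Longrightarrow> u \<in> ch 1 {} V \<Longrightarrow> (\<Sum>q\<in>idx 1. aug_coeff q * u q) = 0"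
begin

definition has_edge :: "'v set \<Rightarrow> bool" where "has_edge V \<longleftrightarrow> (\<exists>e\<in>E. e \<subseteq> V)"

definition augment :: "(nat \<Rightarrow> 'k) \<Rightarrow> 'k" where "augment u = (\<Sum>q\<in>idx 1. aug_coeff q * u q)"

lemma augment_diff: "augment (u - w) = augment u - augment w"
  by (simp add: augment_def algebra_simps sum_subtractf)

lemma augment_scale: "augment (fscale c u) = c * augment u"
  by (simp add: augment_def sum_distrib_left mult.left_commute)

lemma augment_add: "augment (u + w) = augment u + augment w"
  by (simp add: augment_def algebra_simps sum.distrib)

lemma bnd_1: "V \<subseteq> W \<Longrightarrow> bnd 1 {} V = {u \<in> ch 1 {} V. augment u = 0}"
  unfolding augment_def by (rule exact_aug)

lemma cyc_1: "cyc 1 A V = ch 1 A V"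
proof -
  have "bd 0 A u = 0" if "u \<in> ch (Suc 0) A V" for u
    using bd_in_ch[OF that] by (simp add: ch_level_0)
  thus ?thesis by auto
qed

lemma nat_cases_3: obtains "n = 0" | "n = (1::nat)" | m where "n = Suc (Suc m)"
  by (metis One_nat_def not0_implies_Suc)

lemma acyclic_no_edges:
  assumes "V \<subseteq> W" "\<not> has_edge V"
  shows "acyclic {} V"
  unfolding acyclic_def
proof
  fix n show "cyc n {} V \<subseteq> bnd n {} V"
  proof (cases rule: nat_cases_3[of n])
    case 1
    thus ?thesis using bnd_subspace[of 0 "{}" V] by (simp add: ch_level_0 FS.subspace_def)
  next
    case 2
    have "augment u = 0" if "u \<in> ch 1 {} V" for u
      unfolding augment_def using aug_zero[OF assms(1) _ that] assms(2) by (auto simp: has_edge_def)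
    thus ?thesis using 2 cyc_1[of "{}" V] bnd_1[OF assms(1)] by auto
  next
    case (3 m)
    thus ?thesis using exact_high[OF assms(1)] by blast
  qed
qed

lemma spherical_edges:
  assumes V: "V \<subseteq> W" "has_edge V"
  shows "spherical 1 {} V"
  unfolding spherical_def
proof
  fix n show "hdim n {} V = of_bool (n = 1)"
  proof (cases rule: nat_cases_3[of n])
    case 1
    thus ?thesis by (simp add: hdim_0)
  next
    case 2
    \<comment> \<open>The augmentation as a map into functions supported at \<open>0\<close>, so that rank and nullity apply.\<close>
    define f where "f u = (\<lambda>j. if j = (0::nat) then augment u else 0)" for u
    have f: "fun_linear f"
      by (auto simp: fun_linear_def f_def augment_add augment_scale fun_eq_iff)
    obtain u1 where u1: "u1 \<in> ch 1 {} V" "augment u1 = 1"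
      using V aug_onto unfolding has_edge_def augment_def by blast
    let ?e = "\<lambda>j. if j = (0::nat) then (1::'k) else 0"
    have sp: "FS.span {?e} = (\<lambda>c. fscale c ?e) ` UNIV" by (simp add: FS.span_singleton)
    have "f ` ch 1 {} V = FS.span {?e}"
    proof
      show "f ` ch 1 {} V \<subseteq> FS.span {?e}" unfolding sp f_def by (auto simp: fun_eq_iff intro!: image_eqI)
      show "FS.span {?e} \<subseteq> f ` ch 1 {} V"
      proof
        fix y assume "y \<in> FS.span {?e}"
        then obtain c where "y = fscale c ?e" unfolding sp by blast
        hence "y = f (fscale c u1)" by (simp add: f_def augment_scale u1(2) fun_eq_iff)
        moreover have "fscale c u1 \<in> ch 1 {} V" using u1(1) ch_subspace[of 1 "{}" V] by (auto simp: FS.subspace_def)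
        ultimately show "y \<in> f ` ch 1 {} V" by blast
      qed
    qed
    moreover have "FS.independent {?e}"
      using FS.dependent_single[of ?e] by (auto simp: fun_eq_iff)
    ultimately have "vdim (f ` ch 1 {} V) = 1"
      unfolding vdim_def using FS.dim_eq_card_independent[of "{?e}"] by simp
    moreover have "{u \<in> ch 1 {} V. f u = 0} = bnd 1 {} V"
      unfolding bnd_1[OF V(1)] f_def by (auto simp: fun_eq_iff)
    ultimately have "vdim (cyc 1 {} V) = 1 + vdim (bnd 1 {} V)"
      using ch_rank_nullity[OF ch_subspace subset_refl f, of 1 "{}" V] by (simp only: cyc_1)
    thus ?thesis using 2 by (simp add: hdim_def)
  next
    case (3 m)
    have "cyc n {} V = bnd n {} V"
      unfolding 3 using exact_high[OF V(1)] bnd_subset_cyc by blast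
    thus ?thesis using 3 by (simp add: hdim_def)
  qed
qed

text \<open>
  If \<open>V\<close> and \<open>V - {v}\<close> both contain an edge, the augmentation identifies the homology of either strand with
  \<open>k\<close>, compatibly with the inclusion. Otherwise neither strand has homology.
\<close>
lemma acyclic_vertex:
  assumes V: "V \<subseteq> W" "has_edge V \<Longrightarrow> has_edge (V - {v})"
  shows "acyclic {v} V"
proof (cases "has_edge V")
  case False
  have "\<not> has_edge (V - {v})" using False by (auto simp: has_edge_def)
  moreover have "V - {v} \<subseteq> W" using V(1) by blast
  ultimately have "acyclic {} (V - {v})" "acyclic {} V" using acyclic_no_edges V(1) False by auto
  thus ?thesis by (rule acyclic_quotient)
next
  case True
  have V': "V - {v} \<subseteq> W" using V(1) by blast
  show ?thesis
  proof (rule acyclic_insert)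
    fix n show "bnd n {} V \<inter> ch n {} (V - {v}) \<subseteq> bnd n {} (V - {v})"
    proof (cases rule: nat_cases_3[of n])
      case 1
      thus ?thesis using bnd_subspace[of 0 "{}" "V - {v}"] by (auto simp: ch_level_0 FS.subspace_def)
    next
      case 2
      thus ?thesis by (auto simp: bnd_1[OF V(1), simplified] bnd_1[OF V', simplified])
    next
      case (3 m)
      thus ?thesis using exact_high[OF V', of m] bnd_subset_cyc[of n "{}" V] cyc_sub[of n "{}" V v] by blast
    qed
  next
    fix n z assume z: "z \<in> cyc n {} V"
    show "\<exists>s\<in>ch n {} (V - {v}). z - s \<in> bnd n {} V"
    proof (cases rule: nat_cases_3[of n])
      case 1
      thus ?thesis using z ch_0 bnd_subspace[of 0 "{}" V] by (intro bexI[of _ 0]) (auto simp: ch_level_0 FS.subspace_def)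
    next
      case 2
      obtain u1 where u1: "u1 \<in> ch 1 {} (V - {v})" "augment u1 = 1"
        using V' V(2)[OF True] aug_onto unfolding has_edge_def augment_def by blast
      let ?s = "fscale (augment z) u1"
      have "?s \<in> ch 1 {} (V - {v})" using u1(1) ch_subspace[of 1 "{}" "V - {v}"] by (auto simp: FS.subspace_def)
      moreover have "z - ?s \<in> ch 1 {} V"
      proof (rule ch_diff)
        show "z \<in> ch 1 {} V" using z unfolding 2 cyc_1 .
        show "?s \<in> ch 1 {} V" by (rule ch_sub) fact
      qed
      moreover have "augment (z - ?s) = 0" by (simp only: augment_diff augment_scale u1(2)) simp
      ultimately have "?s \<in> ch n {} (V - {v})" "z - ?s \<in> bnd n {} V"
        unfolding 2 bnd_1[OF V(1)] by (simp_all only: mem_Collect_eq simp_thms)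
      thus ?thesis by (intro bexI[of _ ?s])
    next
      case (3 m)
      thus ?thesis using exact_high[OF V(1), of m] z ch_0 by (intro bexI[of _ 0]) auto
    qed
  qed
qed

text \<open>
  In terms of the simplicial complex of all \<open>S \<subseteq> A\<close> such that \<open>V - S\<close> contains an edge, the condition says that
  this complex is a cone with apex \<open>v\<close>. The proof enlarges \<open>{v}\<close> to \<open>A\<close>: the condition is inherited by both
  complexes from which the next one is formed.
\<close>
lemma acyclic_cone:
  assumes "v \<in> A" "A \<subseteq> V" "V \<subseteq> W"
    and "\<And>U. V - A \<subseteq> U \<Longrightarrow> U \<subseteq> V - {v} \<Longrightarrow> has_edge (insert v U) \<Longrightarrow> has_edge U"
  shows "acyclic A V"
proof -
  define A' where "A' = A - {v}"
  have "A' \<subseteq> W" using assms(2,3) by (auto simp: A'_def)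
  hence "finite A'" using finite_W by (rule finite_subset)
  hence "v \<notin> A' \<Longrightarrow> insert v A' \<subseteq> V \<Longrightarrow> V \<subseteq> W \<Longrightarrow>
    (\<And>U. V - insert v A' \<subseteq> U \<Longrightarrow> U \<subseteq> V - {v} \<Longrightarrow> has_edge (insert v U) \<Longrightarrow> has_edge U) \<Longrightarrow>
    acyclic (insert v A') V"
  proof (induction A' arbitrary: V rule: finite_induct)
    case empty
    have "has_edge V \<Longrightarrow> has_edge (V - {v})"
      using empty.prems(4)[of "V - {v}"] empty.prems(2) by (auto simp: insert_absorb)
    thus ?case using acyclic_vertex[OF empty.prems(3)] by simp
  next
    case (insert a F)
    have "acyclic (insert v F) (V - {a})"
    proof (rule insert.IH)
      fix U assume "V - {a} - insert v F \<subseteq> U" "U \<subseteq> V - {a} - {v}" "has_edge (insert v U)"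
      thus "has_edge U" by (intro insert.prems(4)[of U]) auto
    qed (use insert.prems insert.hyps in auto)
    moreover have "acyclic (insert v F) V"
    proof (rule insert.IH)
      fix U assume "V - insert v F \<subseteq> U" "U \<subseteq> V - {v}" "has_edge (insert v U)"
      thus "has_edge U" by (intro insert.prems(4)[of U]) auto
    qed (use insert.prems insert.hyps in auto)
    ultimately have "acyclic (insert a (insert v F)) V" by (rule acyclic_quotient)
    thus ?case by (simp add: insert_commute)
  qed
  moreover have "insert v A' = A" using assms(1) by (auto simp: A'_def)
  ultimately show ?thesis using assms by (auto simp: A'_def)
qed

end

section \<open>Transversals\<close>

definition hits :: "'v set set \<Rightarrow> 'v set \<Rightarrow> 'v set \<Rightarrow> bool" where
  "hits E X' U \<longleftrightarrow> (\<forall>x\<in>X'. \<exists>y\<in>U. {x, y} \<in> E)"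

definition minimal_transversal :: "'v set set \<Rightarrow> 'v set \<Rightarrow> 'v set \<Rightarrow> bool" where
  "minimal_transversal E X' U \<longleftrightarrow> hits E X' U \<and> (\<forall>y\<in>U. \<not> hits E X' (U - {y}))"

locale bipartite_complex = edge_complex idx dg D aug_coeff "X \<union> Y" E
  for idx :: "nat \<Rightarrow> nat set" and dg :: "nat \<Rightarrow> nat \<Rightarrow> 'v set" and D :: "nat \<Rightarrow> nat \<Rightarrow> nat \<Rightarrow> 'k::field"
    and aug_coeff :: "nat \<Rightarrow> 'k" and X Y :: "'v set" and E :: "'v set set" +
  assumes bipartite: "bipartite_graph X Y E"
begin

lemma finite_X: "finite X" and finite_Y: "finite Y" and X_Y_disjoint: "X \<inter> Y = {}"
  using bipartite by (auto simp: bipartite_graph_def)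

lemma has_edge_iff: "has_edge V \<longleftrightarrow> (\<exists>x y. x \<in> X \<and> y \<in> Y \<and> x \<in> V \<and> y \<in> V \<and> {x, y} \<in> E)"
proof
  assume "has_edge V"
  then obtain e where e: "e \<in> E" "e \<subseteq> V" by (auto simp: has_edge_def)
  then obtain x y where "x \<in> X" "y \<in> Y" "e = {x, y}" using bipartite by (auto simp: bipartite_graph_def)
  thus "\<exists>x y. x \<in> X \<and> y \<in> Y \<and> x \<in> V \<and> y \<in> V \<and> {x, y} \<in> E" using e by blast
next
  assume "\<exists>x y. x \<in> X \<and> y \<in> Y \<and> x \<in> V \<and> y \<in> V \<and> {x, y} \<in> E"
  thus "has_edge V" by (auto simp: has_edge_def intro: bexI[of _ "{_, _}"])
qed

text \<open>
  The first row is attached where no edge was present before, which gives the class. For each further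
  row \<open>x\<close> the total complex is a cone, because \<open>x\<close> stays available and provides an edge all by itself;
  the class of the subcomplex then moves up by one level.
\<close>
lemma spherical_hit_rows:
  assumes "X' \<subseteq> X" "X' \<noteq> {}" "Y' \<subseteq> Y" "hits E X' Y'"
  shows "spherical (card X') X' (X' \<union> Y')"
proof -
  have "finite X'" using assms(1) finite_X finite_subset by blast
  thus ?thesis using assms(2,1,3,4)
  proof (induction X' rule: finite_ne_induct)
    case (singleton x)
    have xY: "x \<notin> Y'" using singleton.prems X_Y_disjoint by blast
    have "\<not> has_edge Y'" using singleton.prems X_Y_disjoint by (auto simp: has_edge_iff)
    hence "acyclic {} ({x} \<union> Y' - {x})" using acyclic_no_edges[of Y'] singleton.prems xY by auto
    moreover have "has_edge ({x} \<union> Y')" using singleton.prems by (auto simp: has_edge_iff hits_def)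
    hence "spherical 1 {} ({x} \<union> Y')" using singleton.prems by (intro spherical_edges) auto
    ultimately show ?case using spherical_quotient_if_sub_acyclic[of "{}" _ x] by simp
  next
    case (insert x F)
    have xY: "x \<notin> Y'" using insert.prems X_Y_disjoint by blast
    have "spherical (card F) F (F \<union> Y')"
      using insert.IH insert.prems by (auto simp: hits_def)
    moreover have "insert x F \<union> Y' - {x} = F \<union> Y'" using insert.hyps xY by auto
    moreover have "acyclic F (insert x F \<union> Y')"
    proof -
      obtain v where v: "v \<in> F" using insert.hyps by blast
      obtain y where y: "y \<in> Y'" "{x, y} \<in> E" using insert.prems by (auto simp: hits_def)
      have "y \<notin> F" "y \<noteq> x" using insert.prems y X_Y_disjoint by auto
      show ?thesis
      proof (rule acyclic_cone[OF v])
        fix U assume "insert x F \<union> Y' - F \<subseteq> U"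
        hence "x \<in> U" "y \<in> U" using insert.hyps y \<open>y \<notin> F\<close> by auto
        thus "has_edge U" using y insert.prems by (auto simp: has_edge_iff)
      qed (use insert.prems in auto)
    qed
    ultimately show ?case
      using spherical_quotient_if_total_acyclic[of F "insert x F \<union> Y'" "card F" x] insert.hyps by simp
  qed
qed

end

text \<open>
  From now on the row set \<open>X'\<close> is fixed and contained in the lower bound, and only the columns vary:
  \<open>Z\<close> is the set of columns in the lower bound, \<open>U\<close> the one in the upper bound.
\<close>
locale row_complex = bipartite_complex idx dg D aug_coeff X Y E
  for idx :: "nat \<Rightarrow> nat set" and dg :: "nat \<Rightarrow> nat \<Rightarrow> 'v set" and D :: "nat \<Rightarrow> nat \<Rightarrow> nat \<Rightarrow> 'k::field"
    and aug_coeff :: "nat \<Rightarrow> 'k" and X Y :: "'v set" and E :: "'v set set" +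
  fixes X' :: "'v set"
  assumes X'_subset: "X' \<subseteq> X" and X'_nonempty: "X' \<noteq> {}"
begin

abbreviation transversal :: "'v set \<Rightarrow> bool" where "transversal \<equiv> hits E X'"

abbreviation row_acyclic :: "'v set \<Rightarrow> 'v set \<Rightarrow> bool" where "row_acyclic Z U \<equiv> acyclic (X' \<union> Z) (X' \<union> U)"

abbreviation row_spherical :: "nat \<Rightarrow> 'v set \<Rightarrow> 'v set \<Rightarrow> bool" where "row_spherical k Z U \<equiv> spherical k (X' \<union> Z) (X' \<union> U)"

lemma remove_column:
  assumes "U \<subseteq> Y" "y \<in> U"
  shows "X' \<union> U - {y} = X' \<union> (U - {y})"
  using assms X'_subset X_Y_disjoint by blast

lemma row_acyclic_insert:
  assumes "U \<subseteq> Y" "y \<in> U" "row_acyclic Z (U - {y})" "row_acyclic Z U"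
  shows "row_acyclic (insert y Z) U"
  using acyclic_quotient[of "X' \<union> Z" "X' \<union> U" y] assms remove_column[OF assms(1,2)] by simp

lemma row_spherical_insert_sub:
  assumes "U \<subseteq> Y" "y \<in> U" "row_acyclic Z (U - {y})" "row_spherical k Z U"
  shows "row_spherical k (insert y Z) U"
  using spherical_quotient_if_sub_acyclic[of "X' \<union> Z" "X' \<union> U" y] assms remove_column[OF assms(1,2)] by simp

lemma row_spherical_insert_total:
  assumes "U \<subseteq> Y" "y \<in> U" "row_acyclic Z U" "row_spherical k Z (U - {y})"
  shows "row_spherical (Suc k) (insert y Z) U"
  using spherical_quotient_if_total_acyclic[of "X' \<union> Z" "X' \<union> U" k y] assms remove_column[OF assms(1,2)] by simp

text \<open>
  A row of \<open>X'\<close> without neighbours in \<open>Y'\<close> is the apex of a cone.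
\<close>
lemma row_acyclic_not_transversal:
  assumes "Z \<subseteq> Y'" "Y' \<subseteq> Y" "\<not> transversal Y'"
  shows "row_acyclic Z Y'"
proof -
  obtain x where x: "x \<in> X'" "\<And>y. y \<in> Y' \<Longrightarrow> {x, y} \<notin> E" using assms(3) by (auto simp: hits_def)
  show ?thesis
  proof (rule acyclic_cone[of x])
    fix U assume U: "U \<subseteq> X' \<union> Y' - {x}" "has_edge (insert x U)"
    then obtain a b where ab: "a \<in> X" "b \<in> Y" "a \<in> insert x U" "b \<in> insert x U" "{a, b} \<in> E"
      by (auto simp: has_edge_iff)
    have "b \<in> Y'" "b \<noteq> x" using ab(2,4) U(1) X'_subset X_Y_disjoint x(1) by auto
    hence "a \<noteq> x" using x(2) ab(5) by blast
    thus "has_edge U" using ab \<open>b \<noteq> x\<close> unfolding has_edge_iff by blast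
  qed (use x assms X'_subset in auto)
qed

text \<open>
  The columns outside \<open>Z\<close> are always present, so an edge at the column \<open>y\<close> can be replaced by an edge from the
  same row to one of them.
\<close>
lemma row_acyclic_rest_transversal:
  assumes "y \<in> Z" "Z \<subseteq> Y'" "Y' \<subseteq> Y" "transversal (Y' - Z)"
  shows "row_acyclic Z Y'"
proof (rule acyclic_cone[of y])
  fix U assume U: "X' \<union> Y' - (X' \<union> Z) \<subseteq> U" "U \<subseteq> X' \<union> Y' - {y}" "has_edge (insert y U)"
  then obtain a b where ab: "a \<in> X" "b \<in> Y" "a \<in> insert y U" "b \<in> insert y U" "{a, b} \<in> E"
    by (auto simp: has_edge_iff)
  have "a \<noteq> y" using ab(1) assms(1-3) X_Y_disjoint by blast
  hence a: "a \<in> U" using ab by blast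
  hence "a \<in> X'" using U(2) ab(1) assms(3) X_Y_disjoint by blast
  then obtain c where c: "c \<in> Y' - Z" "{a, c} \<in> E" using assms(4) by (auto simp: hits_def)
  have "c \<notin> X'" using c assms(3) X_Y_disjoint X'_subset by blast
  hence "c \<in> U" using c U(1) by blast
  thus "has_edge U" using a ab(1) c assms(3) unfolding has_edge_iff by blast
qed (use assms X'_subset in auto)

text \<open>
  A cone criterion in which edges no longer occur: it suffices that \<open>y\<close> never decides whether a set of
  columns is a transversal. Starting with \<open>Z = {y}\<close>, the two preceding lemmas cover the cases that \<open>Y'\<close> is a
  transversal or not.
\<close>
lemma row_acyclic_cone:
  assumes "y \<in> Z" "Z \<subseteq> Y'" "Y' \<subseteq> Y"
    and "\<And>U. Y' - Z \<subseteq> U \<Longrightarrow> U \<subseteq> Y' - {y} \<Longrightarrow> transversal (insert y U) \<Longrightarrow> transversal U"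
  shows "row_acyclic Z Y'"
proof -
  define F where "F = Z - {y}"
  have "F \<subseteq> Y" using assms(2,3) by (auto simp: F_def)
  hence "finite F" using finite_Y by (rule finite_subset)
  hence main: "y \<notin> F \<Longrightarrow> insert y F \<subseteq> Y' \<Longrightarrow> Y' \<subseteq> Y \<Longrightarrow>
    (\<And>U. Y' - insert y F \<subseteq> U \<Longrightarrow> U \<subseteq> Y' - {y} \<Longrightarrow> transversal (insert y U) \<Longrightarrow> transversal U) \<Longrightarrow> row_acyclic (insert y F) Y'"
  proof (induction F arbitrary: Y' rule: finite_induct)
    case empty
    show ?case
    proof (cases "transversal Y'")
      case True
      hence "transversal (Y' - {y})" using empty.prems(4)[of "Y' - {y}"] empty.prems(2) by (auto simp: insert_absorb)
      thus ?thesis using empty.prems by (intro row_acyclic_rest_transversal[of y]) auto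
    next
      case False
      thus ?thesis using empty.prems by (intro row_acyclic_not_transversal) auto
    qed
  next
    case (insert a F)
    have "row_acyclic (insert y F) (Y' - {a})"
    proof (rule insert.IH)
      fix U assume "Y' - {a} - insert y F \<subseteq> U" "U \<subseteq> Y' - {a} - {y}" "transversal (insert y U)"
      thus "transversal U" by (intro insert.prems(4)[of U]) auto
    qed (use insert.prems insert.hyps in auto)
    moreover have "row_acyclic (insert y F) Y'"
    proof (rule insert.IH)
      fix U assume "Y' - insert y F \<subseteq> U" "U \<subseteq> Y' - {y}" "transversal (insert y U)"
      thus "transversal U" by (intro insert.prems(4)[of U]) auto
    qed (use insert.prems insert.hyps in auto)
    ultimately have "row_acyclic (insert a (insert y F)) Y'"
      using insert.prems by (intro row_acyclic_insert[of Y' a "insert y F"]) blast+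
    thus ?case by (simp add: insert_commute)
  qed
  have "insert y F = Z" using assms(1) by (auto simp: F_def)
  from main[unfolded this] show ?thesis using assms unfolding F_def by blast
qed

lemma row_spherical_start:
  assumes "Y' \<subseteq> Y" "transversal Y'"
  shows "row_spherical (card X') {} Y'"
  using spherical_hit_rows[OF X'_subset X'_nonempty assms] by simp

text \<open>
  No proper subset of \<open>Y'\<close> is a transversal, so every subcomplex that occurs is acyclic and the class
  of \<open>C(X', X' \<union> Y')\<close> survives unchanged.
\<close>
lemma row_spherical_minimal_transversal:
  assumes Y': "Y' \<subseteq> Y" and mt: "minimal_transversal E X' Y'"
  shows "row_spherical (card X') Y' Y'"
proof -
  have "finite Y'" using Y' finite_Y by (rule finite_subset)
  have "Z \<subseteq> Y' \<Longrightarrow> row_spherical (card X') Z Y'" if "finite Z" for Z using that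
  proof (induction Z rule: finite_induct)
    case empty
    show ?case using row_spherical_start[OF Y'] mt by (auto simp: minimal_transversal_def)
  next
    case (insert y Z)
    have "\<not> transversal (Y' - {y})" using mt insert.prems by (auto simp: minimal_transversal_def)
    hence "row_acyclic Z (Y' - {y})" using insert Y' by (intro row_acyclic_not_transversal) auto
    thus ?case using insert Y' by (intro row_spherical_insert_sub[of Y' y Z]) blast+
  qed
  thus ?thesis using \<open>finite Y'\<close> by blast
qed

text \<open>
  A column outside \<open>A \<union> B\<close>, or one from \<open>B\<close> when not all of \<open>B\<close> is present, never decides whether a set is a
  transversal, which kills all \<open>Y'\<close> except the nonempty subsets of \<open>A\<close> and the sets \<open>A' \<union> B\<close> with \<open>A' \<subseteq> A\<close>. These
  carry one class each, and adding a column \<open>a \<in> A\<close> moves it up by one level, since \<open>{a}\<close> is itself a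
  transversal. The level is \<open>m + |Y'| - 1\<close> in the first case and \<open>m + |A'|\<close> in the second, so Pascal's rule counts
  the classes in level \<open>i + 1\<close>.
\<close>
lemma sum_hdim_sunflower:
  assumes A: "A \<subseteq> Y" and B: "B \<subseteq> Y" "B \<noteq> {}" "A \<inter> B = {}"
    and tr: "\<And>U. U \<subseteq> Y \<Longrightarrow> transversal U \<longleftrightarrow> U \<inter> A \<noteq> {} \<or> B \<subseteq> U"
  shows "(\<Sum>Y'\<in>Pow Y. hdim (Suc i) (X' \<union> Y') (X' \<union> Y')) =
    (if card X' < i + 2 then Suc (card A) choose (i + 2 - card X') else 0)"
proof -
  define m where "m = card X'"
  have finA: "finite A" using A finite_Y by (rule finite_subset)
  have finB: "finite B" using B(1) finite_Y by (rule finite_subset)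
  have empty: "row_acyclic {} {}" using row_acyclic_not_transversal[of "{}" "{}"] tr[of "{}"] B(2) by simp
  have outside: "row_acyclic Y' Y'" if Y': "Y' \<subseteq> Y" "\<not> Y' \<subseteq> A \<union> B" for Y'
  proof -
    obtain y where y: "y \<in> Y'" "y \<notin> A" "y \<notin> B" using Y' by blast
    show ?thesis
    proof (rule row_acyclic_cone[OF y(1)])
      fix U assume "U \<subseteq> Y' - {y}" "transversal (insert y U)"
      moreover from this have "insert y U \<subseteq> Y" "U \<subseteq> Y" using y Y' by auto
      ultimately show "transversal U" using tr[of U] tr[of "insert y U"] y by auto
    qed (use Y' in auto)
  qed
  have part_B: "row_acyclic Y' Y'" if Y': "Y' \<subseteq> Y" "Y' \<inter> B \<noteq> {}" "\<not> B \<subseteq> Y'" for Y'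
  proof -
    obtain y where y: "y \<in> Y'" "y \<in> B" using Y' by blast
    show ?thesis
    proof (rule row_acyclic_cone[OF y(1)])
      fix U assume U: "U \<subseteq> Y' - {y}" "transversal (insert y U)"
      moreover from this have "insert y U \<subseteq> Y" "U \<subseteq> Y" using y Y' by auto
      moreover have "\<not> B \<subseteq> insert y U" using U(1) Y' y by blast
      ultimately show "transversal U" using tr[of U] tr[of "insert y U"] y B(3) by auto
    qed (use Y' in auto)
  qed
  have in_A: "row_spherical (m + card F - 1) F F" if "finite F" "F \<noteq> {}" "F \<subseteq> A" for F
    using that
  proof (induction F rule: finite_ne_induct)
    case (singleton a)
    have "row_spherical m {} {a}" unfolding m_def using singleton A tr[of "{a}"] by (intro row_spherical_start) auto
    hence "row_spherical m {a} {a}" using singleton A empty by (intro row_spherical_insert_sub) auto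
    thus ?case by simp
  next
    case (insert a F)
    obtain y where y: "y \<in> F" using insert.hyps by blast
    have "row_acyclic F (insert a F)"
    proof (rule row_acyclic_rest_transversal[OF y])
      have "insert a F - F = {a}" using insert.hyps by auto
      thus "transversal (insert a F - F)" using insert.prems A tr[of "{a}"] by auto
    qed (use insert.prems A in auto)
    moreover have "insert a F - {a} = F" using insert.hyps by auto
    ultimately have "row_spherical (Suc (m + card F - 1)) (insert a F) (insert a F)"
      using insert.IH insert.prems A by (intro row_spherical_insert_total) auto
    moreover have "card F > 0" using insert.hyps by (simp add: card_gt_0_iff)
    ultimately show ?case using insert.hyps by (simp add: Suc_diff_Suc)
  qed
  have with_B: "row_spherical (m + card F) (F \<union> B) (F \<union> B)" if "finite F" "F \<subseteq> A" for F
    using that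
  proof (induction F rule: finite_induct)
    case empty
    have "minimal_transversal E X' B"
      unfolding minimal_transversal_def
    proof (intro conjI ballI)
      show "transversal B" using tr[of B] B by blast
      fix y assume "y \<in> B"
      thus "\<not> transversal (B - {y})" using tr[of "B - {y}"] B by blast
    qed
    thus ?case using row_spherical_minimal_transversal[OF B(1)] by (simp add: m_def)
  next
    case (insert a F)
    obtain y where y: "y \<in> B" using B(2) by blast
    have aB: "a \<notin> B" using insert.prems B(3) by auto
    have "row_acyclic (F \<union> B) (insert a F \<union> B)"
    proof (rule row_acyclic_rest_transversal[of y])
      have "insert a F \<union> B - (F \<union> B) = {a}" using insert.hyps aB by auto
      thus "transversal (insert a F \<union> B - (F \<union> B))" using insert.prems A tr[of "{a}"] by auto
    qed (use insert.prems A B y in auto)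
    moreover have "insert a F \<union> B - {a} = F \<union> B" using insert.hyps aB by auto
    ultimately have "row_spherical (Suc (m + card F)) (insert a (F \<union> B)) (insert a F \<union> B)"
      using insert.IH insert.prems A B(1) by (intro row_spherical_insert_total) auto
    thus ?case using insert.hyps by simp
  qed
  let ?h = "\<lambda>Y'. hdim (Suc i) (X' \<union> Y') (X' \<union> Y')"
  define S1 where "S1 = {F. F \<subseteq> A \<and> F \<noteq> {} \<and> m + card F - 1 = Suc i}"
  define S2 where "S2 = {F. F \<subseteq> A \<and> m + card F = Suc i}"
  have h: "?h Y' = of_bool (Y' \<in> S1 \<union> (\<lambda>F. F \<union> B) ` S2)" if Y': "Y' \<subseteq> Y" for Y'
  proof -
    consider "Y' = {}" | "\<not> Y' \<subseteq> A \<union> B" | "Y' \<inter> B \<noteq> {}" "\<not> B \<subseteq> Y'" | "Y' \<noteq> {}" "Y' \<subseteq> A"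
      | "Y' \<subseteq> A \<union> B" "B \<subseteq> Y'" by blast
    then show ?thesis
    proof cases
      case 1
      thus ?thesis using acyclic_hdim[OF empty] B(2) by (auto simp: S1_def)
    next
      case 2
      thus ?thesis using acyclic_hdim[OF outside[OF Y']] by (auto simp: S1_def S2_def)
    next
      case 3
      hence "Y' \<notin> S1" "Y' \<notin> (\<lambda>F. F \<union> B) ` S2" using B(3) by (auto simp: S1_def)
      thus ?thesis using acyclic_hdim[OF part_B[OF Y' 3]] by simp
    next
      case 4
      have "Y' \<notin> (\<lambda>F. F \<union> B) ` S2" using 4 B by blast
      moreover have "row_spherical (m + card Y' - 1) Y' Y'" using in_A 4 finA finite_subset by blast
      hence "?h Y' = of_bool (Suc i = m + card Y' - 1)" by (simp only: spherical_def)
      ultimately show ?thesis using 4 by (auto simp: S1_def of_bool_def)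
    next
      case 5
      define F where "F = Y' - B"
      have F: "F \<subseteq> A" "Y' = F \<union> B" using 5 by (auto simp: F_def)
      have "Y' \<notin> S1" using 5 B by (auto simp: S1_def)
      moreover have "Y' \<in> (\<lambda>F. F \<union> B) ` S2 \<longleftrightarrow> F \<in> S2"
      proof
        assume "Y' \<in> (\<lambda>F. F \<union> B) ` S2"
        then obtain F' where "F' \<in> S2" "Y' = F' \<union> B" by blast
        moreover from this have "F' = F" using B(3) by (auto simp: F_def S2_def)
        ultimately show "F \<in> S2" by simp
      qed (use F in blast)
      moreover have "row_spherical (m + card F) (F \<union> B) (F \<union> B)" using with_B F(1) finA finite_subset by blast
      hence "?h Y' = of_bool (Suc i = m + card F)" unfolding F(2) by (simp only: spherical_def)
      ultimately show ?thesis using F(1) by (auto simp: S2_def of_bool_def)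
    qed
  qed
  have finS: "finite S1" "finite S2" using finA by (auto simp: S1_def S2_def intro: finite_subset[of _ "Pow A"])
  have sub: "S1 \<union> (\<lambda>F. F \<union> B) ` S2 \<subseteq> Pow Y" using A B(1) by (auto simp: S1_def S2_def)
  have "(\<Sum>Y'\<in>Pow Y. ?h Y') = (\<Sum>Y'\<in>Pow Y. of_bool (Y' \<in> S1 \<union> (\<lambda>F. F \<union> B) ` S2))"
    using h by (intro sum.cong) auto
  also have "\<dots> = card (S1 \<union> (\<lambda>F. F \<union> B) ` S2)"
  proof -
    have "(\<Sum>Y'\<in>Pow Y. of_bool (Y' \<in> S)) = card S" if "S \<subseteq> Pow Y" for S
      using finite_Y that by (simp add: Int_absorb1)
    thus ?thesis using sub .
  qed
  also have "\<dots> = card S1 + card ((\<lambda>F. F \<union> B) ` S2)"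
    using finS B by (intro card_Un_disjoint) (auto simp: S1_def)
  also have "card ((\<lambda>F. F \<union> B) ` S2) = card S2"
    using B(3) by (intro card_image) (auto simp: inj_on_def S2_def)
  also have "card S1 + card S2 = (if m < i + 2 then Suc (card A) choose (i + 2 - m) else 0)"
  proof (cases "m < i + 2")
    case True
    define k where "k = Suc i - m"
    have m: "m + k = Suc i" using True by (simp add: k_def)
    have "F \<noteq> {} \<and> m + card F - 1 = Suc i \<longleftrightarrow> card F = Suc k" if "F \<subseteq> A" for F
    proof -
      have "F = {} \<longleftrightarrow> card F = 0" using finite_subset[OF that finA] by simp
      moreover have "m > 0" using X'_nonempty X'_subset finite_X finite_subset by (auto simp: m_def card_gt_0_iff)
      ultimately show ?thesis using m by auto
    qed
    hence "S1 = {F. F \<subseteq> A \<and> card F = Suc k}" by (auto simp: S1_def)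
    moreover have "S2 = {F. F \<subseteq> A \<and> card F = k}" using m by (auto simp: S2_def)
    ultimately have "card S1 + card S2 = Suc (card A) choose (Suc k)"
      using n_subsets[OF finA] by simp
    moreover have "i + 2 - m = Suc k" using m by simp
    ultimately show ?thesis using True by simp
  next
    case False
    have "F \<notin> S1" for F
    proof
      assume "F \<in> S1"
      hence F: "F \<subseteq> A" "F \<noteq> {}" "m + card F - 1 = Suc i" by (simp_all add: S1_def)
      have "card F > 0" using F(2) finite_subset[OF F(1) finA] by (simp add: card_gt_0_iff)
      thus False using F(3) False by linarith
    qed
    hence "S1 = {}" by blast
    moreover have "F \<notin> S2" for F using False by (simp add: S2_def)
    hence "S2 = {}" by blast
    ultimately show ?thesis using False by simp
  qed
  finally show ?thesis by (simp add: m_def)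
qed

lemma sum_hdim_no_transversal:
  assumes "\<And>U. U \<subseteq> Y \<Longrightarrow> \<not> transversal U"
  shows "(\<Sum>Y'\<in>Pow Y. hdim n (X' \<union> Y') (X' \<union> Y')) = 0"
  using acyclic_hdim[OF row_acyclic_not_transversal] assms by (intro sum.neutral) auto

lemma card_minimal_transversals_le:
  "card {U. U \<subseteq> Y \<and> minimal_transversal E X' U} \<le> (\<Sum>Y'\<in>Pow Y. hdim (card X') (X' \<union> Y') (X' \<union> Y'))"
proof -
  let ?M = "{U. U \<subseteq> Y \<and> minimal_transversal E X' U}"
  have "card ?M = (\<Sum>Y'\<in>?M. hdim (card X') (X' \<union> Y') (X' \<union> Y'))"
  proof -
    have "hdim (card X') (X' \<union> U) (X' \<union> U) = 1" if "U \<in> ?M" for U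
    proof -
      have "row_spherical (card X') U U" using that by (intro row_spherical_minimal_transversal) blast+
      thus ?thesis unfolding spherical_def by simp
    qed
    hence "(\<Sum>Y'\<in>?M. hdim (card X') (X' \<union> Y') (X' \<union> Y')) = (\<Sum>Y'\<in>?M. 1)"
      by (intro sum.cong refl)
    thus ?thesis by (simp only: card_eq_sum)
  qed
  also have "\<dots> \<le> (\<Sum>Y'\<in>Pow Y. hdim (card X') (X' \<union> Y') (X' \<union> Y'))"
    using finite_Y by (intro sum_mono2) auto
  finally show ?thesis .
qed

end

section \<open>Betti numbers as homology of strands\<close>

text \<open>
  The squarefree generators of a resolution, with levels shifted by one, form a complex of the above
  kind. Generators of other degrees do not divide a squarefree monomial and are left out.
\<close>
definition res_idx :: "('v, 'k::zero) free_complex \<Rightarrow> nat \<Rightarrow> nat set" where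
  "res_idx F n = (case n of 0 \<Rightarrow> {} | Suc i \<Rightarrow>
     {j \<in> basis F i. fdeg F i j = squarefree_mon (Poly_Mapping.keys (fdeg F i j))})"

definition res_deg :: "('v, 'k::zero) free_complex \<Rightarrow> nat \<Rightarrow> nat \<Rightarrow> 'v set" where
  "res_deg F n j = (case n of 0 \<Rightarrow> {} | Suc i \<Rightarrow> Poly_Mapping.keys (fdeg F i j))"

definition res_scalars :: "('v, 'k::zero) free_complex \<Rightarrow> nat \<Rightarrow> nat \<Rightarrow> nat \<Rightarrow> 'k" where
  "res_scalars F i = scalars (fdeg F i) (fdeg F (Suc i)) (bdry F i)"

definition res_coeff :: "('v, 'k::zero) free_complex \<Rightarrow> nat \<Rightarrow> nat \<Rightarrow> nat \<Rightarrow> 'k" where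
  "res_coeff F n p q = (case n of 0 \<Rightarrow> 0 | Suc i \<Rightarrow>
     if p \<in> res_idx F (Suc i) \<and> q \<in> res_idx F (Suc (Suc i)) then res_scalars F i p q else 0)"

definition res_aug :: "('v, 'k::zero) free_complex \<Rightarrow> nat \<Rightarrow> 'k" where
  "res_aug F q = Poly_Mapping.lookup (aug F q) (fdeg F 0 q)"

lemma strand_squarefree:
  assumes "finite V"
  shows "strand (basis F i) (fdeg F i) (squarefree_mon V) =
    {u. \<forall>j. u j \<noteq> 0 \<longrightarrow> j \<in> res_idx F (Suc i) \<and> res_deg F (Suc i) j \<subseteq> V}"
  by (auto simp: strand_def res_idx_def res_deg_def mdvd_squarefree_mon_iff[OF assms])

lemma
  fixes F :: "('v, 'k::field) free_complex"
  assumes fr: "free_resolution V I F"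
  shows free_resolution_finite: "finite (basis F i)"
    and free_resolution_degrees: "j \<in> basis F i \<Longrightarrow> Poly_Mapping.keys (fdeg F i j) \<subseteq> V"
    and free_resolution_graded: "graded_matrix (basis F i) (fdeg F i) (basis F (Suc i)) (fdeg F (Suc i)) (bdry F i)"
    and free_resolution_entries: "p \<in> basis F i \<Longrightarrow> q \<in> basis F (Suc i) \<Longrightarrow> bdry F i p q \<in> poly_ring V"
    and free_resolution_aug: "q \<in> basis F 0 \<Longrightarrow> Poly_Mapping.keys (aug F q) \<subseteq> {fdeg F 0 q}"
    and free_resolution_image: "aug_map F ` chains V F 0 = I"
    and free_resolution_exact_0: "bdry_map F 0 ` chains V F (Suc 0) = {f \<in> chains V F 0. aug_map F f = 0}"
    and free_resolution_exact: "bdry_map F (Suc i) ` chains V F (Suc (Suc i)) =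
          {f \<in> chains V F (Suc i). bdry_map F i f = (\<lambda>_. 0)}"
proof -
  note 1 = fr[unfolded free_resolution_def]
  note 2 = conjunct2[OF 1] note 3 = conjunct2[OF 2] note 4 = conjunct2[OF 3]
  note 5 = conjunct2[OF 4] note 6 = conjunct2[OF 5] note 7 = conjunct2[OF 6]
  show "finite (basis F i)" by (rule conjunct1[OF 1, rule_format])
  show "j \<in> basis F i \<Longrightarrow> Poly_Mapping.keys (fdeg F i j) \<subseteq> V"
    by (rule conjunct1[OF 2, rule_format])
  show "graded_matrix (basis F i) (fdeg F i) (basis F (Suc i)) (fdeg F (Suc i)) (bdry F i)"
    unfolding graded_matrix_def using conjunct1[OF 3] by blast
  show "p \<in> basis F i \<Longrightarrow> q \<in> basis F (Suc i) \<Longrightarrow> bdry F i p q \<in> poly_ring V"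
    using conjunct1[OF 3] by blast
  show "q \<in> basis F 0 \<Longrightarrow> Poly_Mapping.keys (aug F q) \<subseteq> {fdeg F 0 q}"
    by (rule conjunct1[OF 4, rule_format])
  show "aug_map F ` chains V F 0 = I" by (rule conjunct1[OF 5])
  show "bdry_map F 0 ` chains V F (Suc 0) = {f \<in> chains V F 0. aug_map F f = 0}"
    by (rule conjunct1[OF 6])
  show "bdry_map F (Suc i) ` chains V F (Suc (Suc i)) =
          {f \<in> chains V F (Suc i). bdry_map F i f = (\<lambda>_. 0)}"
    using 7 by (rule spec)
qed

lemma strands_exact:
  fixes F :: "('v, 'k::field) free_complex"
  assumes fr: "free_resolution V I F" and t: "Poly_Mapping.keys t \<subseteq> V"
  shows "mat_map (basis F (Suc i)) (basis F (Suc (Suc i))) (res_scalars F (Suc i)) `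
      strand (basis F (Suc (Suc i))) (fdeg F (Suc (Suc i))) t =
    {u \<in> strand (basis F (Suc i)) (fdeg F (Suc i)) t.
      mat_map (basis F i) (basis F (Suc i)) (res_scalars F i) u = (\<lambda>_. 0)}"
  unfolding res_scalars_def
proof (rule exact_iff_strands_exact[THEN iffD1, THEN spec, THEN mp])
  show "mat_map (basis F (Suc i)) (basis F (Suc (Suc i))) (bdry F (Suc i)) ` poly_vectors V (basis F (Suc (Suc i))) =
     {f \<in> poly_vectors V (basis F (Suc i)). mat_map (basis F i) (basis F (Suc i)) (bdry F i) f = (\<lambda>_. 0)}"
    using free_resolution_exact[OF fr, of i] unfolding chains_eq bdry_map_eq .
qed (fact t free_resolution_graded[OF fr] free_resolution_entries[OF fr]
      free_resolution_finite[OF fr] free_resolution_degrees[OF fr])+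

lemma strands_exact_0:
  fixes F :: "('v, 'k::field) free_complex"
  assumes fr: "free_resolution V I F" and t: "Poly_Mapping.keys t \<subseteq> V"
  shows "mat_map (basis F 0) (basis F (Suc 0)) (res_scalars F 0) ` strand (basis F (Suc 0)) (fdeg F (Suc 0)) t =
    {u \<in> strand (basis F 0) (fdeg F 0) t. (\<Sum>q\<in>basis F 0. res_aug F q * u q) = 0}"
proof -
  let ?N = "\<lambda>_::nat. aug F" and ?d = "\<lambda>_::nat. 0 :: 'v mon"
  have gr: "graded_matrix {0} ?d (basis F 0) (fdeg F 0) ?N"
    using free_resolution_aug[OF fr] by (fastforce simp: graded_matrix_def)
  have pr: "?N c q \<in> poly_ring V" if "q \<in> basis F 0" for c q
    using free_resolution_aug[OF fr that] free_resolution_degrees[OF fr that] by (auto simp: poly_ring_def)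
  have "mat_map {0} (basis F 0) ?N f = (\<lambda>_. 0) \<longleftrightarrow> aug_map F f = 0" for f
    unfolding aug_map_eq by (auto simp: fun_eq_iff)
  hence "mat_map (basis F 0) (basis F (Suc 0)) (bdry F 0) ` poly_vectors V (basis F (Suc 0)) =
     {f \<in> poly_vectors V (basis F 0). mat_map {0} (basis F 0) ?N f = (\<lambda>_. 0)}"
    using free_resolution_exact_0[OF fr] unfolding chains_eq bdry_map_eq by simp
  hence "mat_map (basis F 0) (basis F (Suc 0)) (scalars (fdeg F 0) (fdeg F (Suc 0)) (bdry F 0)) `
      strand (basis F (Suc 0)) (fdeg F (Suc 0)) t =
    {u \<in> strand (basis F 0) (fdeg F 0) t. mat_map {0} (basis F 0) (scalars ?d (fdeg F 0) ?N) u = (\<lambda>_. 0)}"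
    by (rule exact_iff_strands_exact[THEN iffD1, THEN spec, THEN mp, rotated 6])
      (fact t, fact gr, fact free_resolution_graded[OF fr], rule pr, assumption,
        fact free_resolution_entries[OF fr], fact free_resolution_finite[OF fr],
        fact free_resolution_degrees[OF fr])
  moreover have "mat_map {0} (basis F 0) (scalars ?d (fdeg F 0) ?N) u = (\<lambda>_. 0) \<longleftrightarrow>
      (\<Sum>q\<in>basis F 0. res_aug F q * u q) = 0" for u
    by (auto simp: mat_map_def scalars_def res_aug_def fun_eq_iff)
  ultimately show ?thesis unfolding res_scalars_def by simp
qed

lemma res_scalars_squarefree:
  fixes F :: "('v, 'k::field) free_complex"
  assumes fr: "free_resolution V I F" and pq: "p \<in> basis F i" "q \<in> res_idx F (Suc (Suc i))" "res_scalars F i p q \<noteq> 0"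
  shows "p \<in> res_idx F (Suc i)" "res_deg F (Suc i) p \<subseteq> res_deg F (Suc (Suc i)) q"
proof -
  have q: "q \<in> basis F (Suc i)" "fdeg F (Suc i) q = squarefree_mon (Poly_Mapping.keys (fdeg F (Suc i) q))"
    using pq(2) by (auto simp: res_idx_def)
  have "mdvd (fdeg F i p) (fdeg F (Suc i) q)"
    using scalars_nonzero_mdvd[OF free_resolution_graded[OF fr] pq(1) q(1)] pq(3) by (simp add: res_scalars_def)
  hence "mdvd (fdeg F i p) (squarefree_mon (Poly_Mapping.keys (fdeg F (Suc i) q)))" using q(2) by simp
  hence "fdeg F i p = squarefree_mon (Poly_Mapping.keys (fdeg F i p))"
    "Poly_Mapping.keys (fdeg F i p) \<subseteq> Poly_Mapping.keys (fdeg F (Suc i) q)"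
    by (simp_all only: mdvd_squarefree_mon_iff[OF finite_keys])
  thus "p \<in> res_idx F (Suc i)" "res_deg F (Suc i) p \<subseteq> res_deg F (Suc (Suc i)) q"
    using pq(1) by (simp_all add: res_idx_def res_deg_def)
qed

lemma mat_map_res_scalars:
  fixes F :: "('v, 'k::field) free_complex"
  assumes fr: "free_resolution V I F" and u: "\<And>j. u j \<noteq> 0 \<Longrightarrow> j \<in> res_idx F (Suc (Suc i))"
  shows "mat_map (basis F i) (basis F (Suc i)) (res_scalars F i) u =
    (\<lambda>p. \<Sum>q\<in>res_idx F (Suc (Suc i)). res_coeff F (Suc i) p q * u q)"
proof
  fix p
  have sub: "res_idx F (Suc (Suc i)) \<subseteq> basis F (Suc i)" by (auto simp: res_idx_def)
  have "(\<Sum>q\<in>basis F (Suc i). res_scalars F i p q * u q) =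
    (\<Sum>q\<in>res_idx F (Suc (Suc i)). res_scalars F i p q * u q)"
    using u sub free_resolution_finite[OF fr] by (intro sum.mono_neutral_right) auto
  moreover have "res_scalars F i p q * u q = res_coeff F (Suc i) p q * u q"
    if "p \<in> basis F i" "q \<in> res_idx F (Suc (Suc i))" for q
    using res_scalars_squarefree(1)[OF fr that] that by (auto simp: res_coeff_def)
  moreover have "res_coeff F (Suc i) p q = 0" if "p \<notin> basis F i" for q
    using that by (auto simp: res_coeff_def res_idx_def)
  ultimately show "mat_map (basis F i) (basis F (Suc i)) (res_scalars F i) u p =
    (\<Sum>q\<in>res_idx F (Suc (Suc i)). res_coeff F (Suc i) p q * u q)"
    by (cases "p \<in> basis F i") (simp_all add: mat_map_def)
qed

text \<open>
  That the scalars compose to zero is seen in the strand whose degree is that of the generator \<open>r\<close>: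
  there the indicator vector of \<open>r\<close> is homogeneous.
\<close>
lemma resolution_filtered_complex:
  fixes F :: "('v, 'k::field) free_complex"
  assumes fr: "free_resolution V I F"
  shows "filtered_complex (res_idx F) (res_deg F) (res_coeff F)"
proof
  show "finite (res_idx F n)" for n
    using free_resolution_finite[OF fr] by (cases n) (auto simp: res_idx_def)
  show "res_idx F 0 = {}" by (simp add: res_idx_def)
  show "p \<in> res_idx F n \<and> res_deg F n p \<subseteq> res_deg F (Suc n) q"
    if "q \<in> res_idx F (Suc n)" "res_coeff F n p q \<noteq> 0" for n p q
  proof (cases n)
    case 0
    thus ?thesis using that by (simp add: res_coeff_def)
  next
    case (Suc i)
    have "p \<in> res_idx F (Suc i)" "res_scalars F i p q \<noteq> 0"
      using that by (auto simp: Suc res_coeff_def split: if_splits)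
    moreover from this have "p \<in> basis F i" by (simp add: res_idx_def)
    ultimately show ?thesis using res_scalars_squarefree(2)[OF fr] that(1) by (simp add: Suc)
  qed
  show "(\<Sum>q\<in>res_idx F (Suc n). res_coeff F n p q * res_coeff F (Suc n) q r) = 0"
    if r: "r \<in> res_idx F (Suc (Suc n))" for n p r
  proof (cases n)
    case 0
    thus ?thesis by (simp add: res_coeff_def)
  next
    case (Suc i)
    define t where "t = fdeg F (Suc n) r"
    have rb: "r \<in> basis F (Suc n)" using r by (simp add: res_idx_def)
    have t: "Poly_Mapping.keys t \<subseteq> V" unfolding t_def using free_resolution_degrees[OF fr rb] .
    let ?u = "\<lambda>j. of_bool (j = r) :: 'k"
    have u: "?u \<in> strand (basis F (Suc (Suc i))) (fdeg F (Suc (Suc i))) t"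
      using rb by (auto simp: strand_def t_def Suc mdvd_def)
    define w where "w = mat_map (basis F (Suc i)) (basis F (Suc (Suc i))) (res_scalars F (Suc i)) ?u"
    have rj: "j \<in> res_idx F (Suc (Suc (Suc i)))" if "?u j \<noteq> 0" for j using that r Suc by (auto split: if_splits)
    have "w = (\<lambda>q. \<Sum>j\<in>res_idx F (Suc (Suc (Suc i))). res_coeff F (Suc (Suc i)) q j * ?u j)"
      unfolding w_def by (rule mat_map_res_scalars[OF fr rj])
    moreover have "finite (res_idx F (Suc (Suc (Suc i))))"
      using free_resolution_finite[OF fr] by (simp add: res_idx_def)
    ultimately have w: "w = (\<lambda>q. res_coeff F (Suc (Suc i)) q r)"
      using r by (simp add: Suc if_distrib sum_of_bool_eq_mult(2))
    have "w \<in> mat_map (basis F (Suc i)) (basis F (Suc (Suc i))) (res_scalars F (Suc i)) `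
      strand (basis F (Suc (Suc i))) (fdeg F (Suc (Suc i))) t" unfolding w_def using u by blast
    hence "mat_map (basis F i) (basis F (Suc i)) (res_scalars F i) w = (\<lambda>_. 0)"
      unfolding strands_exact[OF fr t] by blast
    moreover have "j \<in> res_idx F (Suc (Suc i))" if "w j \<noteq> 0" for j
      using that by (auto simp: w res_coeff_def split: if_splits)
    ultimately have "(\<lambda>p. \<Sum>q\<in>res_idx F (Suc (Suc i)). res_coeff F (Suc i) p q * w q) = (\<lambda>_. 0)"
      using mat_map_res_scalars[OF fr, of w i] by simp
    thus ?thesis by (simp add: w Suc fun_eq_iff)
  qed
qed

lemma resolution_edge_complex:
  fixes F :: "('v, 'k::field) free_complex"
  assumes W: "finite W" "E \<subseteq> Pow W" and fr: "free_resolution W (edge_ideal W E) F"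
  shows "edge_complex (res_idx F) (res_deg F) (res_coeff F) (res_aug F) W E"
proof -
  interpret filtered_complex "res_idx F" "res_deg F" "res_coeff F"
    by (rule resolution_filtered_complex[OF fr])
  have strand_ch: "strand (basis F i) (fdeg F i) (squarefree_mon V) = ch (Suc i) {} V" if "V \<subseteq> W" for V i
    using strand_squarefree[OF finite_subset[OF that W(1)]] by (simp add: ch_def)
  have keysV: "Poly_Mapping.keys (squarefree_mon V) \<subseteq> W" if "V \<subseteq> W" for V
    using keys_squarefree_mon[OF finite_subset[OF that W(1)]] that by simp
  have bd_eq: "mat_map (basis F i) (basis F (Suc i)) (res_scalars F i) u = bd (Suc i) {} u"
    if "u \<in> ch (Suc (Suc i)) {} V" for u i V
    unfolding bd_def using mat_map_res_scalars[OF fr, of u i] that by (simp add: ch_def)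
  have aug_sum: "(\<Sum>q\<in>basis F 0. res_aug F q * u q) = (\<Sum>q\<in>res_idx F 1. res_aug F q * u q)"
    if "u \<in> ch 1 {} V" for u V
    using that free_resolution_finite[OF fr]
    by (intro sum.mono_neutral_right) (auto simp: ch_def res_idx_def)
  have image: "p \<in> edge_ideal W E \<longleftrightarrow> p \<in> poly_ring W \<and> (\<forall>t. \<exists>w\<in>strand (basis F 0) (fdeg F 0) t.
       Poly_Mapping.lookup p t = (\<Sum>q\<in>basis F 0. res_aug F q * w q))" for p
    unfolding res_aug_def
    using aug_image_iff[of F W p, OF free_resolution_aug[OF fr] free_resolution_degrees[OF fr]]
    by (simp add: free_resolution_image[OF fr])
  show ?thesis
  proof
    show "finite W" by fact
    show "cyc (Suc (Suc n)) {} V \<subseteq> bnd (Suc (Suc n)) {} V" if V: "V \<subseteq> W" for V n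
    proof
      fix u assume "u \<in> cyc (Suc (Suc n)) {} V"
      hence u: "u \<in> ch (Suc (Suc n)) {} V" "bd (Suc n) {} u = 0" by auto
      hence "u \<in> {u \<in> strand (basis F (Suc n)) (fdeg F (Suc n)) (squarefree_mon V).
          mat_map (basis F n) (basis F (Suc n)) (res_scalars F n) u = (\<lambda>_. 0)}"
        using bd_eq[OF u(1)] by (simp add: strand_ch[OF V] zero_fun_def)
      then obtain w where "w \<in> ch (Suc (Suc (Suc n))) {} V"
        "u = mat_map (basis F (Suc n)) (basis F (Suc (Suc n))) (res_scalars F (Suc n)) w"
        unfolding strands_exact[OF fr keysV[OF V], symmetric] unfolding strand_ch[OF V] by blast
      thus "u \<in> bnd (Suc (Suc n)) {} V" using bd_eq by (auto simp: bnd_def)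
    qed
    show "bnd 1 {} V = {u \<in> ch 1 {} V. (\<Sum>q\<in>res_idx F 1. res_aug F q * u q) = 0}" if V: "V \<subseteq> W" for V
    proof -
      have "bnd 1 {} V = mat_map (basis F 0) (basis F (Suc 0)) (res_scalars F 0) ` ch (Suc (Suc 0)) {} V"
        unfolding bnd_def using bd_eq[of _ 0 V] by (intro image_cong) auto
      also have "\<dots> = {u \<in> ch 1 {} V. (\<Sum>q\<in>basis F 0. res_aug F q * u q) = 0}"
        using strands_exact_0[OF fr keysV[OF V]] by (simp add: strand_ch[OF V])
      finally show ?thesis using aug_sum by auto
    qed
    show "\<exists>u\<in>ch 1 {} V. (\<Sum>q\<in>res_idx F 1. res_aug F q * u q) = 1" if V: "V \<subseteq> W" and e: "e \<in> E" "e \<subseteq> V" for V e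
    proof -
      let ?p = "Poly_Mapping.single (squarefree_mon V) (1::'k)"
      have "?p \<in> edge_ideal W E"
        unfolding edge_ideal_iff[OF W] using e keysV[OF V] keys_squarefree_mon[OF finite_subset[OF V W(1)]]
        by (auto intro!: poly_ring_single)
      then obtain w where "w \<in> strand (basis F 0) (fdeg F 0) (squarefree_mon V)"
        "Poly_Mapping.lookup ?p (squarefree_mon V) = (\<Sum>q\<in>basis F 0. res_aug F q * w q)"
        unfolding image by blast
      thus ?thesis using aug_sum strand_ch[OF V, of 0] by auto
    qed
    show "(\<Sum>q\<in>res_idx F 1. res_aug F q * u q) = 0"
      if V: "V \<subseteq> W" and e: "\<forall>e\<in>E. \<not> e \<subseteq> V" and u: "u \<in> ch 1 {} V" for V u
    proof (rule ccontr)
      let ?c = "\<Sum>q\<in>res_idx F 1. res_aug F q * u q"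
      let ?p = "Poly_Mapping.single (squarefree_mon V) ?c"
      assume c: "?c \<noteq> 0"
      have "\<exists>w\<in>strand (basis F 0) (fdeg F 0) t.
          Poly_Mapping.lookup ?p t = (\<Sum>q\<in>basis F 0. res_aug F q * w q)" for t
      proof (cases "t = squarefree_mon V")
        case True
        thus ?thesis using u aug_sum[OF u] strand_ch[OF V, of 0] by (intro bexI[of _ u]) auto
      next
        case False
        thus ?thesis by (intro bexI[of _ "\<lambda>_. 0"]) (auto simp: strand_def lookup_single when_def)
      qed
      moreover have "?p \<in> poly_ring W" using keysV[OF V] by (rule poly_ring_single)
      ultimately have "?p \<in> edge_ideal W E" unfolding image by blast
      hence "\<exists>e\<in>E. e \<subseteq> Poly_Mapping.keys (squarefree_mon V)"
        unfolding edge_ideal_iff[OF W] using c by simp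
      thus False using e keys_squarefree_mon[OF finite_subset[OF V W(1)]] by simp
    qed
  qed
qed

text \<open>
  Between generators of the same degree an entry of the differential is constant, so its scalar is
  its constant term. Between generators of different degree the constant term is zero.
\<close>
lemma tor_homology_eq_hdim:
  fixes F :: "('v, 'k::field) free_complex"
  assumes W: "finite W" "E \<subseteq> Pow W" and fr: "free_resolution W (edge_ideal W E) F" and U: "U \<subseteq> W"
  shows "vdim (tor_cycles F (squarefree_mon U) i) - vdim (tor_boundaries F (squarefree_mon U) i) =
    filtered_complex.hdim (res_idx F) (res_deg F) (res_coeff F) (Suc i) U U"
proof -
  interpret edge_complex "res_idx F" "res_deg F" "res_coeff F" "res_aug F" W E
    by (rule resolution_edge_complex[OF W fr])
  have finU: "finite U" using U W(1) by (rule finite_subset)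
  have degU: "fdeg F i j = squarefree_mon U \<longleftrightarrow>
      fdeg F i j = squarefree_mon (Poly_Mapping.keys (fdeg F i j)) \<and> U = Poly_Mapping.keys (fdeg F i j)" for i j
    using keys_squarefree_mon[OF finU] by metis
  have chains: "tor_chains F (squarefree_mon U) i = ch (Suc i) U U" for i
    unfolding tor_chains_def ch_def res_idx_def res_deg_def degU by auto
  have bdry: "tor_bdry F i u = bd (Suc i) U u" if u: "u \<in> ch (Suc (Suc i)) U U" for i u
  proof
    fix p
    have "fdeg F (Suc i) q = squarefree_mon U" if "u q \<noteq> 0" for q
      using u that unfolding chains[symmetric] tor_chains_def by blast
    moreover have "q \<in> res_idx F (Suc (Suc i))" if "u q \<noteq> 0" for q
      using u that unfolding ch_def by blast
    ultimately have uq: "fdeg F (Suc i) q = squarefree_mon U" "q \<in> res_idx F (Suc (Suc i))"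
      if "u q \<noteq> 0" for q using that by blast+
    show "tor_bdry F i u p = bd (Suc i) U u p"
    proof (cases "p \<in> basis F i \<and> fdeg F i p = squarefree_mon U")
      case True
      hence p: "p \<in> res_idx F (Suc i)" "U \<subseteq> res_deg F (Suc i) p"
        using degU[of i p] by (auto simp: res_idx_def res_deg_def)
      have "(\<Sum>q\<in>basis F (Suc i). Poly_Mapping.lookup (bdry F i p q) 0 * u q) =
        (\<Sum>q\<in>res_idx F (Suc (Suc i)). Poly_Mapping.lookup (bdry F i p q) 0 * u q)"
        using uq free_resolution_finite[OF fr]
        by (intro sum.mono_neutral_right) (auto simp: res_idx_def)
      also have "\<dots> = (\<Sum>q\<in>res_idx F (Suc (Suc i)). res_coeff F (Suc i) p q * u q)"
      proof (intro sum.cong refl)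
        fix q assume q: "q \<in> res_idx F (Suc (Suc i))"
        show "Poly_Mapping.lookup (bdry F i p q) 0 * u q = res_coeff F (Suc i) p q * u q"
        proof (cases "u q = 0")
          case False
          thus ?thesis using uq(1)[OF False] True p(1) q by (simp add: res_coeff_def res_scalars_def scalars_def)
        qed simp
      qed
      finally show ?thesis using True p by (simp add: tor_bdry_def bd_def)
    next
      case False
      have "Poly_Mapping.lookup (bdry F i p q) 0 * u q = 0" if p: "p \<in> basis F i" and q: "q \<in> basis F (Suc i)" for q
      proof (rule ccontr)
        assume "Poly_Mapping.lookup (bdry F i p q) 0 * u q \<noteq> 0"
        hence "u q \<noteq> 0" "0 \<in> Poly_Mapping.keys (bdry F i p q)" by (auto simp: in_keys_iff)
        hence "0 + fdeg F i p = squarefree_mon U"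
          using free_resolution_graded[OF fr] p q uq(1) unfolding graded_matrix_def by metis
        thus False using False p by simp
      qed
      hence "(\<Sum>q\<in>basis F (Suc i). Poly_Mapping.lookup (bdry F i p q) 0 * u q) = 0" if "p \<in> basis F i"
        using that by (intro sum.neutral ballI) blast
      hence "tor_bdry F i u p = 0" by (simp add: tor_bdry_def)
      moreover have "bd (Suc i) U u \<in> ch (Suc i) U U" using bd_in_ch[OF u] .
      hence "bd (Suc i) U u p = 0" using False unfolding chains[symmetric] tor_chains_def by blast
      ultimately show ?thesis by simp
    qed
  qed
  have "tor_cycles F (squarefree_mon U) i = cyc (Suc i) U U"
  proof (cases i)
    case 0
    thus ?thesis using cyc_1[of U U] by (simp add: chains)
  next
    case (Suc j)
    thus ?thesis using bdry by (auto simp: chains zero_fun_def)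
  qed
  moreover have "tor_boundaries F (squarefree_mon U) i = bnd (Suc i) U U"
    unfolding tor_boundaries_def bnd_def chains using bdry by (intro image_cong) auto
  ultimately show ?thesis by (simp add: hdim_def)
qed

lemma betti_row_eq_sum_hdim:
  assumes bip: "bipartite_graph X Y E"
  obtains F :: "('v, 'k::field) free_complex" where
    "bipartite_complex (res_idx F) (res_deg F) (res_coeff F) (res_aug F) X Y E"
    "\<And>i X'. X' \<subseteq> X \<Longrightarrow> betti_row X Y (edge_ideal (X \<union> Y) E :: ('v, 'k) pol set) i X' =
      (\<Sum>Y'\<in>Pow Y. filtered_complex.hdim (res_idx F) (res_deg F) (res_coeff F) (Suc i) (X' \<union> Y') (X' \<union> Y'))"
proof -
  have W: "finite (X \<union> Y)" "E \<subseteq> Pow (X \<union> Y)" using bip by (auto simp: bipartite_graph_def)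
  let ?I = "edge_ideal (X \<union> Y) E :: ('v, 'k) pol set"
  define F where "F = (SOME F. free_resolution (X \<union> Y) ?I F)"
  have fr: "free_resolution (X \<union> Y) ?I F"
    unfolding F_def using edge_ideal_has_resolution[OF W] by (rule someI_ex)
  show thesis
  proof (rule that[of F])
    show "bipartite_complex (res_idx F) (res_deg F) (res_coeff F) (res_aug F) X Y E"
      using resolution_edge_complex[OF W fr] bip
      by (simp add: bipartite_complex_def bipartite_complex_axioms_def)
    fix i X' assume "X' \<subseteq> X"
    hence "X' \<union> Y' \<subseteq> X \<union> Y" if "Y' \<in> Pow Y" for Y' using that by auto
    thus "betti_row X Y ?I i X' =
      (\<Sum>Y'\<in>Pow Y. filtered_complex.hdim (res_idx F) (res_deg F) (res_coeff F) (Suc i) (X' \<union> Y') (X' \<union> Y'))"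
      unfolding betti_row_def betti_def Let_def F_def[symmetric]
      by (intro sum.cong refl tor_homology_eq_hdim[OF W fr])
  qed
qed

section \<open>Rows and transversals\<close>

lemma vdeg_eq_card_row:
  assumes "bipartite_graph X Y E" "x \<in> X"
  shows "vdeg E x = card (row Y E x)"
proof -
  have XY: "X \<inter> Y = {}" and E: "E \<subseteq> {{x, y} | x y. x \<in> X \<and> y \<in> Y}"
    using assms(1) by (auto simp: bipartite_graph_def)
  have "{e \<in> E. x \<in> e} = (\<lambda>y. {x, y}) ` row Y E x"
  proof
    show "{e \<in> E. x \<in> e} \<subseteq> (\<lambda>y. {x, y}) ` row Y E x"
    proof
      fix e assume "e \<in> {e \<in> E. x \<in> e}"
      hence e: "e \<in> E" "x \<in> e" by auto
      then obtain a b where ab: "e = {a, b}" "a \<in> X" "b \<in> Y" using E by blast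
      hence "a = x" using e(2) assms(2) XY by blast
      thus "e \<in> (\<lambda>y. {x, y}) ` row Y E x" using ab e by (auto simp: row_def)
    qed
  qed (auto simp: row_def)
  moreover have "inj_on (\<lambda>y. {x, y}) (row Y E x)" by (auto simp: inj_on_def doubleton_eq_iff)
  ultimately show ?thesis by (simp add: vdeg_def card_image)
qed

lemma finite_row: "finite Y \<Longrightarrow> finite (row Y E x)"
  by (simp add: row_def)

lemma hits_iff_row: "U \<subseteq> Y \<Longrightarrow> hits E X' U \<longleftrightarrow> (\<forall>x\<in>X'. row Y E x \<inter> U \<noteq> {})"
  unfolding hits_def row_def by blast

lemma mindeg_properties:
  assumes bip: "bipartite_graph X Y E" and X': "X' \<subseteq> X" "X' \<noteq> {}"
  shows "\<exists>x\<in>X'. card (row Y E x) = mindeg E X'" "x \<in> X' \<Longrightarrow> mindeg E X' \<le> card (row Y E x)"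
proof -
  have fin: "finite X'" using bip X'(1) finite_subset by (auto simp: bipartite_graph_def)
  have v: "vdeg E x = card (row Y E x)" if "x \<in> X'" for x
    using vdeg_eq_card_row[OF bip] that X'(1) by blast
  have "mindeg E X' \<in> vdeg E ` X'" unfolding mindeg_def using fin X'(2) by (intro Min_in) auto
  thus "\<exists>x\<in>X'. card (row Y E x) = mindeg E X'" using v by force
  show "mindeg E X' \<le> card (row Y E x)" if "x \<in> X'"
    unfolding mindeg_def v[OF that, symmetric] using fin that by (intro Min_le) auto
qed

text \<open>
  Longer rows contain the shortest ones and may be ignored. The common part \<open>Q\<close> of all rows of minimal
  size \<open>c\<close> has size \<open>c\<close> or \<open>c - 1\<close>. If it has size \<open>c - 1\<close>, each such row is \<open>Q\<close> with one more vertex, and these vertices form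
  \<open>B\<close>. If it has size \<open>c\<close>, the rows coincide, and any vertex of \<open>Q\<close> may be singled out to form \<open>B\<close>.
\<close>
lemma nearly_row_nested_sunflower:
  assumes bip: "bipartite_graph X Y E" and X': "X' \<subseteq> X" "X' \<noteq> {}" and nn: "nearly_row_nested X Y E"
  shows "(mindeg E X' = 0 \<and> (\<forall>U\<subseteq>Y. \<not> hits E X' U)) \<or>
    (\<exists>A B. A \<subseteq> Y \<and> B \<subseteq> Y \<and> B \<noteq> {} \<and> A \<inter> B = {} \<and> Suc (card A) = mindeg E X' \<and>
      (\<forall>U\<subseteq>Y. hits E X' U \<longleftrightarrow> U \<inter> A \<noteq> {} \<or> B \<subseteq> U))"
proof -
  define r where "r = row Y E"
  define c where "c = mindeg E X'"
  define K where "K = {x \<in> X'. card (r x) = c}"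
  define Q where "Q = (\<Inter>x\<in>{x \<in> X. card (r x) = c}. r x)"
  have finY: "finite Y" using bip by (simp add: bipartite_graph_def)
  have rY: "r x \<subseteq> Y" for x by (auto simp: r_def row_def)
  have finr: "finite (r x)" for x using rY finY finite_subset by blast
  obtain x0 where x0: "x0 \<in> X'" "card (r x0) = c"
    using mindeg_properties(1)[OF bip X'] by (auto simp: r_def c_def)
  have x0X: "x0 \<in> X" using x0 X' by blast
  have le: "c \<le> card (r x)" if "x \<in> X'" for x using mindeg_properties(2)[OF bip X' that] by (simp add: r_def c_def)
  have K: "K \<subseteq> X" "x0 \<in> K" using X' x0 by (auto simp: K_def)
  have hitsK: "hits E X' U \<longleftrightarrow> (\<forall>x\<in>K. r x \<inter> U \<noteq> {})" if U: "U \<subseteq> Y" for U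
  proof
    assume R: "\<forall>x\<in>K. r x \<inter> U \<noteq> {}"
    have "r x \<inter> U \<noteq> {}" if x: "x \<in> X'" for x
    proof (cases "card (r x) = c")
      case True
      thus ?thesis using R x by (auto simp: K_def)
    next
      case False
      hence "card (r x0) < card (r x)" using le[OF x] x0(2) by simp
      hence "r x0 \<subset> r x" using nn x0X x X' unfolding nearly_row_nested_def r_def by blast
      thus ?thesis using R K(2) by blast
    qed
    thus "hits E X' U" using hits_iff_row[OF U] by (simp add: r_def)
  next
    assume "hits E X' U"
    thus "\<forall>x\<in>K. r x \<inter> U \<noteq> {}" using hits_iff_row[OF U] by (auto simp: r_def K_def)
  qed
  have Qr: "Q \<subseteq> r x" if "x \<in> K" for x using that K(1) by (auto simp: Q_def K_def)
  have QY: "Q \<subseteq> Y" using Qr[OF K(2)] rY by blast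
  have finQ: "finite Q" using QY finY finite_subset by blast
  have "c \<in> (\<lambda>x. card (row Y E x)) ` X" using x0 x0X by (auto simp: r_def)
  hence "int (card Q) \<in> {int c - 1, int c}"
    using nn unfolding nearly_row_nested_def Q_def r_def by blast
  hence "card Q = c \<or> Suc (card Q) = c" by fastforce
  then consider "card Q = c" "c = 0" | "card Q = c" "c > 0" | "Suc (card Q) = c"
    by (metis neq0_conv)
  thus ?thesis
  proof cases
    case 1
    hence "r x0 = {}" using x0(2) finr by simp
    hence "\<not> hits E X' U" if "U \<subseteq> Y" for U using hitsK[OF that] K(2) by blast
    thus ?thesis using 1 by (simp add: c_def)
  next
    case 2
    have rQ: "r x = Q" if "x \<in> K" for x
      using card_subset_eq[OF finr Qr[OF that]] 2(1) that by (simp add: K_def)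
    obtain d where d: "d \<in> Q" using 2 by fastforce
    have "hits E X' U \<longleftrightarrow> U \<inter> (Q - {d}) \<noteq> {} \<or> {d} \<subseteq> U" if "U \<subseteq> Y" for U
      unfolding hitsK[OF that] using rQ K(2) d by auto
    moreover have "Suc (card (Q - {d})) = c" using d finQ 2 by (simp add: card_Suc_Diff1)
    moreover have "Q - {d} \<subseteq> Y" "{d} \<subseteq> Y" "{d} \<noteq> {}" "(Q - {d}) \<inter> {d} = {}"
      using d QY by auto
    ultimately show ?thesis unfolding c_def
      by (intro disjI2 exI[of _ "Q - {d}"] exI[of _ "{d}"] conjI allI impI)
  next
    case 3
    have "\<exists>d. r x = insert d Q \<and> d \<notin> Q" if x: "x \<in> K" for x
    proof -
      have "card (r x - Q) = 1" using card_Diff_subset[OF finQ Qr[OF x]] 3 x by (simp add: K_def)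
      then obtain d where "r x - Q = {d}" by (auto simp: card_1_singleton_iff)
      thus ?thesis using Qr[OF x] by blast
    qed
    hence "\<forall>x\<in>K. \<exists>d. r x = insert d Q \<and> d \<notin> Q" by blast
    from bchoice[OF this] obtain g where g: "\<And>x. x \<in> K \<Longrightarrow> r x = insert (g x) Q \<and> g x \<notin> Q"
      by blast
    have "hits E X' U \<longleftrightarrow> U \<inter> Q \<noteq> {} \<or> g ` K \<subseteq> U" if "U \<subseteq> Y" for U
    proof -
      have "r x \<inter> U \<noteq> {} \<longleftrightarrow> U \<inter> Q \<noteq> {} \<or> g x \<in> U" if "x \<in> K" for x
        using g[OF that] by auto
      thus ?thesis unfolding hitsK[OF that] using K(2) by auto
    qed
    moreover have "g ` K \<subseteq> Y"
    proof
      fix y assume "y \<in> g ` K"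
      then obtain x where "x \<in> K" "y = g x" by blast
      thus "y \<in> Y" using g[of x] rY[of x] by simp
    qed
    moreover have "g ` K \<noteq> {}" "Q \<inter> g ` K = {}" using g K(2) by auto
    ultimately show ?thesis using QY 3 unfolding c_def
      by (intro disjI2 exI[of _ Q] exI[of _ "g ` K"] conjI allI impI)
  qed
qed

lemma betti_row_nearly_row_nested:
  assumes bip: "bipartite_graph X Y E" and X': "X' \<subseteq> X" "X' \<noteq> {}" and nn: "nearly_row_nested X Y E"
  shows "betti_row X Y (edge_ideal (X \<union> Y) E :: ('v, 'k::field) pol set) i X' =
    (if card X' < i + 2 then mindeg E X' choose (i + 2 - card X') else 0)"
proof -
  obtain F :: "('v, 'k) free_complex" where
    F: "bipartite_complex (res_idx F) (res_deg F) (res_coeff F) (res_aug F) X Y E"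
    and betti: "\<And>i X'. X' \<subseteq> X \<Longrightarrow> betti_row X Y (edge_ideal (X \<union> Y) E :: ('v, 'k) pol set) i X' =
      (\<Sum>Y'\<in>Pow Y. filtered_complex.hdim (res_idx F) (res_deg F) (res_coeff F) (Suc i) (X' \<union> Y') (X' \<union> Y'))"
    using betti_row_eq_sum_hdim[OF bip] by blast
  interpret row_complex "res_idx F" "res_deg F" "res_coeff F" "res_aug F" X Y E X'
    using F X' by (simp add: row_complex_def row_complex_axioms_def)
  from nearly_row_nested_sunflower[OF bip X' nn] show ?thesis
  proof (elim disjE exE conjE)
    assume "mindeg E X' = 0" "\<forall>U\<subseteq>Y. \<not> hits E X' U"
    thus ?thesis using sum_hdim_no_transversal by (simp add: betti[OF X'(1)])
  next
    fix A B assume "A \<subseteq> Y" "B \<subseteq> Y" "B \<noteq> {}" "A \<inter> B = {}" and c: "Suc (card A) = mindeg E X'"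
      and "\<forall>U\<subseteq>Y. hits E X' U \<longleftrightarrow> U \<inter> A \<noteq> {} \<or> B \<subseteq> U"
    thus ?thesis using sum_hdim_sunflower[of A B i] by (simp add: betti[OF X'(1)])
  qed
qed

lemma card_minimal_transversals_le_betti_row:
  assumes bip: "bipartite_graph X Y E" and X': "X' \<subseteq> X" "X' \<noteq> {}"
  shows "card {U. U \<subseteq> Y \<and> minimal_transversal E X' U} \<le>
    betti_row X Y (edge_ideal (X \<union> Y) E :: ('v, 'k::field) pol set) (card X' - 1) X'"
proof -
  obtain F :: "('v, 'k) free_complex" where
    F: "bipartite_complex (res_idx F) (res_deg F) (res_coeff F) (res_aug F) X Y E"
    and betti: "\<And>i X'. X' \<subseteq> X \<Longrightarrow> betti_row X Y (edge_ideal (X \<union> Y) E :: ('v, 'k) pol set) i X' =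
      (\<Sum>Y'\<in>Pow Y. filtered_complex.hdim (res_idx F) (res_deg F) (res_coeff F) (Suc i) (X' \<union> Y') (X' \<union> Y'))"
    using betti_row_eq_sum_hdim[OF bip] by blast
  interpret row_complex "res_idx F" "res_deg F" "res_coeff F" "res_aug F" X Y E X'
    using F X' by (simp add: row_complex_def row_complex_axioms_def)
  have "finite X'" using X'(1) finite_X by (rule finite_subset)
  hence "Suc (card X' - 1) = card X'" using X'(2) by (simp add: card_gt_0_iff)
  thus ?thesis using card_minimal_transversals_le by (simp add: betti[OF X'(1)])
qed

section \<open>Few minimal transversals force near nestedness\<close>

lemma minimal_transversal_singleton:
  "(\<And>x. x \<in> X' \<Longrightarrow> y \<in> row Y E x) \<Longrightarrow> X' \<noteq> {} \<Longrightarrow> minimal_transversal E X' {y}"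
  by (auto simp: minimal_transversal_def hits_def row_def)

lemma minimal_transversal_pair:
  assumes "\<And>x. x \<in> X' \<Longrightarrow> row Y E x \<inter> {a, b} \<noteq> {}" "a \<in> Y" "b \<in> Y" "a \<noteq> b"
    and "x1 \<in> X'" "a \<notin> row Y E x1" "x2 \<in> X'" "b \<notin> row Y E x2"
  shows "minimal_transversal E X' {a, b}"
proof -
  have *: "insert a {b} - {a} = {b}" "insert a {b} - {b} = {a}" using assms(4) by auto
  have "hits E X' {a, b}" "\<not> hits E X' {a}" "\<not> hits E X' {b}"
    using assms hits_iff_row[of "{a,b}" Y E X'] hits_iff_row[of "{a}" Y E X'] hits_iff_row[of "{b}" Y E X']
    by blast+
  thus ?thesis by (simp add: minimal_transversal_def *)
qed

text \<open>
  The minimal transversals counted here are the vertices common to both rows and the pairs of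
  vertices that lie in one row each.
\<close>
lemma transversals_of_two_rows:
  fixes Y :: "'a set"
  assumes finY: "finite Y" and x: "x \<noteq> x'"
  shows "card (row Y E x \<inter> row Y E x') + card (row Y E x - row Y E x') * card (row Y E x' - row Y E x)
     \<le> card {U. U \<subseteq> Y \<and> minimal_transversal E {x, x'} U}"
proof -
  let ?R = "row Y E x" and ?R' = "row Y E x'"
  let ?S1 = "(\<lambda>y. {y}) ` (?R \<inter> ?R')" and ?S2 = "(\<lambda>(a, b). {a, b}) ` ((?R - ?R') \<times> (?R' - ?R))"
  have RY: "?R \<subseteq> Y" "?R' \<subseteq> Y" by (auto simp: row_def)
  have fin: "finite ?R" "finite ?R'" using finY by (simp_all add: finite_row)
  have "?S1 \<subseteq> {U. U \<subseteq> Y \<and> minimal_transversal E {x, x'} U}"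
    using RY minimal_transversal_singleton[of "{x, x'}" _ Y E] by auto
  moreover have "?S2 \<subseteq> {U. U \<subseteq> Y \<and> minimal_transversal E {x, x'} U}"
  proof clarsimp
    fix a b assume ab: "a \<in> ?R" "a \<notin> ?R'" "b \<in> ?R'" "b \<notin> ?R"
    have Y: "a \<in> Y" "b \<in> Y" "a \<noteq> b" using ab RY by blast+
    have "minimal_transversal E {x, x'} {a, b}"
    proof (rule minimal_transversal_pair[OF _ Y, of _ E x' x])
      show "row Y E z \<inter> {a, b} \<noteq> {}" if "z \<in> {x, x'}" for z using that ab by blast
    qed (use ab in simp_all)
    thus "a \<in> Y \<and> b \<in> Y \<and> minimal_transversal E {x, x'} {a, b}" using Y by simp
  qed
  moreover have "finite {U. U \<subseteq> Y \<and> minimal_transversal E {x, x'} U}"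
    by (rule finite_subset[of _ "Pow Y"]) (use finY in auto)
  ultimately have "card (?S1 \<union> ?S2) \<le> card {U. U \<subseteq> Y \<and> minimal_transversal E {x, x'} U}"
    by (intro card_mono Un_least)
  moreover have "card (?S1 \<union> ?S2) = card ?S1 + card ?S2"
  proof (rule card_Un_disjoint)
    show "?S1 \<inter> ?S2 = {}" by (auto simp: singleton_insert_inj_eq)
  qed (use fin in simp_all)
  moreover have "card ?S1 = card (?R \<inter> ?R')" by (intro card_image) auto
  moreover have "card ?S2 = card ((?R - ?R') \<times> (?R' - ?R))"
  proof (intro card_image inj_onI, clarify)
    fix a b c d assume "a \<notin> ?R'" "b \<in> ?R'" "c \<notin> ?R'" "d \<in> ?R'" and eq: "{a, b} = {c, d}"
    thus "a = c \<and> b = d" unfolding doubleton_eq_iff by blast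
  qed
  ultimately show ?thesis by (simp add: card_cartesian_product)
qed

text \<open>
  The rows are the set \<open>{t, a, b} \<union> Q\<close> with one of \<open>b\<close>, \<open>a\<close>, \<open>t\<close> removed. The vertices of \<open>Q\<close> and the three pairs of the
  other vertices are minimal transversals, and there are \<open>c + 1\<close> of them.
\<close>
lemma transversals_of_three_rows:
  assumes finY: "finite Y" and c: "card (row Y E x1) = c"
    and r1: "row Y E x1 = insert t (insert a Q)" and r2: "row Y E x2 = insert t (insert b Q)"
    and r3: "row Y E x3 = insert a (insert b Q)"
    and new: "t \<notin> Q" "a \<notin> Q" "b \<notin> Q" "t \<noteq> a" "t \<noteq> b" "a \<noteq> b"
  shows "c < card {U. U \<subseteq> Y \<and> minimal_transversal E {x1, x2, x3} U}"
proof -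
  let ?X = "{x1, x2, x3}"
  let ?M = "{U. U \<subseteq> Y \<and> minimal_transversal E ?X U}"
  let ?S = "insert {t, a} (insert {t, b} (insert {a, b} ((\<lambda>y. {y}) ` Q)))"
  have Y: "t \<in> Y" "a \<in> Y" "b \<in> Y" "Q \<subseteq> Y" using r1 r2 by (auto simp: row_def)
  have "minimal_transversal E ?X {y}" if "y \<in> Q" for y
    using that r1 r2 r3 by (intro minimal_transversal_singleton[of _ _ Y]) auto
  moreover have "minimal_transversal E ?X {t, a}"
  proof (rule minimal_transversal_pair[of _ Y E t a x3 x2])
    show "row Y E z \<inter> {t, a} \<noteq> {}" if "z \<in> ?X" for z
      using that r1 r2 r3 by blast
  qed (use r1 r2 r3 new Y in simp_all)
  moreover have "minimal_transversal E ?X {t, b}"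
  proof (rule minimal_transversal_pair[of _ Y E t b x3 x1])
    show "row Y E z \<inter> {t, b} \<noteq> {}" if "z \<in> ?X" for z
      using that r1 r2 r3 by blast
  qed (use r1 r2 r3 new Y in simp_all)
  moreover have "minimal_transversal E ?X {a, b}"
  proof (rule minimal_transversal_pair[of _ Y E a b x2 x1])
    show "row Y E z \<inter> {a, b} \<noteq> {}" if "z \<in> ?X" for z
      using that r1 r2 r3 by blast
  qed (use r1 r2 r3 new Y in simp_all)
  ultimately have "?S \<subseteq> ?M" using Y by auto
  moreover have "finite ?M" by (rule finite_subset[of _ "Pow Y"]) (use finY in auto)
  ultimately have "card ?S \<le> card ?M" by (intro card_mono)
  moreover have finQ: "finite Q" using Y(4) finY by (rule finite_subset)
  moreover have "card ?S = 3 + card ((\<lambda>y. {y}) ` Q)"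
  proof -
    have "{t, a} \<notin> insert {t, b} (insert {a, b} ((\<lambda>y. {y}) ` Q))"
      "{t, b} \<notin> insert {a, b} ((\<lambda>y. {y}) ` Q)" "{a, b} \<notin> (\<lambda>y. {y}) ` Q"
      using new by (auto simp: doubleton_eq_iff)
    hence "card ?S = Suc (Suc (Suc (card ((\<lambda>y. {y}) ` Q))))"
      using finQ by (simp only: card_insert_disjoint finite_insert finite_imageI not_False_eq_True simp_thms)
    thus ?thesis by linarith
  qed
  moreover have "card ((\<lambda>y. {y}) ` Q) = card Q" by (intro card_image) auto
  moreover have "c = 2 + card Q" using c r1 new finQ by simp
  ultimately show ?thesis by linarith
qed

text \<open>
  Two rows suffice for the nesting condition and show that rows of equal size \<open>c\<close> differ in at most one vertex.
  If two of these rows meet in \<open>A\<close>, of size \<open>c - 1\<close>, a third one that does not contain \<open>A\<close> must lie in their union;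
  that case is ruled out by the count for three rows. So all rows of size \<open>c\<close> contain \<open>A\<close>.
\<close>
lemma nearly_row_nested_if_few_transversals:
  assumes bip: "bipartite_graph X Y E"
    and few: "\<And>X'. X' \<subseteq> X \<Longrightarrow> X' \<noteq> {} \<Longrightarrow>
      card {U. U \<subseteq> Y \<and> minimal_transversal E X' U} \<le> mindeg E X'"
  shows "nearly_row_nested X Y E"
proof -
  define r where "r = row Y E"
  have finY: "finite Y" using bip by (simp add: bipartite_graph_def)
  have finr: "finite (r x)" for x using finY by (simp add: r_def finite_row)
  have min_le: "mindeg E X' \<le> card (r x)" if "X' \<subseteq> X" "x \<in> X'" for X' x
    using mindeg_properties(2)[OF bip that(1) _ that(2)] that(2) by (auto simp: r_def)
  have split: "card (r x) = card (r x \<inter> r x') + card (r x - r x')" for x x'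
    using finr by (metis card_Int_Diff)
  have two: "card (r x - r x') * card (r x' - r x) \<le> card (r x - r x')"
    if x: "x \<in> X" "x' \<in> X" "x \<noteq> x'" for x x'
  proof -
    have "card (r x \<inter> r x') + card (r x - r x') * card (r x' - r x) \<le>
        card {U. U \<subseteq> Y \<and> minimal_transversal E {x, x'} U}"
      unfolding r_def by (rule transversals_of_two_rows[OF finY x(3)])
    also have "\<dots> \<le> mindeg E {x, x'}" using x by (intro few) auto
    also have "\<dots> \<le> card (r x)" using x by (intro min_le) auto
    finally show ?thesis using split[of x x'] by linarith
  qed
  have nested: "r x \<subset> r x'" if x: "x \<in> X" "x' \<in> X" "card (r x) < card (r x')" for x x'
  proof -
    have "x \<noteq> x'" using x by auto
    have lt: "card (r x - r x') < card (r x' - r x)"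
      using x(3) split[of x x'] split[of x' x] by (simp add: Int_commute)
    have "card (r x - r x') = 0"
    proof (rule ccontr)
      assume n: "card (r x - r x') \<noteq> 0"
      hence "card (r x' - r x) \<ge> 2" using lt by linarith
      hence "card (r x - r x') * 2 \<le> card (r x - r x') * card (r x' - r x)" by (rule mult_le_mono2)
      thus False using two[OF x(1,2) \<open>x \<noteq> x'\<close>] n by linarith
    qed
    hence "r x \<subseteq> r x'" using finr by auto
    thus ?thesis using x(3) by auto
  qed
  have near: "card (r x - r x') \<le> 1" if x: "x \<in> X" "x' \<in> X" "card (r x) = card (r x')" for x x'
  proof (cases "x = x'")
    case False
    have "card (r x - r x') = card (r x' - r x)"
      using x(3) split[of x x'] split[of x' x] by (simp add: Int_commute)
    hence "card (r x - r x') * card (r x - r x') \<le> card (r x - r x')"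
      using two[OF x(1,2) False] by simp
    moreover have "n \<le> 1" if "n * n \<le> n" for n :: nat using that by (cases n) simp_all
    ultimately show ?thesis by blast
  qed simp
  have core: "int (card (\<Inter>x\<in>{x \<in> X. card (r x) = c}. r x)) \<in> {int c - 1, int c}"
    if c: "c \<in> (\<lambda>x. card (r x)) ` X" for c
  proof -
    define K where "K = {x \<in> X. card (r x) = c}"
    obtain x1 where x1: "x1 \<in> K" using c by (auto simp: K_def)
    have nearK: "card (r x - r x') \<le> 1" if "x \<in> K" "x' \<in> K" for x x' using near that by (simp add: K_def)
    have cK: "card (r x) = c" if "x \<in> K" for x using that by (simp add: K_def)
    show ?thesis
    proof (cases "\<forall>x\<in>K. r x = r x1")
      case True
      have "(\<Inter>x\<in>K. r x) = r x1"
      proof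
        show "(\<Inter>x\<in>K. r x) \<subseteq> r x1" using x1 by blast
        show "r x1 \<subseteq> (\<Inter>x\<in>K. r x)" using True by blast
      qed
      thus ?thesis using cK[OF x1] by (simp add: K_def)
    next
      case False
      then obtain x2 where x2: "x2 \<in> K" "r x2 \<noteq> r x1" by blast
      have diff: "\<exists>a. r x - r x' = {a}" if x: "x \<in> K" "x' \<in> K" "r x \<noteq> r x'" for x x'
      proof -
        have "\<not> r x \<subseteq> r x'" using card_subset_eq[OF finr, of "r x" x'] cK x by auto
        hence "card (r x - r x') \<noteq> 0" using finr by auto
        hence "card (r x - r x') = 1" using nearK[OF x(1,2)] by linarith
        thus ?thesis by (simp add: card_1_singleton_iff)
      qed
      obtain a where a: "r x1 - r x2 = {a}" using diff[of x1 x2] x1 x2 by metis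
      obtain b where b: "r x2 - r x1 = {b}" using diff[of x2 x1] x1 x2 by metis
      define A where "A = r x1 \<inter> r x2"
      have cA: "Suc (card A) = c" using split[of x1 x2] cK[OF x1] a by (simp add: A_def)
      have "A \<subseteq> r x3" if x3: "x3 \<in> K" for x3
      proof (rule ccontr)
        assume "\<not> A \<subseteq> r x3"
        then obtain t where t: "t \<in> r x1" "t \<in> r x2" "t \<notin> r x3" by (auto simp: A_def)
        have single: "r x - r x3 = {t}" if x: "x \<in> K" "t \<in> r x" for x
        proof -
          have "r x \<noteq> r x3" using x(2) t(3) by auto
          from diff[OF x(1) x3 this] obtain d where "r x - r x3 = {d}" ..
          moreover have "t \<in> r x - r x3" using x(2) t(3) by simp
          ultimately show ?thesis by auto
        qed
        have "r x1 - r x3 = {t}" "r x2 - r x3 = {t}"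
          using single[OF x1 t(1)] single[OF x2(1) t(2)] by blast+
        hence sub: "insert a (insert b (A - {t})) \<subseteq> r x3" using a b t unfolding A_def by blast
        have new: "t \<notin> A - {t}" "a \<notin> A - {t}" "b \<notin> A - {t}" "t \<noteq> a" "t \<noteq> b" "a \<noteq> b"
          using a b t unfolding A_def by blast+
        have finA: "finite A" using finr by (simp add: A_def)
        have "t \<in> A" using t by (simp add: A_def)
        hence "card (A - {t}) = card A - 1" "card A > 0" using finA by (auto simp: card_gt_0_iff)
        hence "card (insert a (insert b (A - {t}))) = c" using new finA cA by simp
        hence r3: "r x3 = insert a (insert b (A - {t}))"
          using card_subset_eq[OF finr sub] cK[OF x3] by simp
        have r12: "r x1 = insert t (insert a (A - {t}))" "r x2 = insert t (insert b (A - {t}))"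
          using a b t unfolding A_def by blast+
        have "c < card {U. U \<subseteq> Y \<and> minimal_transversal E {x1, x2, x3} U}"
          using transversals_of_three_rows[OF finY, of E x1 c t a "A - {t}" x2 b x3] cK[OF x1] r12 r3 new
          by (simp add: r_def)
        also have "\<dots> \<le> mindeg E {x1, x2, x3}" using x1 x2 x3 by (intro few) (auto simp: K_def)
        also have "\<dots> \<le> c" using min_le[of "{x1, x2, x3}" x1] cK[OF x1] x1 x2 x3 by (auto simp: K_def)
        finally show False by simp
      qed
      hence "(\<Inter>x\<in>K. r x) = A" using x1 x2(1) unfolding A_def by blast
      thus ?thesis using cA by (auto simp: K_def)
    qed
  qed
  show ?thesis
    unfolding nearly_row_nested_def using nested core unfolding r_def by blast
qed

section \<open>Row-nested companions\<close>

lemma row_nested_imp_nearly_row_nested: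
  assumes bip: "bipartite_graph X Y E" and rn: "row_nested X Y E"
  shows "nearly_row_nested X Y E"
proof -
  have fin: "finite (row Y E x)" for x using bip by (simp add: bipartite_graph_def finite_row)
  have eq: "row Y E x = row Y E x'" if "x \<in> X" "x' \<in> X" "card (row Y E x) = card (row Y E x')" for x x'
    using rn that card_subset_eq[OF fin] unfolding row_nested_def by metis
  have "row Y E x \<subset> row Y E x'"
    if "x \<in> X" "x' \<in> X" "card (row Y E x) < card (row Y E x')" for x x'
    using rn that card_mono[OF fin, of "row Y E x'" x] unfolding row_nested_def by fastforce
  moreover have "card (\<Inter>x\<in>{x \<in> X. card (row Y E x) = c}. row Y E x) = c"
    if c: "c \<in> (\<lambda>x. card (row Y E x)) ` X" for c
  proof -
    obtain x0 where x0: "x0 \<in> X" "card (row Y E x0) = c" using c by blast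
    have "(\<Inter>x\<in>{x \<in> X. card (row Y E x) = c}. row Y E x) = row Y E x0"
      using x0 eq by blast
    thus ?thesis using x0 by simp
  qed
  ultimately show ?thesis unfolding nearly_row_nested_def by simp
qed

lemma companion_exists:
  assumes bip: "bipartite_graph X Y E"
  shows "\<exists>Y'' R. is_row_nested_companion X E Y'' R"
proof -
  have XY: "finite X" "finite Y" "X \<inter> Y = {}" using bip by (auto simp: bipartite_graph_def)
  obtain f where f: "bij_betw f {0..<card Y} Y" using ex_bij_betw_nat_finite[OF XY(2)] by blast
  define R where "R = {{x, f j} | x j. x \<in> X \<and> j < vdeg E x}"
  have le: "vdeg E x \<le> card Y" if "x \<in> X" for x
    unfolding vdeg_eq_card_row[OF bip that] using XY(2) by (intro card_mono) (auto simp: row_def)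
  have fY: "f j \<in> Y" if "x \<in> X" "j < vdeg E x" for x j
    using le[OF that(1)] that(2) f by (auto simp: bij_betw_def)
  have bipR: "bipartite_graph X Y R"
    unfolding bipartite_graph_def R_def using XY fY by blast
  have rowR: "row Y R x = f ` {..<vdeg E x}" if x: "x \<in> X" for x
  proof
    show "row Y R x \<subseteq> f ` {..<vdeg E x}"
    proof
      fix y assume "y \<in> row Y R x"
      then obtain x' j where j: "y \<in> Y" "{x, y} = {x', f j}" "x' \<in> X" "j < vdeg E x'"
        by (auto simp: row_def R_def)
      moreover have "y \<noteq> x'" using j XY(3) by blast
      ultimately have "x = x'" "y = f j" by (auto simp: doubleton_eq_iff)
      thus "y \<in> f ` {..<vdeg E x}" using j by blast
    qed
    show "f ` {..<vdeg E x} \<subseteq> row Y R x" using x fY[OF x] by (auto simp: row_def R_def)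
  qed
  have "vdeg R x = vdeg E x" if x: "x \<in> X" for x
  proof -
    have "inj_on f {..<vdeg E x}"
      using f le[OF x] by (auto simp: bij_betw_def intro: inj_on_subset)
    thus ?thesis by (simp add: vdeg_eq_card_row[OF bipR x] rowR[OF x] card_image)
  qed
  moreover have "row_nested X Y R"
    unfolding row_nested_def
  proof (intro ballI)
    fix x x' assume x: "x \<in> X" "x' \<in> X"
    have "{..<vdeg E x} \<subseteq> {..<vdeg E x'} \<or> {..<vdeg E x'} \<subseteq> {..<vdeg E x}" by auto
    thus "row Y R x \<subseteq> row Y R x' \<or> row Y R x' \<subseteq> row Y R x"
      unfolding rowR[OF x(1)] rowR[OF x(2)] using image_mono by metis
  qed
  ultimately show ?thesis using bipR unfolding is_row_nested_companion_def by blast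
qed

text \<open>
  Insert the members in the order of their size. A new largest member contains all earlier ones in
  both chains, so the bijection between the unions is extended by any bijection between the two
  complements, which have the same size.
\<close>
lemma chains_of_finite_sets_isomorphic:
  assumes "finite S"
    and "\<And>x. x \<in> S \<Longrightarrow> finite (r1 x)" "\<And>x. x \<in> S \<Longrightarrow> finite (r2 x)"
    and "\<And>x. x \<in> S \<Longrightarrow> card (r1 x) = card (r2 x)"
    and "\<And>x x'. x \<in> S \<Longrightarrow> x' \<in> S \<Longrightarrow> r1 x \<subseteq> r1 x' \<or> r1 x' \<subseteq> r1 x"
    and "\<And>x x'. x \<in> S \<Longrightarrow> x' \<in> S \<Longrightarrow> r2 x \<subseteq> r2 x' \<or> r2 x' \<subseteq> r2 x"
  shows "\<exists>\<phi>. bij_betw \<phi> (\<Union>x\<in>S. r1 x) (\<Union>x\<in>S. r2 x) \<and> (\<forall>x\<in>S. \<phi> ` r1 x = r2 x)"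
  using assms
proof (induction S rule: finite_ranking_induct[where f = "\<lambda>x. card (r1 x)"])
  case empty
  show ?case by (simp add: bij_betw_def)
next
  case (insert x S)
  let ?U1 = "\<Union>x\<in>S. r1 x" and ?U2 = "\<Union>x\<in>S. r2 x"
  have "\<exists>\<phi>. bij_betw \<phi> ?U1 ?U2 \<and> (\<forall>s\<in>S. \<phi> ` r1 s = r2 s)"
  proof (rule insert.IH)
    fix s s' assume s: "s \<in> S" "s' \<in> S"
    show "r1 s \<subseteq> r1 s' \<or> r1 s' \<subseteq> r1 s" by (rule insert.prems(4)) (use s in simp_all)
    show "r2 s \<subseteq> r2 s' \<or> r2 s' \<subseteq> r2 s" by (rule insert.prems(5)) (use s in simp_all)
  qed (simp_all add: insert.prems(1-3))
  then obtain \<phi> where \<phi>: "bij_betw \<phi> ?U1 ?U2" "\<And>s. s \<in> S \<Longrightarrow> \<phi> ` r1 s = r2 s"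
    by blast
  have sub1: "r1 s \<subseteq> r1 x" if s: "s \<in> S" for s
  proof (cases "r1 s \<subseteq> r1 x")
    case False
    hence "r1 x \<subseteq> r1 s" using insert.prems(4)[of s x] s by blast
    thus ?thesis using card_seteq[of "r1 s" "r1 x"] insert.prems(1)[of s] insert.hyps(2)[OF s] s by auto
  qed
  have sub2: "r2 s \<subseteq> r2 x" if s: "s \<in> S" for s
  proof (cases "r2 s \<subseteq> r2 x")
    case False
    hence "r2 x \<subseteq> r2 s" using insert.prems(5)[of s x] s by blast
    moreover have "card (r2 s) \<le> card (r2 x)"
      using insert.hyps(2)[OF s] insert.prems(3)[of s] insert.prems(3)[of x] s by simp
    ultimately show ?thesis using card_seteq[of "r2 s" "r2 x"] insert.prems(2)[of s] s by auto
  qed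
  have U: "?U1 \<subseteq> r1 x" "?U2 \<subseteq> r2 x" using sub1 sub2 by blast+
  have fin: "finite (r1 x)" "finite (r2 x)" using insert.prems by auto
  have "card (r1 x - ?U1) = card (r2 x - ?U2)"
    using card_Diff_subset[OF finite_subset[OF U(1) fin(1)] U(1)]
      card_Diff_subset[OF finite_subset[OF U(2) fin(2)] U(2)]
      bij_betw_same_card[OF \<phi>(1)] insert.prems(3)[of x] by simp
  then obtain \<psi> where \<psi>: "bij_betw \<psi> (r1 x - ?U1) (r2 x - ?U2)"
    using fin finite_same_card_bij by blast
  define \<theta> where "\<theta> y = (if y \<in> ?U1 then \<phi> y else \<psi> y)" for y
  have t1: "bij_betw \<theta> ?U1 ?U2"
    using \<phi>(1) by (subst bij_betw_cong[of _ _ \<phi>]) (auto simp: \<theta>_def)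
  have t2: "bij_betw \<theta> (r1 x - ?U1) (r2 x - ?U2)"
    using \<psi> by (subst bij_betw_cong[of _ _ \<psi>]) (auto simp: \<theta>_def)
  have "bij_betw \<theta> (?U1 \<union> (r1 x - ?U1)) (?U2 \<union> (r2 x - ?U2))"
    by (rule bij_betw_combine[OF t1 t2]) auto
  hence bij: "bij_betw \<theta> (r1 x) (r2 x)" using U by (simp add: Un_absorb1)
  have "\<theta> ` r1 s = r2 s" if s: "s \<in> S" for s
  proof -
    have "\<theta> ` r1 s = \<phi> ` r1 s" using s by (intro image_cong) (auto simp: \<theta>_def)
    thus ?thesis using \<phi>(2)[OF s] by simp
  qed
  moreover have "\<theta> ` r1 x = r2 x" using bij by (simp add: bij_betw_def)
  moreover have "(\<Union>x\<in>insert x S. r1 x) = r1 x" "(\<Union>x\<in>insert x S. r2 x) = r2 x" using U by auto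
  ultimately show ?case using bij by (intro exI[of _ \<theta>]) auto
qed

lemma companion_unique:
  assumes "is_row_nested_companion X E Y1 R1" "is_row_nested_companion X E Y2 R2"
  shows "\<exists>\<phi>. bij_betw \<phi> (\<Union>x\<in>X. row Y1 R1 x) (\<Union>x\<in>X. row Y2 R2 x) \<and>
    (\<forall>x\<in>X. \<phi> ` row Y1 R1 x = row Y2 R2 x)"
proof (rule chains_of_finite_sets_isomorphic)
  have bip: "bipartite_graph X Y1 R1" "bipartite_graph X Y2 R2"
    and deg: "\<And>x. x \<in> X \<Longrightarrow> vdeg R1 x = vdeg E x" "\<And>x. x \<in> X \<Longrightarrow> vdeg R2 x = vdeg E x"
    and rn: "row_nested X Y1 R1" "row_nested X Y2 R2"
    using assms by (auto simp: is_row_nested_companion_def)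
  show "finite X" using bip(1) by (simp add: bipartite_graph_def)
  show "finite (row Y1 R1 x)" "finite (row Y2 R2 x)" for x
    using bip by (simp_all add: bipartite_graph_def finite_row)
  show "card (row Y1 R1 x) = card (row Y2 R2 x)" if "x \<in> X" for x
    using vdeg_eq_card_row[OF bip(1) that] vdeg_eq_card_row[OF bip(2) that] deg[OF that] by simp
  show "row Y1 R1 x \<subseteq> row Y1 R1 x' \<or> row Y1 R1 x' \<subseteq> row Y1 R1 x"
    "row Y2 R2 x \<subseteq> row Y2 R2 x' \<or> row Y2 R2 x' \<subseteq> row Y2 R2 x" if "x \<in> X" "x' \<in> X" for x x'
    using rn that unfolding row_nested_def by blast+
qed

lemma betti_row_companion:
  assumes comp: "is_row_nested_companion X E Y'' R" and X': "X' \<subseteq> X" "X' \<noteq> {}"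
  shows "betti_row X Y'' (edge_ideal (X \<union> Y'') R :: ('v, 'k::field) pol set) i X' =
      (if card X' < i + 2 then mindeg E X' choose (i + 2 - card X') else 0)"
proof -
  have bip: "bipartite_graph X Y'' R" and rn: "row_nested X Y'' R"
    and deg: "\<And>x. x \<in> X \<Longrightarrow> vdeg R x = vdeg E x"
    using comp by (auto simp: is_row_nested_companion_def)
  have "vdeg R ` X' = vdeg E ` X'" using deg X'(1) by (intro image_cong) auto
  hence "mindeg E X' = mindeg R X'" by (simp add: mindeg_def)
  thus ?thesis
    by (simp only: betti_row_nearly_row_nested[OF bip X' row_nested_imp_nearly_row_nested[OF bip rn]])
qed

theorem theorem4p18:
  fixes X Y :: "'v set" and E :: "'v set set"
  assumes "bipartite_graph X Y E"
  shows "(\<exists>Y'' R. is_row_nested_companion X E Y'' R) \<and>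
    (\<forall>Y1 R1 Y2 R2.
       is_row_nested_companion X E Y1 R1 \<longrightarrow> is_row_nested_companion X E Y2 R2 \<longrightarrow>
       (\<exists>\<phi>. bij_betw \<phi> (\<Union>x\<in>X. row Y1 R1 x) (\<Union>x\<in>X. row Y2 R2 x) \<and>
            (\<forall>x\<in>X. \<phi> ` row Y1 R1 x = row Y2 R2 x))) \<and>
    (\<forall>Y'' R. is_row_nested_companion X E Y'' R \<longrightarrow>
       (\<forall>i X'. X' \<subseteq> X \<longrightarrow> X' \<noteq> {} \<longrightarrow>
          betti_row X Y'' (edge_ideal (X \<union> Y'') R :: ('v, 'k::field) pol set) i X' =
          (if card X' < i + 2 then mindeg E X' choose (i + 2 - card X') else 0)) \<and>
       ((\<forall>i X'. X' \<subseteq> X \<longrightarrow> X' \<noteq> {} \<longrightarrow>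
           betti_row X Y (edge_ideal (X \<union> Y) E :: ('v, 'k) pol set) i X' =
           betti_row X Y'' (edge_ideal (X \<union> Y'') R :: ('v, 'k) pol set) i X')
        \<longleftrightarrow> nearly_row_nested X Y E))"
proof (intro conjI allI impI)
  show "\<exists>Y'' R. is_row_nested_companion X E Y'' R" by (rule companion_exists[OF assms])
next
  fix Y1 R1 Y2 R2
  assume "is_row_nested_companion X E Y1 R1" "is_row_nested_companion X E Y2 R2"
  thus "\<exists>\<phi>. bij_betw \<phi> (\<Union>x\<in>X. row Y1 R1 x) (\<Union>x\<in>X. row Y2 R2 x) \<and>
            (\<forall>x\<in>X. \<phi> ` row Y1 R1 x = row Y2 R2 x)"
    by (rule companion_unique)
next
  fix Y'' R i X'
  assume comp: "is_row_nested_companion X E Y'' R" and X': "X' \<subseteq> X" "X' \<noteq> {}"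
  thus "betti_row X Y'' (edge_ideal (X \<union> Y'') R :: ('v, 'k) pol set) i X' =
      (if card X' < i + 2 then mindeg E X' choose (i + 2 - card X') else 0)"
    by (rule betti_row_companion)
next
  fix Y'' R
  assume comp: "is_row_nested_companion X E Y'' R"
  show "(\<forall>i X'. X' \<subseteq> X \<longrightarrow> X' \<noteq> {} \<longrightarrow>
           betti_row X Y (edge_ideal (X \<union> Y) E :: ('v, 'k) pol set) i X' =
           betti_row X Y'' (edge_ideal (X \<union> Y'') R :: ('v, 'k) pol set) i X')
        \<longleftrightarrow> nearly_row_nested X Y E" (is "?L \<longleftrightarrow> ?N")
  proof
    assume L: ?L
    show ?N
    proof (rule nearly_row_nested_if_few_transversals[OF assms])
      fix X' assume X': "X' \<subseteq> X" "X' \<noteq> {}"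
      have "finite X'" using X'(1) assms finite_subset by (auto simp: bipartite_graph_def)
      hence pos: "card X' > 0" using X'(2) by (simp add: card_gt_0_iff)
      have "card {U. U \<subseteq> Y \<and> minimal_transversal E X' U} \<le>
          betti_row X Y (edge_ideal (X \<union> Y) E :: ('v, 'k) pol set) (card X' - 1) X'"
        by (rule card_minimal_transversals_le_betti_row[OF assms X'])
      also have "\<dots> = mindeg E X'"
        using L X' pos betti_row_companion[OF comp X', where 'k = 'k and i = "card X' - 1"]
        by (simp add: Suc_diff_Suc)
      finally show "card {U. U \<subseteq> Y \<and> minimal_transversal E X' U} \<le> mindeg E X'" .
    qed
  next
    assume ?N
    show ?L
    proof (intro allI impI)
      fix i X' assume X': "X' \<subseteq> X" "X' \<noteq> {}"
      show "betti_row X Y (edge_ideal (X \<union> Y) E :: ('v, 'k) pol set) i X' =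
           betti_row X Y'' (edge_ideal (X \<union> Y'') R :: ('v, 'k) pol set) i X'"
        by (simp only: betti_row_nearly_row_nested[OF assms X' \<open>?N\<close>] betti_row_companion[OF comp X'])
    qed
  qed
qed

end
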